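(* Let $\mathcal D$ be a dyadic lattice in $\mathbb{R}^N$ and let $T$ be a big Haar shift or a paraproduct (bounded in $L^2(\mathbb R^N)$) with respect to $\mathcal D$. Let $V,W$ be $d\times d$ matrix weights on $\mathbb{R}^N$ which satisfy the joint dyadic condition $[V,W]_{\mathbf A_2^{\mathcal D}}<\infty$ and which both satisfy the scalar dyadic $A_\infty^{\mathcal D}$ condition, i.e. $[V]_{A_\infty^{\mathcal D}}^{\mathrm{sc}}<\infty$ and $[W]_{A_\infty^{\mathcal D}}^{\mathrm{sc}}<\infty$. Then $$\| M_W^{1/2}\, T\, M_V^{1/2}\|_{L^2\to L^2}^2\le C\,[V]_{A_\infty^{\mathcal D}}^{\mathrm{sc}}\,[W]_{A_\infty^{\mathcal D}}^{\mathrm{sc}}\,[V,W]_{\mathbf A_2^{\mathcal D}},$$ where $C=C(T,N,d)$ depends only on $T$, $N$ and $d$ (not on $V,W$).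
   Context: $\mathbb F=\mathbb R$ or $\mathbb C$. A dyadic lattice is any translation of the standard dyadic lattice of cubes in $\mathbb R^N$. $\mathrm{ch}^k Q$ denotes the $k$-th generation dyadic descendants of $Q\in\mathcal D$ (so $\mathrm{ch}^0Q=\{Q\}$), and $\mathcal D(Q)=\{R\in\mathcal D:R\subset Q\}$. $\langle f\rangle_Q=|Q|^{-1}\int_Q f\,dx$, and $|\cdot|$ of a matrix is its operator norm. A ($d\times d$) matrix weight is a locally integrable function on $\mathbb R^N$ with values in the positive semidefinite $d\times d$ matrices. $[V,W]_{\mathbf A_2^{\mathcal D}}=[W,V]_{\mathbf A_2^{\mathcal D}}:=\sup_{Q\in\mathcal D}\bigl|\langle W\rangle_Q^{1/2}\langle V\rangle_Q^{1/2}\bigr|^2$. For $Q\in\mathcal D$ let $M_Qf(x)=\sup\{|\langle f\rangle_R|:R\in\mathcal D(Q),x\in R\}$ for $x\in Q$ and $0$ for $x\notin Q$. For a scalar weight $w$, $[w]_{A_\infty^{\mathcal D}}$ is the best constant $C$ in $\langle M_Qw\rangle_Q\le C\langle w\rangle_Q$ for all $Q\in\mathcal D$. For a matrix weight $W$, $[W]_{A_\infty^{\mathcal D}}^{\mathrm{sc}}:=\sup_{e\in\mathbb F^d}[w_e]_{A_\infty^{\mathcal D}}$, where $w_e(x)=(W(x)e,e)$. A generalized big Haar shift of complexity $r\ge0$ is an operator bounded in $L^2(\mathbb R^N)$ of the form $\sum_{Q\in\mathcal D}T_Q$, $T_Qf(x)=\int K_Q(x,y)f(y)\,dy$, where each kernel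 $K_Q$ is supported on $Q\times Q$, is constant on all $R\times S$ with $R,S\in\mathrm{ch}^{r+1}Q$, and satisfies $\|K_Q\|_\infty\le|Q|^{-1}$. It is a big Haar shift (without the word "generalized") if in addition $T_Q\mathbf 1_Q=0$ and $T_Q^*\mathbf 1_Q=0$ for all $Q\in\mathcal D$. For a locally integrable $b$, the paraproduct of order $r$ with symbol $b$ is $\Pi_b^rf=\sum_{Q\in\mathcal D}\langle f\rangle_Q\sum_{R\in\mathrm{ch}^rQ}\Delta_Rb$, where $\Delta_Rb=\sum_{S\in\mathrm{ch}^1R}\langle b\rangle_S\mathbf 1_S-\langle b\rangle_R\mathbf 1_R$. On vector-valued functions $T$ acts componentwise, i.e. as $T\otimes\mathbf I_d$. $M_W^{1/2}$ is multiplication by $W^{1/2}$, so $M_W^{1/2}TM_V^{1/2}f=W^{1/2}T(V^{1/2}f)$, and the norm is the operator norm on the unweighted $L^2(\mathbb R^N;\mathbb F^d)$ (the operator being defined initially on bounded compactly supported $f$, for which $V^{1/2}f\in L^2$). *)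

theory Defs
  imports "HOL-Analysis.Analysis"
begin

text \<open>
  The scalar field \<open>\<real>\<close> or \<open>\<complex>\<close>. The axioms leave no other models: see \<open>real_or_complex_cases\<close>.
\<close>

class real_or_complex = real_normed_field + euclidean_space +
  fixes fconj :: "'a \<Rightarrow> 'a"
  assumes fconj_add: "fconj (x + y) = fconj x + fconj y"
    and mult_fconj_scaleR: "x * fconj x = ((norm x)\<^sup>2) *\<^sub>R 1"

instantiation real :: real_or_complex
begin
definition fconj_real :: "real \<Rightarrow> real" where "fconj_real x = x"
instance by standard (simp_all add: fconj_real_def power2_eq_square)
end

instantiation complex :: real_or_complex
begin
definition fconj_complex :: "complex \<Rightarrow> complex" where "fconj_complex x = cnj x"
instance by standard (simp_all add: fconj_complex_def complex_norm_square[symmetric] scaleR_conv_of_real)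
end

lemma mult_fconj: "x * fconj x = of_real ((norm (x :: 'a::real_or_complex))\<^sup>2)"
  by (simp only: mult_fconj_scaleR of_real_def)

lemma fconj_zero [simp]: "fconj (0 :: 'a::real_or_complex) = 0"
  using fconj_add[of "0::'a" 0] by simp

lemma fconj_minus: "fconj (- x) = - fconj (x :: 'a::real_or_complex)"
  using fconj_add[of x "- x"] by (simp add: eq_neg_iff_add_eq_0 add.commute)

lemma fconj_diff: "fconj (x - y) = fconj x - fconj (y :: 'a::real_or_complex)"
  using fconj_add[of x "- y"] by (simp add: fconj_minus)

lemma fconj_mult: "fconj (x * y) = fconj x * fconj (y :: 'a::real_or_complex)"
proof (cases "x * y = 0")
  case False
  have "(x * y) * fconj (x * y) = (x * fconj x) * (y * fconj y)"
    by (simp add: mult_fconj norm_mult power_mult_distrib)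
  also have "\<dots> = (x * y) * (fconj x * fconj y)" by (simp add: mult_ac)
  finally show ?thesis using False by (metis mult_left_cancel)
qed auto

lemma norm_fconj: "norm (fconj x) = norm (x :: 'a::real_or_complex)"
proof (cases "x = 0")
  case False
  have "norm x * norm (fconj x) = norm x * norm x"
    using arg_cong[OF mult_fconj[of x], of norm]
    by (simp only: norm_mult) (simp add: power2_eq_square norm_mult)
  with False show ?thesis by simp
qed simp

lemma fconj_fconj [simp]: "fconj (fconj x) = (x :: 'a::real_or_complex)"
proof (cases "x = 0")
  case False
  have nz: "fconj x \<noteq> 0" using norm_fconj[of x] False by (metis norm_eq_zero)
  have "fconj x * fconj (fconj x) = fconj x * x"
    using mult_fconj[of "fconj x"] mult_fconj[of x] by (simp add: norm_fconj mult.commute)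
  with nz show ?thesis by (metis mult_left_cancel)
qed simp

lemma fconj_one [simp]: "fconj 1 = (1 :: 'a::real_or_complex)"
  using mult_fconj[of "1::'a"] by simp

lemma add_fconj_Reals: "x + fconj x \<in> (\<real> :: 'a::real_or_complex set)"
proof -
  have "(x + 1) * fconj (x + 1) - x * fconj x - 1 = x + fconj x"
    by (simp add: fconj_add algebra_simps)
  moreover have "(x + 1) * fconj (x + 1) - x * fconj x - 1 \<in> \<real>"
    unfolding mult_fconj by simp
  ultimately show ?thesis by simp
qed

lemma fconj_fixed_Reals: "x \<in> \<real>" if "fconj x = (x :: 'a::real_or_complex)"
proof -
  have "(x + fconj x) / 2 \<in> \<real>" using add_fconj_Reals[of x] by simp
  moreover have "(x + fconj x) / 2 = x" using that by simp
  ultimately show ?thesis by simp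
qed

lemma real_or_complex_cases:
  "(\<forall>x::'a::real_or_complex. x \<in> \<real>) \<or>
   (\<exists>i::'a. i * i = - 1 \<and> (\<forall>x. \<exists>a b. x = of_real a + of_real b * i))"
proof (rule disjCI)
  assume "\<not> (\<exists>i::'a. i * i = - 1 \<and> (\<forall>x. \<exists>a b. x = of_real a + of_real b * i))"
  note no_i = this
  have "z \<in> \<real>" for z :: 'a
  proof (rule ccontr)
    assume z: "z \<notin> \<real>"
    define w where "w = z - fconj z"
    have w0: "w \<noteq> 0" using z fconj_fixed_Reals[of z] by (auto simp: w_def)
    have cw: "fconj w = - w" by (simp add: w_def fconj_diff)
    define i where "i = w * of_real (inverse (norm w))"
    have "w * w = - of_real ((norm w)\<^sup>2)"
      using mult_fconj[of w] cw by (metis minus_minus mult_minus_right)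
    then have ii: "i * i = - 1"
      using w0 by (simp add: i_def field_simps power2_eq_square)
    have cr: "fconj (of_real r) = (of_real r :: 'a)" for r
    proof (cases "r = 0")
      case False
      have "of_real r * fconj (of_real r) = of_real r * (of_real r :: 'a)"
        using mult_fconj[of "of_real r :: 'a"] by (simp add: power2_eq_square flip: of_real_mult)
      with False show ?thesis by (metis mult_left_cancel of_real_eq_0_iff)
    qed simp
    have ci: "fconj i = - i"
      unfolding i_def fconj_mult cw cr by simp
    have "\<exists>a b. x = of_real a + of_real b * i" for x :: 'a
    proof -
      obtain a where a: "x + fconj x = of_real a" using add_fconj_Reals[of x] Reals_cases by blast
      define s where "s = x - fconj x"
      have "fconj (s * i) = s * i"
        by (simp add: fconj_mult ci s_def fconj_diff algebra_simps)
      then obtain b where b: "s * i = of_real b" using fconj_fixed_Reals Reals_cases by metis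
      have "s = - (s * i) * i" using ii by (simp add: mult.assoc)
      then have s: "s = - of_real b * i" using b by simp
      have "x = (of_real a + s) / 2" using a by (simp add: s_def flip: a)
      also have "\<dots> = of_real (a / 2) + of_real (- b / 2) * i"
        by (simp add: s add_divide_distrib)
      finally show ?thesis by blast
    qed
    with ii no_i show False by blast
  qed
  then show "\<forall>x::'a. x \<in> \<real>" by blast
qed


section \<open>Matrices\<close>

text \<open>
  For \<open>v, w\<close> in \<open>'k ^ 'd\<close> the library's \<open>v \<bullet> w\<close> is the real part of the \<open>'k\<close>-valued inner product;
  for Hermitian \<open>A\<close> the number \<open>(A v, v)\<close> is real, so \<open>(A *v v) \<bullet> v\<close> is its value.
\<close>

definition positive_semidefinite :: "'k::real_or_complex ^ 'd ^ 'd \<Rightarrow> bool" where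
  "positive_semidefinite A \<longleftrightarrow>
     (\<forall>i j. A $ i $ j = fconj (A $ j $ i)) \<and> (\<forall>v. 0 \<le> (A *v v) \<bullet> v)"

definition matrix_sqrt :: "'k::real_or_complex ^ 'd ^ 'd \<Rightarrow> 'k ^ 'd ^ 'd" where
  "matrix_sqrt A = (THE B. positive_semidefinite B \<and> B ** B = A)"

definition matrix_opnorm :: "'k::real_or_complex ^ 'd ^ 'd \<Rightarrow> real" where
  "matrix_opnorm A = onorm (\<lambda>v. A *v v)"


section \<open>Dyadic lattices and averages\<close>

definition standard_dyadic_cube :: "int \<Rightarrow> ('n \<Rightarrow> int) \<Rightarrow> (real ^ 'n) set" where
  "standard_dyadic_cube k m =
     {x. \<forall>i. of_int (m i) * 2 powi k \<le> x $ i \<and> x $ i < (of_int (m i) + 1) * 2 powi k}"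

definition dyadic_lattice :: "(real ^ 'n) set set \<Rightarrow> bool" where
  "dyadic_lattice D \<longleftrightarrow> (\<exists>a. D = {(\<lambda>x. x + a) ` standard_dyadic_cube k m | k m. True})"

text \<open>
  Passing to the next generation halves the side length, hence divides the volume by
  \<open>2 ^ CARD('n)\<close>; in a dyadic lattice this determines the generation of a subcube.
\<close>

definition descendants :: "(real ^ 'n) set set \<Rightarrow> nat \<Rightarrow> (real ^ 'n) set \<Rightarrow> (real ^ 'n) set set" where
  "descendants D k Q =
     {R \<in> D. R \<subseteq> Q \<and> measure lebesgue Q = 2 ^ (k * CARD('n)) * measure lebesgue R}"

definition average :: "(real ^ 'n) set \<Rightarrow> (real ^ 'n \<Rightarrow> 'b::euclidean_space) \<Rightarrow> 'b" where
  "average Q f = (1 / measure lebesgue Q) *\<^sub>R (LINT x:Q|lebesgue. f x)"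

definition locally_integrable :: "(real ^ 'n \<Rightarrow> 'b::euclidean_space) \<Rightarrow> bool" where
  "locally_integrable f \<longleftrightarrow> (\<forall>K. compact K \<longrightarrow> f absolutely_integrable_on K)"


section \<open>Matrix weights and their characteristics\<close>

definition matrix_weight :: "(real ^ 'n \<Rightarrow> 'k::real_or_complex ^ 'd ^ 'd) \<Rightarrow> bool" where
  "matrix_weight W \<longleftrightarrow> locally_integrable W \<and> (\<forall>x. positive_semidefinite (W x))"

definition joint_A2 ::
  "(real ^ 'n) set set \<Rightarrow> (real ^ 'n \<Rightarrow> 'k::real_or_complex ^ 'd ^ 'd) \<Rightarrow>
   (real ^ 'n \<Rightarrow> 'k ^ 'd ^ 'd) \<Rightarrow> ennreal" where
  "joint_A2 D V W =
     (SUP Q\<in>D. ennreal ((matrix_opnorm (matrix_sqrt (average Q W) ** matrix_sqrt (average Q V)))\<^sup>2))"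

definition local_maximal ::
  "(real ^ 'n) set set \<Rightarrow> (real ^ 'n) set \<Rightarrow> (real ^ 'n \<Rightarrow> real) \<Rightarrow> real ^ 'n \<Rightarrow> ennreal" where
  "local_maximal D Q f x =
     (if x \<in> Q then SUP R\<in>{R \<in> D. R \<subseteq> Q \<and> x \<in> R}. ennreal \<bar>average R f\<bar> else 0)"

text \<open>The average of the maximal function is a possibly infinite integral of a nonnegative function.\<close>

definition A_infinity :: "(real ^ 'n) set set \<Rightarrow> (real ^ 'n \<Rightarrow> real) \<Rightarrow> ennreal" where
  "A_infinity D w =
     Inf {C. \<forall>Q\<in>D. (\<integral>\<^sup>+x\<in>Q. local_maximal D Q w x \<partial>lebesgue) / ennreal (measure lebesgue Q)
                   \<le> C * ennreal (average Q w)}"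

definition scalar_A_infinity ::
  "(real ^ 'n) set set \<Rightarrow> (real ^ 'n \<Rightarrow> 'k::real_or_complex ^ 'd ^ 'd) \<Rightarrow> ennreal" where
  "scalar_A_infinity D W = (SUP e. A_infinity D (\<lambda>x. (W x *v e) \<bullet> e))"


section \<open>Operators on \<open>L\<^sup>2\<close>\<close>

definition in_L2 :: "(real ^ 'n \<Rightarrow> 'b::euclidean_space) \<Rightarrow> bool" where
  "in_L2 f \<longleftrightarrow> f \<in> borel_measurable lebesgue \<and> integrable lebesgue (\<lambda>x. (norm (f x))\<^sup>2)"

definition L2_norm :: "(real ^ 'n \<Rightarrow> 'b::euclidean_space) \<Rightarrow> real" where
  "L2_norm f = sqrt (LINT x|lebesgue. (norm (f x))\<^sup>2)"

definition L2_bounded ::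
  "((real ^ 'n \<Rightarrow> 'k::real_or_complex) \<Rightarrow> real ^ 'n \<Rightarrow> 'k) \<Rightarrow> bool" where
  "L2_bounded T \<longleftrightarrow> (\<exists>B. \<forall>f. in_L2 f \<longrightarrow> in_L2 (T f) \<and> L2_norm (T f) \<le> B * L2_norm f)"

text \<open>
  The series \<open>\<Sum>Q\<in>D. T_Q f\<close> converges unconditionally in \<open>L\<^sup>2\<close> to \<open>T f\<close> for every \<open>f\<close> in \<open>L\<^sup>2\<close>.
  For big Haar shifts, and for paraproducts bounded in \<open>L\<^sup>2\<close>, this mode of convergence is
  automatic: the sum is orthogonal, or splits into finitely many orthogonal sums.
\<close>

definition L2_operator_sum ::
  "(real ^ 'n) set set \<Rightarrow>
   ((real ^ 'n) set \<Rightarrow> (real ^ 'n \<Rightarrow> 'k::real_or_complex) \<Rightarrow> real ^ 'n \<Rightarrow> 'k) \<Rightarrow>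
   ((real ^ 'n \<Rightarrow> 'k) \<Rightarrow> real ^ 'n \<Rightarrow> 'k) \<Rightarrow> bool" where
  "L2_operator_sum D TQ T \<longleftrightarrow>
     (\<forall>f. in_L2 f \<longrightarrow>
        ((\<lambda>F. L2_norm (\<lambda>x. T f x - (\<Sum>Q\<in>F. TQ Q f x))) \<longlongrightarrow> 0) (finite_subsets_at_top D))"

definition kernel_operator ::
  "(real ^ 'n \<Rightarrow> real ^ 'n \<Rightarrow> 'k::real_or_complex) \<Rightarrow> (real ^ 'n \<Rightarrow> 'k) \<Rightarrow> real ^ 'n \<Rightarrow> 'k" where
  "kernel_operator K f x = (LINT y|lebesgue. K x y * f y)"

definition adjoint_kernel ::
  "(real ^ 'n \<Rightarrow> real ^ 'n \<Rightarrow> 'k::real_or_complex) \<Rightarrow> real ^ 'n \<Rightarrow> real ^ 'n \<Rightarrow> 'k" where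
  "adjoint_kernel K x y = fconj (K y x)"

definition big_haar_kernel ::
  "(real ^ 'n) set set \<Rightarrow> nat \<Rightarrow> (real ^ 'n) set \<Rightarrow>
   (real ^ 'n \<Rightarrow> real ^ 'n \<Rightarrow> 'k::real_or_complex) \<Rightarrow> bool" where
  "big_haar_kernel D r Q K \<longleftrightarrow>
     (\<forall>x y. (x, y) \<notin> Q \<times> Q \<longrightarrow> K x y = 0) \<and>
     (\<forall>R\<in>descendants D (r + 1) Q. \<forall>S\<in>descendants D (r + 1) Q.
        \<exists>c. \<forall>x\<in>R. \<forall>y\<in>S. K x y = c) \<and>
     (\<forall>x y. norm (K x y) \<le> 1 / measure lebesgue Q)"

definition generalized_big_haar_shift_with_kernels ::
  "(real ^ 'n) set set \<Rightarrow> nat \<Rightarrow>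
   ((real ^ 'n) set \<Rightarrow> real ^ 'n \<Rightarrow> real ^ 'n \<Rightarrow> 'k::real_or_complex) \<Rightarrow>
   ((real ^ 'n \<Rightarrow> 'k) \<Rightarrow> real ^ 'n \<Rightarrow> 'k) \<Rightarrow> bool" where
  "generalized_big_haar_shift_with_kernels D r K T \<longleftrightarrow>
     L2_bounded T \<and> (\<forall>Q\<in>D. big_haar_kernel D r Q (K Q)) \<and>
     L2_operator_sum D (\<lambda>Q. kernel_operator (K Q)) T"

definition big_haar_shift ::
  "(real ^ 'n) set set \<Rightarrow> nat \<Rightarrow> ((real ^ 'n \<Rightarrow> 'k::real_or_complex) \<Rightarrow> real ^ 'n \<Rightarrow> 'k) \<Rightarrow> bool" where
  "big_haar_shift D r T \<longleftrightarrow>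
     (\<exists>K. generalized_big_haar_shift_with_kernels D r K T \<and>
          (\<forall>Q\<in>D. kernel_operator (K Q) (indicator Q) = (\<lambda>x. 0) \<and>
                  kernel_operator (adjoint_kernel (K Q)) (indicator Q) = (\<lambda>x. 0)))"

definition martingale_difference ::
  "(real ^ 'n) set set \<Rightarrow> (real ^ 'n) set \<Rightarrow> (real ^ 'n \<Rightarrow> 'k::real_or_complex) \<Rightarrow> real ^ 'n \<Rightarrow> 'k" where
  "martingale_difference D R b x =
     (\<Sum>S\<in>descendants D 1 R. average S b * indicator S x) - average R b * indicator R x"

definition bounded_paraproduct ::
  "(real ^ 'n) set set \<Rightarrow> nat \<Rightarrow> (real ^ 'n \<Rightarrow> 'k::real_or_complex) \<Rightarrow>
   ((real ^ 'n \<Rightarrow> 'k) \<Rightarrow> real ^ 'n \<Rightarrow> 'k) \<Rightarrow> bool" where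
  "bounded_paraproduct D r b T \<longleftrightarrow>
     locally_integrable b \<and> L2_bounded T \<and>
     L2_operator_sum D
       (\<lambda>Q f x. average Q f * (\<Sum>R\<in>descendants D r Q. martingale_difference D R b x)) T"

definition componentwise ::
  "((real ^ 'n \<Rightarrow> 'k::real_or_complex) \<Rightarrow> real ^ 'n \<Rightarrow> 'k) \<Rightarrow>
   (real ^ 'n \<Rightarrow> 'k ^ 'd) \<Rightarrow> real ^ 'n \<Rightarrow> 'k ^ 'd" where
  "componentwise T f x = (\<chi> i. T (\<lambda>y. f y $ i) x)"

definition mult_sqrt ::
  "(real ^ 'n \<Rightarrow> 'k::real_or_complex ^ 'd ^ 'd) \<Rightarrow> (real ^ 'n \<Rightarrow> 'k ^ 'd) \<Rightarrow> real ^ 'n \<Rightarrow> 'k ^ 'd" where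
  "mult_sqrt W f x = matrix_sqrt (W x) *v f x"

text \<open>
  Operator norm on \<open>L\<^sup>2\<close> of an operator given on the dense subspace of bounded, compactly
  supported functions; it is infinite if the operator is unbounded or does not map into \<open>L\<^sup>2\<close>.
\<close>

definition L2_operator_norm ::
  "((real ^ 'n \<Rightarrow> 'b::euclidean_space) \<Rightarrow> real ^ 'n \<Rightarrow> 'b) \<Rightarrow> ennreal" where
  "L2_operator_norm A =
     Inf (ennreal ` {B. 0 \<le> B \<and>
       (\<forall>f. f \<in> borel_measurable lebesgue \<and> bounded (range f) \<and> bounded {x. f x \<noteq> 0} \<longrightarrow>
            in_L2 (A f) \<and> L2_norm (A f) \<le> B * L2_norm f)})"

end

theory Submission
  imports Defs
begin

text \<open>
  By duality it is enough to bound the pairing of \<open>T (V\<^sup>1\<^sup>/\<^sup>2 f)\<close> with \<open>W\<^sup>1\<^sup>/\<^sup>2 g\<close>, and since \<open>T\<close>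
  is a limit in \<open>L\<^sup>2\<close>, to bound finite sums of pairings of \<open>T\<^sub>Q (V\<^sup>1\<^sup>/\<^sup>2 f)\<close>. If only every
  \<open>(r + 1)\<close>-st generation is kept, \<open>T\<^sub>Q\<close> sees a function only through its integrals over the
  children of \<open>Q\<close>, its output is constant on these children and has mean zero, and
  \<open>\<Sum> \<parallel>T\<^sub>Q h\<parallel>\<^sup>2 \<le> B\<^sup>2 \<parallel>h\<parallel>\<^sup>2\<close>. For a big Haar shift the last inequality is Bessel's inequality for
  martingale differences, because \<open>T\<^sub>Q 1 = 0\<close>; for a paraproduct the functions \<open>T\<^sub>Q h\<close> are pairwise
  orthogonal and sum up to \<open>T h\<close>. The mean zero property and this inequality are what \<open>good_blocks\<close> records.

  Sparse bound. Fix a cube \<open>P\<close> and normalize: \<open>F = \<langle>V\<rangle>\<^sub>P\<^sup>-\<^sup>1\<^sup>/\<^sup>2 V\<^sup>1\<^sup>/\<^sup>2 f\<close>, \<open>G = \<langle>W\<rangle>\<^sub>P\<^sup>-\<^sup>1\<^sup>/\<^sup>2 W\<^sup>1\<^sup>/\<^sup>2 g\<close>.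
  Constant matrices commute with the scalar operators \<open>T\<^sub>Q\<close>, so this costs the factor
  \<open>|\<langle>W\<rangle>\<^sub>P\<^sup>1\<^sup>/\<^sup>2 \<langle>V\<rangle>\<^sub>P\<^sup>1\<^sup>/\<^sup>2|\<close>, whose square is at most \<open>[V, W]\<close>. Stop at the maximal subcubes on which
  the average of \<open>|F|\<close> or of \<open>|G|\<close> exceeds four times its average over \<open>P\<close>. The cubes of \<open>P\<close>
  above the stopping cubes do not notice if \<open>F\<close> and \<open>G\<close> are averaged over the stopping cubes, and the
  averaged functions are bounded by a multiple of \<open>\<langle>|F|\<rangle>\<^sub>P\<close> and \<open>\<langle>|G|\<rangle>\<^sub>P\<close>; hence the \<open>L\<^sup>2\<close> bounds give
  at most a multiple of \<open>[V, W]\<^sup>1\<^sup>/\<^sup>2 \<langle>|F|\<rangle>\<^sub>P \<langle>|G|\<rangle>\<^sub>P |P|\<close> for their contribution (\<open>region_estimate\<close>).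
  The stopping cubes fill at most half of \<open>P\<close>, so iterating produces a sparse family, and by
  Cauchy--Schwarz it remains to show that over a sparse family \<open>S\<close>
  \<open>\<Sum> \<langle>|F|\<rangle>\<^sub>P\<^sup>2 |P| \<le> C [V] \<parallel>f\<parallel>\<^sup>2\<close>, and similarly for \<open>g\<close> and \<open>W\<close>.

  The embedding (\<open>weighted_carleson_embedding\<close>). For a scalar weight \<open>w\<close> and \<open>R \<in> S\<close> the mass \<open>w(R)\<close> is
  at most twice the integral of \<open>\<langle>w\<rangle>\<^sub>R \<le> M\<^sub>P w\<close> over the part of \<open>R\<close> that is not covered by smaller members
  of \<open>S\<close>. These parts are disjoint, so the \<open>A\<^sub>\<infinity>\<close> condition gives a packing condition
  \<open>\<Sum>\<^sub>R w(R) \<le> 2 A w(P)\<close>, the sum being over the \<open>R \<in> S\<close> inside \<open>P\<close>. A packing condition improves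
  itself: the mass of the parts that are \<open>k\<close> generations below \<open>P\<close> is summable even with the weight
  \<open>\<lambda>\<^sup>k\<close>, where \<open>\<lambda> - 1\<close> is comparable to \<open>1 / A\<close> (\<open>packing_imp_exponential_decay\<close>). This applies to
  \<open>U\<^sub>P = \<parallel>\<langle>V\<rangle>\<^sub>P\<^sup>-\<^sup>1\<^sup>/\<^sup>2 V\<^sup>1\<^sup>/\<^sup>2\<parallel>\<^sup>2\<close> in the Hilbert--Schmidt norm, which is a sum of scalar weights
  \<open>(V e, e)\<close> and has integral at most \<open>d |P|\<close> over \<open>P\<close>. Since \<open>|F|\<^sup>2 \<le> U\<^sub>P |f|\<^sup>2\<close>, Cauchy--Schwarz with the
  weights \<open>\<lambda>\<^sup>k\<close> bounds \<open>\<langle>|F|\<rangle>\<^sub>P\<^sup>2 |P|\<close> by a multiple of the integral of \<open>\<lambda>\<^sup>-\<^sup>k |f|\<^sup>2\<close>, and when this is summed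
  over \<open>P\<close> every point is charged a geometric series with ratio \<open>1 / \<lambda>\<close>, which is of size \<open>A\<close>. The
  characteristic thus enters to the first power.
\<close>

section \<open>Square roots of positive operators\<close>

lemma blinfun_compose_bilinear:
  fixes a b c :: "'v::real_normed_vector \<Rightarrow>\<^sub>L 'v"
  shows "(a + b) o\<^sub>L c = (a o\<^sub>L c) + (b o\<^sub>L c)" "c o\<^sub>L (a + b) = (c o\<^sub>L a) + (c o\<^sub>L b)"
    "(a - b) o\<^sub>L c = (a o\<^sub>L c) - (b o\<^sub>L c)" "c o\<^sub>L (a - b) = (c o\<^sub>L a) - (c o\<^sub>L b)"
    "(r *\<^sub>R a) o\<^sub>L c = r *\<^sub>R (a o\<^sub>L c)" "c o\<^sub>L (r *\<^sub>R a) = r *\<^sub>R (c o\<^sub>L a)"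
  by (auto intro!: blinfun_eqI simp: blinfun.bilinear_simps)

text \<open>
  With \<open>b = 1 - y\<close> the equation \<open>b\<^sup>2 = 1 - c\<close> reads \<open>y = (c + y\<^sup>2) / 2\<close>, and the right-hand side is a
  contraction of the ball of radius \<open>q < 1\<close>. Symmetry, and commutation with everything that commutes
  with \<open>c\<close>, are closed conditions that the iteration preserves, so the fixed point inherits them.
\<close>

lemma square_root_near_identity:
  fixes c :: "'v::euclidean_space \<Rightarrow>\<^sub>L 'v"
  assumes sa: "\<And>v w. c v \<bullet> w = v \<bullet> c w" and nc: "norm c \<le> q" and q: "0 \<le> q" "q < 1"
  obtains b :: "'v \<Rightarrow>\<^sub>L 'v" where "\<And>v w. b v \<bullet> w = v \<bullet> b w" "\<And>v. 0 \<le> b v \<bullet> v"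
    "b o\<^sub>L b = id_blinfun - c" "\<And>z. z o\<^sub>L c = c o\<^sub>L z \<Longrightarrow> z o\<^sub>L b = b o\<^sub>L z"
proof -
  define s where "s = {y :: 'v \<Rightarrow>\<^sub>L 'v. norm y \<le> q \<and> (\<forall>v w. blinfun_apply y v \<bullet> w = v \<bullet> blinfun_apply y w) \<and>
                        (\<forall>z. z o\<^sub>L c = c o\<^sub>L z \<longrightarrow> z o\<^sub>L y = y o\<^sub>L z)}"
  have s1: "norm y \<le> q" if "y \<in> s" for y using that unfolding s_def by blast
  have s2: "y v \<bullet> w = v \<bullet> y w" if "y \<in> s" for y v w using that unfolding s_def by blast
  have s3: "z o\<^sub>L y = y o\<^sub>L z" if "y \<in> s" "z o\<^sub>L c = c o\<^sub>L z" for y z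
    using that unfolding s_def by blast
  define f where "f y = (1/2) *\<^sub>R (c + (y o\<^sub>L y))" for y :: "'v \<Rightarrow>\<^sub>L 'v"
  have cl: "closed s"
  proof -
    have app: "continuous_on UNIV (\<lambda>y :: 'v \<Rightarrow>\<^sub>L 'v. y v)" for v
      by (intro continuous_intros)
    have comp: "continuous_on UNIV (\<lambda>y. z o\<^sub>L y)" "continuous_on UNIV (\<lambda>y. y o\<^sub>L z)" for z :: "'v \<Rightarrow>\<^sub>L 'v"
      by (intro bounded_bilinear.continuous_on[OF bounded_bilinear_blinfun_compose]
          continuous_on_id continuous_on_const)+
    show ?thesis unfolding s_def
      by (intro closed_Collect_conj closed_Collect_all closed_Collect_imp closed_Collect_le
          closed_Collect_eq open_Collect_const continuous_on_inner app comp continuous_on_id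
          continuous_on_const continuous_on_norm)
  qed
  have "0 \<in> s" using q unfolding s_def by simp
  then have ne: "s \<noteq> {}" by auto
  have comp: "norm (y o\<^sub>L y') \<le> q * q" if "norm y \<le> q" "norm y' \<le> q" for y y' :: "'v \<Rightarrow>\<^sub>L 'v"
    using order_trans[OF norm_blinfun_compose mult_mono[OF that q(1)]] by simp
  have self: "f y \<in> s" if y: "y \<in> s" for y
  proof -
    have "norm (f y) \<le> (1/2) * (q + q * q)"
      unfolding f_def norm_scaleR
      using norm_triangle_ineq[of c "y o\<^sub>L y"] nc comp[OF s1[OF y] s1[OF y]] by auto
    also have "\<dots> \<le> q" using mult_left_le[of q q] q by simp
    finally have n: "norm (f y) \<le> q" .
    note sy = s2[OF y]
    have sf: "f y v \<bullet> w = v \<bullet> f y w" for v w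
      by (simp add: f_def blinfun.bilinear_simps inner_simps sa sy)
    have "z o\<^sub>L f y = f y o\<^sub>L z" if z: "z o\<^sub>L c = c o\<^sub>L z" for z
    proof -
      note zy = s3[OF y z]
      have "z (y (y v)) = y (y (z v))" for v
        using arg_cong[OF zy, of "\<lambda>t. t (y v)"] arg_cong[OF zy, of "\<lambda>t. t v"] by simp
      moreover have "z (c v) = c (z v)" for v using arg_cong[OF z, of "\<lambda>t. t v"] by simp
      ultimately show ?thesis
        by (intro blinfun_eqI) (simp add: f_def blinfun.bilinear_simps)
    qed
    with n sf show ?thesis unfolding s_def by blast
  qed
  have lip: "dist (f x) (f y) \<le> q * dist x y" if "x \<in> s" "y \<in> s" for x y
  proof -
    have "f x - f y = (1/2) *\<^sub>R ((x o\<^sub>L (x - y)) + ((x - y) o\<^sub>L y))"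
      by (simp add: f_def blinfun_compose_bilinear algebra_simps)
    then have "norm (f x - f y) \<le> (1/2) * (norm (x o\<^sub>L (x - y)) + norm ((x - y) o\<^sub>L y))"
      using norm_triangle_ineq[of "x o\<^sub>L (x - y)" "(x - y) o\<^sub>L y"] by simp
    also have "\<dots> \<le> (1/2) * (q * norm (x - y) + norm (x - y) * q)"
      using s1[OF that(1)] s1[OF that(2)]
      by (intro mult_left_mono add_mono order_trans[OF norm_blinfun_compose] mult_right_mono) auto
    finally show ?thesis by (simp add: dist_norm)
  qed
  obtain y where y: "y \<in> s" "f y = y"
    using Banach_fix[of s q f] cl ne q self lip unfolding complete_eq_closed by blast
  define b where "b = id_blinfun - y"
  note sy = s2[OF y(1)]
  show ?thesis
  proof
    show "b v \<bullet> w = v \<bullet> b w" for v w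
      by (simp add: b_def blinfun.bilinear_simps inner_simps sy)
    show "0 \<le> b v \<bullet> v" for v
    proof -
      have "y v \<bullet> v \<le> norm (y v) * norm v" by (rule norm_cauchy_schwarz)
      also have "\<dots> \<le> (norm y * norm v) * norm v" by (intro mult_right_mono norm_blinfun) simp
      also have "\<dots> \<le> (1 * norm v) * norm v" using s1[OF y(1)] q by (intro mult_right_mono) auto
      also have "\<dots> = v \<bullet> v" by (simp add: dot_square_norm power2_eq_square)
      finally show ?thesis by (simp add: b_def blinfun.bilinear_simps inner_simps)
    qed
    have "y + y = 2 *\<^sub>R f y" using y by (simp add: scaleR_2)
    also have "\<dots> = c + (y o\<^sub>L y)" by (simp add: f_def)
    finally have yy: "y + y = c + (y o\<^sub>L y)" .
    have "b o\<^sub>L b = id_blinfun - (y + y) + (y o\<^sub>L y)"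
      by (simp add: b_def blinfun_compose_bilinear algebra_simps)
         (intro blinfun_eqI, simp add: blinfun.bilinear_simps)
    then show "b o\<^sub>L b = id_blinfun - c" unfolding yy by simp
    show "z o\<^sub>L b = b o\<^sub>L z" if "z o\<^sub>L c = c o\<^sub>L z" for z
    proof -
      note s3[OF y(1) that]
      moreover have "z o\<^sub>L id_blinfun = id_blinfun o\<^sub>L z" by (intro blinfun_eqI) simp
      ultimately show ?thesis by (simp add: b_def blinfun_compose_bilinear)
    qed
  qed
qed

text \<open>
  A coercive operator divided by a large number differs from the identity by an operator of
  norm less than \<open>1\<close>.
\<close>

lemma square_root_coercive:
  fixes a :: "'v::euclidean_space \<Rightarrow>\<^sub>L 'v"
  assumes sa: "\<And>v w. a v \<bullet> w = v \<bullet> a w" and m: "0 < m" "\<And>v. m * (norm v)\<^sup>2 \<le> a v \<bullet> v"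
  obtains b :: "'v \<Rightarrow>\<^sub>L 'v" where "\<And>v w. b v \<bullet> w = v \<bullet> b w" "\<And>v. 0 \<le> b v \<bullet> v"
    "b o\<^sub>L b = a" "\<And>z. z o\<^sub>L a = a o\<^sub>L z \<Longrightarrow> z o\<^sub>L b = b o\<^sub>L z"
proof -
  define n where "n = norm a + m"
  have n: "0 < n" "m \<le> n" "norm a \<le> n" using m(1) norm_ge_zero[of a] unfolding n_def by linarith+
  \<comment> \<open>With \<open>n\<close> in place of \<open>\<parallel>a\<parallel>\<close>, this minimizes the bound \<open>1 - 2 m / L + n\<^sup>2 / L\<^sup>2\<close> for \<open>\<parallel>1 - a / L\<parallel>\<^sup>2\<close>.\<close>
  define L where "L = n\<^sup>2 / m"
  have L: "L > 0" using n m by (simp add: L_def)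
  define c where "c = id_blinfun - (1 / L) *\<^sub>R a"
  define q where "q = sqrt (1 - (m / n)\<^sup>2)"
  have mn: "0 < m / n" "m / n \<le> 1" using n m by auto
  then have mn2: "(m / n)\<^sup>2 \<le> 1" "0 < (m / n)\<^sup>2" by (auto simp: power_le_one)
  then have q: "0 \<le> q" "q < 1" by (auto simp: q_def)
  have "norm (c v) \<le> q * norm v" for v
  proof (rule power2_le_imp_le)
    have "(norm (a v))\<^sup>2 \<le> (n * norm v)\<^sup>2"
      using order_trans[OF norm_blinfun[of a v] mult_right_mono[OF n(3)]] by (intro power_mono) auto
    then have 1: "(norm (a v))\<^sup>2 / L\<^sup>2 \<le> n\<^sup>2 * (norm v)\<^sup>2 / L\<^sup>2"
      by (intro divide_right_mono) (auto simp: power_mult_distrib)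
    have 2: "(2 / L) * (m * (norm v)\<^sup>2) \<le> (2 / L) * (a v \<bullet> v)"
      using m L by (intro mult_left_mono) auto
    have "(norm (c v))\<^sup>2 = (norm v)\<^sup>2 - (2 / L) * (a v \<bullet> v) + (norm (a v))\<^sup>2 / L\<^sup>2"
      unfolding power2_norm_eq_inner c_def
      by (simp add: blinfun.bilinear_simps inner_simps inner_commute power2_eq_square)
    also have "\<dots> \<le> (norm v)\<^sup>2 - (2 / L) * (m * (norm v)\<^sup>2) + n\<^sup>2 * (norm v)\<^sup>2 / L\<^sup>2"
      using 1 2 by linarith
    also have "\<dots> = (1 - (m / n)\<^sup>2) * (norm v)\<^sup>2"
      using n m by (simp add: L_def field_simps power2_eq_square)
    also have "\<dots> = (q * norm v)\<^sup>2" using mn2 by (simp add: q_def power_mult_distrib)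
    finally show "(norm (c v))\<^sup>2 \<le> (q * norm v)\<^sup>2" .
  qed (use q in auto)
  then have nc: "norm c \<le> q" using q by (intro norm_blinfun_bound) auto
  have sc: "c v \<bullet> w = v \<bullet> c w" for v w
    by (simp add: c_def blinfun.bilinear_simps inner_simps sa)
  obtain b :: "'v \<Rightarrow>\<^sub>L 'v" where b: "\<And>v w. b v \<bullet> w = v \<bullet> b w" "\<And>v. 0 \<le> b v \<bullet> v"
    "b o\<^sub>L b = id_blinfun - c" "\<And>z. z o\<^sub>L c = c o\<^sub>L z \<Longrightarrow> z o\<^sub>L b = b o\<^sub>L z"
    using square_root_near_identity[OF sc nc q] by metis
  show ?thesis
  proof (rule that[of "sqrt L *\<^sub>R b"])
    have "(sqrt L *\<^sub>R b) o\<^sub>L (sqrt L *\<^sub>R b) = L *\<^sub>R (b o\<^sub>L b)"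
      using L by (simp add: blinfun_compose_bilinear)
    also have "\<dots> = a" using L unfolding b(3) c_def by simp
    finally show "(sqrt L *\<^sub>R b) o\<^sub>L (sqrt L *\<^sub>R b) = a" .
    fix z assume z: "z o\<^sub>L a = a o\<^sub>L z"
    have "z o\<^sub>L id_blinfun = id_blinfun o\<^sub>L z" by (intro blinfun_eqI) simp
    then have "z o\<^sub>L c = c o\<^sub>L z" using z by (simp add: c_def blinfun_compose_bilinear)
    from b(4)[OF this] show "z o\<^sub>L (sqrt L *\<^sub>R b) = (sqrt L *\<^sub>R b) o\<^sub>L z"
      by (simp add: blinfun_compose_bilinear)
  qed (use b(1,2) L in \<open>auto simp: blinfun.bilinear_simps inner_simps\<close>)
qed

text \<open>
  Adding a small multiple of the identity makes \<open>a\<close> coercive; the square roots stay bounded and, the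
  dimension being finite, have a limit point.
\<close>

lemma square_root_exists:
  fixes a :: "'v::euclidean_space \<Rightarrow>\<^sub>L 'v"
  assumes sa: "\<And>v w. a v \<bullet> w = v \<bullet> a w" and pos: "\<And>v. 0 \<le> a v \<bullet> v"
  obtains b :: "'v \<Rightarrow>\<^sub>L 'v" where "\<And>v w. b v \<bullet> w = v \<bullet> b w" "\<And>v. 0 \<le> b v \<bullet> v"
    "b o\<^sub>L b = a" "\<And>z. z o\<^sub>L a = a o\<^sub>L z \<Longrightarrow> z o\<^sub>L b = b o\<^sub>L z"
proof -
  define d where "d n = inverse (real (Suc n))" for n
  define A where "A n = a + d n *\<^sub>R id_blinfun" for n
  have d: "0 < d n" "d n \<le> 1" for n by (auto simp: d_def field_simps)
  define P where "P n b \<longleftrightarrow> (\<forall>v w. blinfun_apply b v \<bullet> w = v \<bullet> blinfun_apply b w) \<and>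
      (\<forall>v. 0 \<le> blinfun_apply b v \<bullet> v) \<and> b o\<^sub>L b = A n \<and>
      (\<forall>z. z o\<^sub>L A n = A n o\<^sub>L z \<longrightarrow> z o\<^sub>L b = b o\<^sub>L z)" for n b
  have "\<exists>b. P n b" for n
  proof -
    have "A n v \<bullet> w = v \<bullet> A n w" for v w
      by (simp add: A_def blinfun.bilinear_simps inner_simps sa)
    moreover have "d n * (norm v)\<^sup>2 \<le> A n v \<bullet> v" for v
      using pos[of v] by (simp add: A_def blinfun.bilinear_simps inner_simps dot_square_norm)
    ultimately obtain b :: "'v \<Rightarrow>\<^sub>L 'v" where
      "\<And>v w. b v \<bullet> w = v \<bullet> b w" "\<And>v. 0 \<le> b v \<bullet> v"
      "b o\<^sub>L b = A n" "\<And>z. z o\<^sub>L A n = A n o\<^sub>L z \<Longrightarrow> z o\<^sub>L b = b o\<^sub>L z"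
      using square_root_coercive[of "A n" "d n", OF _ d(1)] by metis
    then show ?thesis unfolding P_def by blast
  qed
  then obtain B where B0: "\<And>n. P n (B n)" by metis
  have B: "B n v \<bullet> w = v \<bullet> B n w" "0 \<le> B n v \<bullet> v" "B n o\<^sub>L B n = A n" for n v w
    using B0[of n] unfolding P_def by blast+
  have B4: "z o\<^sub>L B n = B n o\<^sub>L z" if "z o\<^sub>L A n = A n o\<^sub>L z" for n z
    using B0[of n] that unfolding P_def by blast
  have nB: "norm (B n) \<le> sqrt (norm a + 1)" for n
  proof (rule norm_blinfun_bound)
    fix v
    have "norm (A n) \<le> norm a + norm (d n *\<^sub>R (id_blinfun :: 'v \<Rightarrow>\<^sub>L 'v))"
      unfolding A_def by (rule norm_triangle_ineq)
    also have "\<dots> \<le> norm a + 1 * 1"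
      unfolding norm_scaleR using d[of n] norm_blinfun_id_le[where 'a='v]
      by (intro add_left_mono mult_mono) auto
    finally have nA: "norm (A n) \<le> norm a + 1" by simp
    have "(norm (B n v))\<^sup>2 = (B n o\<^sub>L B n) v \<bullet> v" by (simp add: power2_norm_eq_inner B(1))
    also have "\<dots> \<le> norm (A n v) * norm v" unfolding B(3) by (rule norm_cauchy_schwarz)
    also have "\<dots> \<le> ((norm a + 1) * norm v) * norm v"
      by (intro mult_right_mono order_trans[OF norm_blinfun] nA) auto
    also have "\<dots> = (sqrt (norm a + 1) * norm v)\<^sup>2" by (simp add: power2_eq_square)
    finally show "norm (B n v) \<le> sqrt (norm a + 1) * norm v"
      by (rule power2_le_imp_le) simp
  qed simp
  then have "bounded (range B)" by (auto simp: bounded_iff)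
  then obtain b r where r: "strict_mono r" and lim: "(B \<circ> r) \<longlonglongrightarrow> b"
    using bounded_imp_convergent_subsequence by blast
  note tc = bounded_bilinear.tendsto[OF bounded_bilinear_blinfun_compose]
  have app: "(\<lambda>n. B (r n) v) \<longlonglongrightarrow> b v" for v
    using blinfun.tendsto[OF lim tendsto_const[of v]] by (simp add: o_def)
  have "d \<longlonglongrightarrow> 0" unfolding d_def by (rule LIMSEQ_inverse_real_of_nat)
  then have "A \<longlonglongrightarrow> a + 0 *\<^sub>R id_blinfun" unfolding A_def by (intro tendsto_intros)
  then have Ar: "(A \<circ> r) \<longlonglongrightarrow> a" using LIMSEQ_subseq_LIMSEQ r by fastforce
  show ?thesis
  proof
    show "b v \<bullet> w = v \<bullet> b w" for v w
    proof (rule LIMSEQ_unique)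
      show "(\<lambda>n. B (r n) v \<bullet> w) \<longlonglongrightarrow> b v \<bullet> w" by (intro tendsto_inner app tendsto_const)
      have "(\<lambda>n. v \<bullet> B (r n) w) \<longlonglongrightarrow> v \<bullet> b w" by (intro tendsto_inner app tendsto_const)
      then show "(\<lambda>n. B (r n) v \<bullet> w) \<longlonglongrightarrow> v \<bullet> b w" by (simp only: B(1))
    qed
    show "0 \<le> b v \<bullet> v" for v
      by (rule LIMSEQ_le_const[OF tendsto_inner[OF app tendsto_const[of v]]]) (use B(2) in auto)
    have "(\<lambda>n. (B \<circ> r) n o\<^sub>L (B \<circ> r) n) \<longlonglongrightarrow> (b o\<^sub>L b)" by (intro tc lim)
    moreover have "(\<lambda>n. (B \<circ> r) n o\<^sub>L (B \<circ> r) n) = A \<circ> r" by (simp add: o_def B(3))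
    ultimately show "b o\<^sub>L b = a" using LIMSEQ_unique[OF _ Ar] by metis
    fix z assume z: "z o\<^sub>L a = a o\<^sub>L z"
    have "z o\<^sub>L id_blinfun = id_blinfun o\<^sub>L z" by (intro blinfun_eqI) simp
    then have "z o\<^sub>L A n = A n o\<^sub>L z" for n unfolding A_def blinfun_compose_bilinear z by simp
    then have "z o\<^sub>L B n = B n o\<^sub>L z" for n by (rule B4)
    then have "(\<lambda>n. z o\<^sub>L (B \<circ> r) n) = (\<lambda>n. (B \<circ> r) n o\<^sub>L z)" by (intro ext) (simp only: o_apply)
    moreover have "(\<lambda>n. z o\<^sub>L (B \<circ> r) n) \<longlonglongrightarrow> (z o\<^sub>L b)" "(\<lambda>n. (B \<circ> r) n o\<^sub>L z) \<longlonglongrightarrow> (b o\<^sub>L z)"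
      by (intro tc lim tendsto_const)+
    ultimately show "z o\<^sub>L b = b o\<^sub>L z" using LIMSEQ_unique by metis
  qed
qed

text \<open>
  The root \<open>r\<close> found above commutes with everything that commutes with \<open>a\<close>, hence with any other
  root \<open>e\<close>, so \<open>(e + r) (e - r) = 0\<close>. Both \<open>e\<close> and \<open>r\<close> are positive, so they vanish separately on the
  range of \<open>e - r\<close>.
\<close>

lemma square_root_unique:
  fixes b c :: "'v::euclidean_space \<Rightarrow>\<^sub>L 'v"
  assumes b: "\<And>v w. b v \<bullet> w = v \<bullet> b w" "\<And>v. 0 \<le> b v \<bullet> v"
    and c: "\<And>v w. c v \<bullet> w = v \<bullet> c w" "\<And>v. 0 \<le> c v \<bullet> v"
    and eq: "b o\<^sub>L b = c o\<^sub>L c"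
  shows "b = c"
proof -
  \<comment> \<open>If \<open>e = r\<^sup>2\<close> is positive and \<open>e x \<bullet> x = 0\<close> then \<open>|r x|\<^sup>2 = 0\<close>.\<close>
  have kernel: "e x = 0" if e: "\<And>v w. e v \<bullet> w = v \<bullet> e w" "\<And>v. 0 \<le> e v \<bullet> v" and "e x \<bullet> x = 0"
    for e :: "'v \<Rightarrow>\<^sub>L 'v" and x
  proof -
    obtain r :: "'v \<Rightarrow>\<^sub>L 'v" where r: "\<And>v w. r v \<bullet> w = v \<bullet> r w" "r o\<^sub>L r = e"
      using square_root_exists[OF e] by metis
    have "r x \<bullet> r x = (r o\<^sub>L r) x \<bullet> x" by (simp add: r(1))
    then have "r x = 0" using that(3) unfolding r(2) by simp
    then show ?thesis unfolding r(2)[symmetric] by (simp add: blinfun.bilinear_simps)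
  qed
  define a where "a = b o\<^sub>L b"
  have "a v \<bullet> w = v \<bullet> a w" for v w by (simp add: a_def b)
  moreover have "0 \<le> a v \<bullet> v" for v
  proof -
    have "a v \<bullet> v = b v \<bullet> b v" by (simp add: a_def b(1))
    then show ?thesis by simp
  qed
  ultimately obtain r :: "'v \<Rightarrow>\<^sub>L 'v" where r: "\<And>v w. r v \<bullet> w = v \<bullet> r w" "\<And>v. 0 \<le> r v \<bullet> v"
    "r o\<^sub>L r = a" "\<And>z. z o\<^sub>L a = a o\<^sub>L z \<Longrightarrow> z o\<^sub>L r = r o\<^sub>L z"
    using square_root_exists[of a] by metis
  have "e = r" if e: "\<And>v w. e v \<bullet> w = v \<bullet> e w" "\<And>v. 0 \<le> e v \<bullet> v" and "e o\<^sub>L e = a"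
    for e :: "'v \<Rightarrow>\<^sub>L 'v"
  proof -
    have "e o\<^sub>L a = a o\<^sub>L e" unfolding that(3)[symmetric] by (intro blinfun_eqI) simp
    then have er: "e o\<^sub>L r = r o\<^sub>L e" by (rule r(4))
    have er': "e (r v) = r (e v)" for v using arg_cong[OF er, of "\<lambda>t. t v"] by simp
    have sq: "e (e v) = r (r v)" for v
      using that(3) r(3) by (metis blinfun_apply_blinfun_compose)
    have "e v = r v" for v
    proof -
      define y where "y = e v - r v"
      have "e y + r y = 0"
        by (simp add: y_def blinfun.bilinear_simps sq er')
      then have "e y \<bullet> y + r y \<bullet> y = 0" by (simp flip: inner_add_left)
      then have "e y \<bullet> y = 0" "r y \<bullet> y = 0" using e(2)[of y] r(2)[of y] by linarith+
      then have z: "e y = 0" "r y = 0" using kernel e r by blast+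
      have "y \<bullet> y = v \<bullet> (e y - r y)" unfolding y_def
        by (simp add: inner_simps blinfun.bilinear_simps e(1) r(1))
      then show ?thesis using z by (simp add: y_def)
    qed
    then show ?thesis by (intro blinfun_eqI)
  qed
  then show ?thesis using b c eq unfolding a_def by metis
qed

section \<open>Positive semidefinite matrices and their square roots\<close>

lemma inner_mult_mult:
  fixes a x y :: "'k::real_or_complex"
  shows "(a * x) \<bullet> (a * y) = (norm a)\<^sup>2 * (x \<bullet> y)"
proof -
  have "4 * ((a * x) \<bullet> (a * y)) = (norm (a * (x + y)))\<^sup>2 - (norm (a * (x - y)))\<^sup>2"
    unfolding power2_norm_eq_inner by (simp add: algebra_simps inner_simps inner_commute)
  also have "\<dots> = (norm a)\<^sup>2 * ((norm (x + y))\<^sup>2 - (norm (x - y))\<^sup>2)"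
    unfolding norm_mult power_mult_distrib by (simp add: algebra_simps)
  also have "(norm (x + y))\<^sup>2 - (norm (x - y))\<^sup>2 = 4 * (x \<bullet> y)"
    unfolding power2_norm_eq_inner by (simp add: algebra_simps inner_simps inner_commute)
  finally show ?thesis by simp
qed

text \<open>
  The scalar field carries an inner product and a conjugation that are related only through the norm;
  polarization of \<open>|a x| = |a| |x|\<close> shows that they are compatible.
\<close>

lemma inner_mult_fconj:
  fixes a x y :: "'k::real_or_complex"
  shows "(a * x) \<bullet> y = x \<bullet> (fconj a * y)"
proof (cases "a = 0")
  case False
  have "(a * x) \<bullet> y = (a * x) \<bullet> (a * (inverse a * y))" using False by (simp add: field_simps)
  also have "\<dots> = x \<bullet> ((norm a)\<^sup>2 *\<^sub>R (inverse a * y))" by (simp add: inner_mult_mult)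
  also have "(norm a)\<^sup>2 *\<^sub>R (inverse a * y) = (a * fconj a) * (inverse a * y)"
    unfolding mult_fconj_scaleR by simp
  also have "\<dots> = fconj a * y" using False by (simp add: field_simps)
  finally show ?thesis .
qed simp

lemma fconj_scaleR: "fconj (t *\<^sub>R z) = t *\<^sub>R fconj (z :: 'k::real_or_complex)"
proof -
  have "fconj (of_real t) = (of_real t :: 'k)"
  proof (cases "t = 0")
    case False
    have "of_real t * fconj (of_real t) = of_real t * (of_real t :: 'k)"
      using mult_fconj[of "of_real t :: 'k"] by (simp add: power2_eq_square flip: of_real_mult)
    with False show ?thesis by simp
  qed simp
  then show ?thesis by (simp add: scaleR_conv_of_real fconj_mult)
qed

lemma fconj_sum: "fconj (sum f A) = (\<Sum>x\<in>A. fconj (f x :: 'k::real_or_complex))"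
  by (induction A rule: infinite_finite_induct) (simp_all add: fconj_add)

lemma inner_matrix_vector_mult:
  fixes A :: "'k::real_or_complex ^ 'd ^ 'e"
  shows "(A *v v) \<bullet> w = v \<bullet> ((\<chi> j i. fconj (A $ i $ j)) *v w)"
proof -
  have "(A *v v) \<bullet> w = (\<Sum>i\<in>UNIV. \<Sum>j\<in>UNIV. v $ j \<bullet> (fconj (A $ i $ j) * w $ i))"
    by (simp add: inner_vec_def matrix_vector_mult_def inner_sum_left inner_mult_fconj)
  also have "\<dots> = (\<Sum>j\<in>UNIV. \<Sum>i\<in>UNIV. v $ j \<bullet> (fconj (A $ i $ j) * w $ i))"
    by (rule sum.swap)
  also have "\<dots> = v \<bullet> ((\<chi> j i. fconj (A $ i $ j)) *v w)"
    by (simp add: inner_vec_def matrix_vector_mult_def inner_sum_right)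
  finally show ?thesis .
qed

text \<open>
  A matrix is Hermitian if and only if it is symmetric for the real inner product, so positive
  semidefinite matrices are positive operators on a real Euclidean space.
\<close>

lemma positive_semidefinite_iff:
  fixes A :: "'k::real_or_complex ^ 'd ^ 'd"
  shows "positive_semidefinite A \<longleftrightarrow>
    (\<forall>v w. (A *v v) \<bullet> w = v \<bullet> (A *v w)) \<and> (\<forall>v. 0 \<le> (A *v v) \<bullet> v)"
proof -
  have "(\<forall>i j. A $ i $ j = fconj (A $ j $ i)) \<longleftrightarrow> (\<forall>v w. (A *v v) \<bullet> w = v \<bullet> (A *v w))"
  proof (intro iffI allI)
    fix v w assume "\<forall>i j. A $ i $ j = fconj (A $ j $ i)"
    then have "fconj (A $ i $ j) = A $ j $ i" for i j by metis
    then have "(\<chi> j i. fconj (A $ i $ j)) = A" by (simp add: vec_eq_iff)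
    then show "(A *v v) \<bullet> w = v \<bullet> (A *v w)" using inner_matrix_vector_mult[of A v w] by simp
  next
    fix i j assume *: "\<forall>v w. (A *v v) \<bullet> w = v \<bullet> (A *v w)"
    let ?B = "(\<chi> j i. fconj (A $ i $ j))"
    have "v \<bullet> (?B *v w - A *v w) = 0" for v w
      using * inner_matrix_vector_mult[of A v w] by (simp add: inner_diff_right)
    then have "?B *v w - A *v w = 0" for w using inner_eq_zero_iff by blast
    then have "?B = A" by (simp add: matrix_eq)
    then show "A $ i $ j = fconj (A $ j $ i)" by (metis (lifting) vec_lambda_beta)
  qed
  then show ?thesis by (simp add: positive_semidefinite_def)
qed

lemma positive_semidefinite_self_adjoint:
  "positive_semidefinite A \<Longrightarrow> (A *v v) \<bullet> w = v \<bullet> (A *v w)"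
  and positive_semidefinite_nonneg: "positive_semidefinite A \<Longrightarrow> 0 \<le> (A *v v) \<bullet> v"
  by (auto simp: positive_semidefinite_iff)

lemma bounded_linear_matrix_vector_mult [simp]:
  "bounded_linear (\<lambda>v :: 'k::real_or_complex ^ 'd. (A :: 'k ^ 'd ^ 'e) *v v)"
  using matrix_vector_mul_linear by (simp add: linear_conv_bounded_linear)

lemma norm_matrix_vector_mult_le: "norm (A *v v) \<le> matrix_opnorm A * norm v"
  unfolding matrix_opnorm_def by (rule onorm) simp

text \<open>
  The square root of the operator commutes with everything that commutes with \<open>A\<close>, in particular with
  multiplication by scalars; therefore it is given by a matrix.
\<close>

lemma matrix_sqrt_exists:
  fixes A :: "'k::real_or_complex ^ 'd ^ 'd"
  assumes "positive_semidefinite A"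
  shows "\<exists>B. positive_semidefinite B \<and> B ** B = A"
proof -
  define a where "a = Blinfun (\<lambda>v. A *v v)"
  have a: "blinfun_apply a v = A *v v" for v by (simp add: a_def bounded_linear_Blinfun_apply)
  have "a v \<bullet> w = v \<bullet> a w" "0 \<le> a v \<bullet> v" for v w
    using assms unfolding a positive_semidefinite_iff by blast+
  then obtain b :: "('k ^ 'd) \<Rightarrow>\<^sub>L ('k ^ 'd)" where b: "\<And>v w. b v \<bullet> w = v \<bullet> b w" "\<And>v. 0 \<le> b v \<bullet> v"
    "b o\<^sub>L b = a" and comm: "\<And>z. z o\<^sub>L a = a o\<^sub>L z \<Longrightarrow> z o\<^sub>L b = b o\<^sub>L z"
    using square_root_exists[of a] by metis
  have scale: "bounded_linear (\<lambda>v :: 'k ^ 'd. k *s v)" for k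
    by (simp add: linear_conv_bounded_linear[symmetric] linear_iff vec_eq_iff algebra_simps)
  have bk: "b (k *s v) = k *s b v" for k v
  proof -
    define z where "z = Blinfun (\<lambda>v :: 'k ^ 'd. k *s v)"
    have z: "blinfun_apply z v = k *s v" for v
      by (simp add: z_def bounded_linear_Blinfun_apply scale)
    have "z o\<^sub>L a = a o\<^sub>L z" by (intro blinfun_eqI) (simp add: z a vector_scalar_commute)
    from arg_cong[OF comm[OF this], of "\<lambda>t. t v"] show ?thesis by (simp add: z)
  qed
  define B where "B = matrix (blinfun_apply b)"
  have "Vector_Spaces.linear (*s) (*s) (blinfun_apply b)"
    by unfold_locales (auto simp: bk blinfun.add_right)
  then have B: "B *v v = b v" for v unfolding B_def by (rule matrix_works)
  have "positive_semidefinite B" using b by (simp add: positive_semidefinite_iff B)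
  moreover have "(B ** B) *v v = A *v v" for v
    using arg_cong[OF b(3), of "\<lambda>t. t v"] by (simp add: matrix_vector_mul_assoc[symmetric] B a)
  then have "B ** B = A" by (simp add: matrix_eq)
  ultimately show ?thesis by blast
qed

lemma matrix_sqrt_unique:
  fixes B C :: "'k::real_or_complex ^ 'd ^ 'd"
  assumes "positive_semidefinite B" "positive_semidefinite C" "B ** B = C ** C"
  shows "B = C"
proof -
  define b c where "b = Blinfun (\<lambda>v. B *v v)" and "c = Blinfun (\<lambda>v. C *v v)"
  have ap: "blinfun_apply b v = B *v v" "blinfun_apply c v = C *v v" for v
    by (simp_all add: b_def c_def bounded_linear_Blinfun_apply)
  have "b o\<^sub>L b = c o\<^sub>L c"
    using assms(3) by (intro blinfun_eqI) (simp add: ap matrix_vector_mul_assoc)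
  then have "b = c"
    using assms(1,2) unfolding positive_semidefinite_iff
    by (intro square_root_unique[of b c]) (auto simp only: ap)
  then have "B *v v = C *v v" for v using ap by metis
  then show ?thesis by (simp add: matrix_eq)
qed

lemma
  assumes "positive_semidefinite A"
  shows positive_semidefinite_matrix_sqrt: "positive_semidefinite (matrix_sqrt A)"
    and matrix_sqrt_square: "matrix_sqrt A ** matrix_sqrt A = A"
proof -
  have "\<exists>!B. positive_semidefinite B \<and> B ** B = A"
    using matrix_sqrt_exists[OF assms] matrix_sqrt_unique by metis
  from theI'[OF this] show "positive_semidefinite (matrix_sqrt A)" "matrix_sqrt A ** matrix_sqrt A = A"
    unfolding matrix_sqrt_def by blast+
qed

lemma matrix_sqrt_eq: "positive_semidefinite B \<Longrightarrow> matrix_sqrt (B ** B) = B"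
proof -
  assume B: "positive_semidefinite B"
  have "(B ** B) *v v = B *v (B *v v)" for v by (simp add: matrix_vector_mul_assoc)
  moreover have "(B *v (B *v v)) \<bullet> w = (B *v v) \<bullet> (B *v w)" for v w
    using B unfolding positive_semidefinite_iff by blast
  moreover have "v \<bullet> (B *v (B *v w)) = (B *v v) \<bullet> (B *v w)" for v w
    using B unfolding positive_semidefinite_iff by metis
  ultimately have "positive_semidefinite (B ** B)"
    by (simp add: positive_semidefinite_iff)
  then show ?thesis
    using matrix_sqrt_unique[OF positive_semidefinite_matrix_sqrt B] matrix_sqrt_square by blast
qed

lemma matrix_sqrt_sqrt_mult: "positive_semidefinite A \<Longrightarrow> matrix_sqrt A *v (matrix_sqrt A *v v) = A *v v"
  by (simp add: matrix_vector_mul_assoc matrix_sqrt_square)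

lemma norm_matrix_sqrt_mult:
  assumes "positive_semidefinite A"
  shows "(norm (matrix_sqrt A *v v))\<^sup>2 = (A *v v) \<bullet> v"
  using positive_semidefinite_self_adjoint[OF positive_semidefinite_matrix_sqrt[OF assms], of v "matrix_sqrt A *v v"]
  by (simp add: power2_norm_eq_inner matrix_sqrt_sqrt_mult[OF assms] inner_commute)

lemma continuous_matrix_mult:
  "continuous_on UNIV (\<lambda>B. (B :: 'k::real_or_complex ^ 'd ^ 'd) ** B)"
  unfolding matrix_matrix_mult_def
  by (intro continuous_on_vec_lambda continuous_on_sum continuous_on_mult continuous_on_component
      continuous_on_id continuous_on_const)

lemma continuous_matrix_vector_mult:
  "continuous_on UNIV (\<lambda>x. (fst x :: 'k::real_or_complex ^ 'd ^ 'e) *v snd x)"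
  unfolding matrix_vector_mult_def
  by (intro continuous_on_vec_lambda continuous_on_sum continuous_on_mult continuous_on_component
      continuous_on_fst continuous_on_snd continuous_on_id)

lemma borel_measurable_matrix_vector_mult [measurable (raw)]:
  fixes A :: "'a \<Rightarrow> 'k::real_or_complex ^ 'd ^ 'e"
  assumes "A \<in> borel_measurable M" "f \<in> borel_measurable M"
  shows "(\<lambda>x. A x *v f x) \<in> borel_measurable M"
  by (rule borel_measurable_continuous_Pair[OF assms continuous_matrix_vector_mult])

lemma closed_positive_semidefinite: "closed {A :: 'k::real_or_complex ^ 'd ^ 'd. positive_semidefinite A}"
proof -
  have "continuous_on UNIV (\<lambda>A :: 'k ^ 'd ^ 'd. A *v v)" for v
    by (rule continuous_on_compose2[OF continuous_matrix_vector_mult,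
          where f="\<lambda>A. (A, v)", simplified]) (intro continuous_intros)
  then show ?thesis
    unfolding positive_semidefinite_iff
    by (intro closed_Collect_conj closed_Collect_all closed_Collect_le closed_Collect_eq
        continuous_on_inner continuous_on_const)
qed

text \<open>
  On a compact set of positive semidefinite matrices squaring is continuous and injective, so its
  inverse is continuous on the image. Every positive semidefinite matrix lies in such an image, and
  the square root of \<open>W\<close> is a pointwise limit of functions obtained by truncating to these images.
\<close>

lemma borel_measurable_matrix_sqrt:
  fixes W :: "'a \<Rightarrow> 'k::real_or_complex ^ 'd ^ 'd"
  assumes W: "W \<in> borel_measurable M" and psd: "\<And>x. positive_semidefinite (W x)"
  shows "(\<lambda>x. matrix_sqrt (W x)) \<in> borel_measurable M"
proof -
  define K where "K r = {A :: 'k ^ 'd ^ 'd. positive_semidefinite A} \<inter> cball 0 (real r)" for r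
  have cK: "compact (K r)" for r
    unfolding K_def by (intro closed_Int_compact closed_positive_semidefinite compact_cball)
  define S where "S r = (\<lambda>B. B ** B) ` K r" for r
  have c: "continuous_on (K r) (\<lambda>B. B ** B)" for r
    using continuous_matrix_mult continuous_on_subset by blast
  have cS: "compact (S r)" for r
    unfolding S_def by (intro compact_continuous_image c cK)
  have cont: "continuous_on (S r) matrix_sqrt" for r
    unfolding S_def by (intro continuous_on_inv c cK) (auto simp: K_def matrix_sqrt_eq)
  define g where "g r A = (if A \<in> S r then matrix_sqrt A else 0)" for r A
  have "g r \<in> borel_measurable borel" for r
    unfolding g_def using cont cS
    by (intro borel_measurable_continuous_on_if compact_imp_closed[THEN borel_closed]) auto
  then have meas: "(\<lambda>x. g r (W x)) \<in> borel_measurable M" for r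
    using W by (rule measurable_compose[rotated])
  show ?thesis
  proof (rule borel_measurable_LIMSEQ_metric[OF meas])
    fix x
    obtain n :: nat where n: "norm (matrix_sqrt (W x)) \<le> real n" using real_arch_simple by blast
    have "g r (W x) = matrix_sqrt (W x)" if "r \<ge> n" for r
    proof -
      have "matrix_sqrt (W x) \<in> K r"
        using n that positive_semidefinite_matrix_sqrt[OF psd] by (auto simp: K_def)
      then have "W x \<in> S r"
        unfolding S_def by (rule image_eqI[rotated]) (simp add: matrix_sqrt_square[OF psd])
      then show ?thesis by (simp add: g_def)
    qed
    then show "(\<lambda>r. g r (W x)) \<longlonglongrightarrow> matrix_sqrt (W x)"
      by (intro tendsto_eventually) (auto simp: eventually_sequentially)
  qed
qed

section \<open>Finite laminar families\<close>

definition laminar :: "'a set set \<Rightarrow> bool" where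
  "laminar \<F> \<longleftrightarrow> {} \<notin> \<F> \<and> (\<forall>Q\<in>\<F>. \<forall>R\<in>\<F>. Q \<subseteq> R \<or> R \<subseteq> Q \<or> Q \<inter> R = {})"

definition maximal_sets :: "'a set set \<Rightarrow> 'a set set" where
  "maximal_sets \<U> = {P \<in> \<U>. \<forall>U\<in>\<U>. P \<subseteq> U \<longrightarrow> P = U}"

lemma laminar_subset: "laminar \<F> \<Longrightarrow> \<G> \<subseteq> \<F> \<Longrightarrow> laminar \<G>"
  unfolding laminar_def by (meson subsetD)

lemma laminar_cases:
  assumes "laminar \<F>" "Q \<in> \<F>" "R \<in> \<F>"
  obtains "Q \<subseteq> R" | "R \<subset> Q" | "Q \<inter> R = {}"
proof -
  have "Q \<subseteq> R \<or> R \<subseteq> Q \<or> Q \<inter> R = {}" using assms unfolding laminar_def by simp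
  then show ?thesis using that by auto
qed

lemma maximal_sets_subset: "maximal_sets \<U> \<subseteq> \<U>"
  by (auto simp: maximal_sets_def)

lemma maximal_sets_disjoint:
  assumes "laminar \<U>" "P \<in> maximal_sets \<U>" "P' \<in> maximal_sets \<U>" "P \<noteq> P'"
  shows "P \<inter> P' = {}"
proof -
  have *: "P \<in> \<U>" "P' \<in> \<U>" using assms maximal_sets_subset by (meson subsetD)+
  have max: "P = Q" if "P \<in> maximal_sets \<U>" "Q \<in> \<U>" "P \<subseteq> Q" for P Q
    using that by (simp add: maximal_sets_def)
  show ?thesis
    by (cases rule: laminar_cases[OF assms(1) *]) (use assms max * in \<open>auto dest: psubset_imp_subset\<close>)
qed

lemma maximal_sets_above:
  assumes "finite \<U>" "Q \<in> \<U>"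
  obtains P where "P \<in> maximal_sets \<U>" "Q \<subseteq> P"
  using finite_has_maximal2[OF assms] that unfolding maximal_sets_def by blast

text \<open>
  \<open>\<B> P\<close> is the collection of sets at which \<open>P\<close> stops. The family consists of the maximal members of
  \<open>\<U>\<close> together with a family for the sets at which these stop; the latter lie strictly below, so
  induction on the number of sets below \<open>\<U>\<close> applies.
\<close>

lemma stopping_family_below:
  assumes fin: "finite \<F>" and lam: "laminar \<F>"
    and B: "\<And>P R. P \<in> \<F> \<Longrightarrow> R \<in> \<B> P \<Longrightarrow> R \<in> \<F> \<and> R \<subset> P"
    and U: "\<U> \<subseteq> \<F>"
  shows "\<exists>S. S \<subseteq> {R \<in> \<F>. \<exists>U\<in>\<U>. R \<subseteq> U} \<and>
    (\<forall>Q\<in>\<F>. (\<exists>U\<in>\<U>. Q \<subseteq> U) \<longrightarrow> (\<exists>P\<in>S. Q \<subseteq> P \<and> (\<forall>R\<in>\<B> P. \<not> Q \<subseteq> R))) \<and>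
    (\<forall>P\<in>S. \<forall>R\<in>S. R \<subset> P \<longrightarrow> (\<exists>B\<in>\<B> P. R \<subseteq> B))"
  using U
proof (induction "card {R \<in> \<F>. \<exists>U\<in>\<U>. R \<subseteq> U}" arbitrary: \<U> rule: less_induct)
  case less
  show ?case
  proof (cases "\<U> = {}")
    case True
    then show ?thesis by (intro exI[of _ "{}"]) auto
  next
    case False
    define dc where "dc \<V> = {R \<in> \<F>. \<exists>U\<in>\<V>. R \<subseteq> U}" for \<V>
    define M where "M = maximal_sets \<U>"
    define V where "V = (\<Union>P\<in>M. \<B> P)"
    have finU: "finite \<U>" and lamU: "laminar \<U>"
      using less.prems fin lam finite_subset laminar_subset by blast+
    have MU: "M \<subseteq> \<U>" "M \<subseteq> \<F>" using maximal_sets_subset less.prems unfolding M_def by blast+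
    have Mmax: "P = Q" if "P \<in> M" "Q \<in> \<U>" "P \<subseteq> Q" for P Q
      using that unfolding M_def maximal_sets_def by blast
    have above: "\<exists>P\<in>M. Q \<subseteq> P" if "Q \<in> \<U>" for Q
      using maximal_sets_above[OF finU that] unfolding M_def by metis
    have VF: "V \<subseteq> \<F>" using B MU unfolding V_def by blast
    obtain P0 where P0: "P0 \<in> M" using False above by blast
    have "P0 \<notin> dc V"
    proof
      assume "P0 \<in> dc V"
      then obtain P R where PR: "P \<in> M" "R \<in> \<B> P" "P0 \<subseteq> R" unfolding dc_def V_def by blast
      then have "P0 \<subset> P" using B MU by blast
      then show False using Mmax[OF P0] PR MU by blast
    qed
    moreover have "P0 \<in> dc \<U>" using P0 MU unfolding dc_def by blast
    moreover have "dc V \<subseteq> dc \<U>"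
    proof
      fix R assume "R \<in> dc V"
      then obtain P R' where PR: "P \<in> M" "R' \<in> \<B> P" "R \<subseteq> R'" "R \<in> \<F>" unfolding dc_def V_def by blast
      then have "R \<subseteq> P" using B MU by blast
      then show "R \<in> dc \<U>" using PR MU unfolding dc_def by blast
    qed
    ultimately have "dc V \<subset> dc \<U>" by blast
    then have "card (dc V) < card (dc \<U>)"
      using fin by (intro psubset_card_mono) (auto simp: dc_def)
    from less.hyps[OF this[unfolded dc_def] VF]
    obtain S where S0: "S \<subseteq> dc V \<and>
      (\<forall>Q\<in>\<F>. (\<exists>U\<in>V. Q \<subseteq> U) \<longrightarrow> (\<exists>P\<in>S. Q \<subseteq> P \<and> (\<forall>R\<in>\<B> P. \<not> Q \<subseteq> R))) \<and>
      (\<forall>P\<in>S. \<forall>R\<in>S. R \<subset> P \<longrightarrow> (\<exists>B\<in>\<B> P. R \<subseteq> B))"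
      unfolding dc_def by (elim exE)
    have S: "S \<subseteq> dc V" using S0 by simp
    have cover: "\<exists>P\<in>S. Q \<subseteq> P \<and> (\<forall>R\<in>\<B> P. \<not> Q \<subseteq> R)" if "Q \<in> dc V" for Q
      using S0 that by (simp add: dc_def)
    have sparse: "\<exists>B\<in>\<B> P. R \<subseteq> B" if "P \<in> S" "R \<in> S" "R \<subset> P" for P R
      using S0 that by simp
    have "\<exists>P\<in>M \<union> S. Q \<subseteq> P \<and> (\<forall>R\<in>\<B> P. \<not> Q \<subseteq> R)" if Q: "Q \<in> \<F>" "\<exists>U\<in>\<U>. Q \<subseteq> U" for Q
    proof (cases "Q \<in> dc V")
      case True then show ?thesis using cover by blast
    next
      case False
      from Q(2) obtain U where "U \<in> \<U>" "Q \<subseteq> U" by (elim bexE)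
      moreover then obtain P where "P \<in> M" "U \<subseteq> P" using above by metis
      ultimately have P: "P \<in> M" "Q \<subseteq> P" by auto
      have "\<not> Q \<subseteq> R" if "R \<in> \<B> P" for R
        using False Q(1) P(1) that by (auto simp: dc_def V_def)
      then show ?thesis using P by (intro bexI[of _ P]) auto
    qed
    moreover have "\<exists>B\<in>\<B> P. R \<subseteq> B" if PR: "P \<in> M \<union> S" "R \<in> M \<union> S" "R \<subset> P" for P R
    proof -
      have below: "\<exists>P\<in>M. Q \<subset> P \<and> (\<exists>B\<in>\<B> P. Q \<subseteq> B)" if QS: "Q \<in> S" for Q
      proof -
        obtain R P where "Q \<subseteq> R" "R \<in> \<B> P" "P \<in> M"
          using subsetD[OF S QS] by (auto simp: dc_def V_def)
        moreover then have "R \<subset> P" using B MU by (meson subsetD)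
        ultimately show ?thesis by (meson subset_psubset_trans)
      qed
      have RnM: "R \<notin> M"
      proof
        assume R: "R \<in> M"
        have "\<exists>P'\<in>\<U>. P \<subseteq> P'"
        proof (cases "P \<in> M")
          case True then show ?thesis using MU by auto
        next
          case False then show ?thesis using PR(1) below[of P] MU by auto
        qed
        then obtain P' where "P' \<in> \<U>" "P \<subseteq> P'" by auto
        then show False using Mmax[OF R] PR(3) by blast
      qed
      then have RS: "R \<in> S" using PR by blast
      show ?thesis
      proof (cases "P \<in> S")
        case True then show ?thesis using sparse RS PR by blast
      next
        case False
        then have P: "P \<in> M" using PR by blast
        obtain P' where P': "P' \<in> M" "R \<subset> P'" "\<exists>B\<in>\<B> P'. R \<subseteq> B" using below[OF RS] by blast
        have "R \<noteq> {}" using RS S lam unfolding dc_def laminar_def by blast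
        then have "P = P'" using maximal_sets_disjoint[OF lamU] P P' PR(3) unfolding M_def by blast
        then show ?thesis using P' by blast
      qed
    qed
    moreover have "M \<union> S \<subseteq> dc \<U>"
    proof -
      have "M \<subseteq> dc \<U>" using MU by (auto simp: dc_def)
      then show ?thesis using S \<open>dc V \<subseteq> dc \<U>\<close> by (meson Un_least order_trans)
    qed
    ultimately show ?thesis unfolding dc_def
      by (intro exI[of _ "M \<union> S"] conjI ballI impI) simp_all
  qed
qed

text \<open>
  The first property of \<open>S\<close> says that every set is treated at some \<open>P\<close>; the second one makes \<open>S\<close> sparse
  if the sets at which \<open>P\<close> stops cover only a part of \<open>P\<close>.
\<close>

lemma stopping_family:
  assumes fin: "finite \<F>" and lam: "laminar \<F>"
    and B: "\<And>P R. P \<in> \<F> \<Longrightarrow> R \<in> \<B> P \<Longrightarrow> R \<in> \<F> \<and> R \<subset> P"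
  obtains S where "S \<subseteq> \<F>"
    "\<And>Q. Q \<in> \<F> \<Longrightarrow> \<exists>P\<in>S. Q \<subseteq> P \<and> (\<forall>R\<in>\<B> P. \<not> Q \<subseteq> R)"
    "\<And>P R. P \<in> S \<Longrightarrow> R \<in> S \<Longrightarrow> R \<subset> P \<Longrightarrow> \<exists>B\<in>\<B> P. R \<subseteq> B"
proof -
  have "\<exists>S. S \<subseteq> {R \<in> \<F>. \<exists>U\<in>\<F>. R \<subseteq> U} \<and>
    (\<forall>Q\<in>\<F>. (\<exists>U\<in>\<F>. Q \<subseteq> U) \<longrightarrow> (\<exists>P\<in>S. Q \<subseteq> P \<and> (\<forall>R\<in>\<B> P. \<not> Q \<subseteq> R))) \<and>
    (\<forall>P\<in>S. \<forall>R\<in>S. R \<subset> P \<longrightarrow> (\<exists>B\<in>\<B> P. R \<subseteq> B))"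
    by (rule stopping_family_below[OF fin lam B]) auto
  then obtain S where S: "S \<subseteq> {R \<in> \<F>. \<exists>U\<in>\<F>. R \<subseteq> U} \<and>
    (\<forall>Q\<in>\<F>. (\<exists>U\<in>\<F>. Q \<subseteq> U) \<longrightarrow> (\<exists>P\<in>S. Q \<subseteq> P \<and> (\<forall>R\<in>\<B> P. \<not> Q \<subseteq> R))) \<and>
    (\<forall>P\<in>S. \<forall>R\<in>S. R \<subset> P \<longrightarrow> (\<exists>B\<in>\<B> P. R \<subseteq> B))"
    by (elim exE)
  show ?thesis
  proof (rule that[of S])
    show "S \<subseteq> \<F>" using S by auto
    show "\<exists>P\<in>S. Q \<subseteq> P \<and> (\<forall>R\<in>\<B> P. \<not> Q \<subseteq> R)" if "Q \<in> \<F>" for Q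
      using S that by (metis order_refl)
    show "\<exists>B\<in>\<B> P. R \<subseteq> B" if "P \<in> S" "R \<in> S" "R \<subset> P" for P R
      using S that by simp
  qed
qed

section \<open>Exponential decay from a packing condition\<close>

definition generations_between :: "'a set set \<Rightarrow> 'a set \<Rightarrow> 'a set \<Rightarrow> nat" where
  "generations_between S P R = card {R' \<in> S. R \<subseteq> R' \<and> R' \<subset> P}"

lemma generations_between_strict_mono:
  assumes "finite S" "P \<in> S" "R \<subseteq> P" "P \<subset> P'"
  shows "generations_between S P R < generations_between S P' R"
  unfolding generations_between_def using assms by (intro psubset_card_mono) auto

lemma inj_on_generations_between:
  assumes "finite S" "laminar S" "R \<noteq> {}"
  shows "inj_on (\<lambda>P. generations_between S P R) {P \<in> S. R \<subseteq> P}"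
proof (rule inj_onI, rule ccontr)
  fix P P' assume *: "P \<in> {P \<in> S. R \<subseteq> P}" "P' \<in> {P \<in> S. R \<subseteq> P}"
    "generations_between S P R = generations_between S P' R" "P \<noteq> P'"
  have "P \<subset> P' \<or> P' \<subset> P" using * assms unfolding laminar_def by blast
  then show False using generations_between_strict_mono[OF assms(1)] * by (metis (lifting) less_irrefl mem_Collect_eq)
qed

text \<open>
  The members of \<open>S\<close> between \<open>R\<close> and \<open>P\<close> form a chain, which their generation over \<open>R\<close> enumerates as
  \<open>0, 1, 2, \<dots>\<close>; so the sum is a geometric one.
\<close>

lemma sum_power_generations_between:
  fixes l :: real
  assumes fin: "finite S" and lam: "laminar S" and R: "R \<in> S"
  shows "l ^ generations_between S P R =
    1 + (l - 1) * (\<Sum>R' | R' \<in> S \<and> R \<subseteq> R' \<and> R' \<subset> P. l ^ generations_between S R' R)"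
proof -
  define C where "C = {R' \<in> S. R \<subseteq> R' \<and> R' \<subset> P}"
  define g where "g P = generations_between S P R" for P
  have R0: "R \<noteq> {}" using R lam by (auto simp: laminar_def)
  have finC: "finite C" using fin by (simp add: C_def)
  have inj: "inj_on g C"
    using inj_on_generations_between[OF fin lam R0] unfolding g_def C_def by (rule inj_on_subset) blast
  have "g R' < card C" if "R' \<in> C" for R'
    using that generations_between_strict_mono[OF fin, of R' R P]
    by (simp add: C_def g_def generations_between_def)
  then have "g ` C \<subseteq> {..<card C}" by blast
  then have img: "g ` C = {..<card C}"
    by (intro card_subset_eq) (auto simp: card_image[OF inj])
  have "(\<Sum>R'\<in>C. l ^ g R') = (\<Sum>k<card C. l ^ k)"
    using sum.reindex[OF inj, of "\<lambda>k. l ^ k"] by (simp add: img)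
  then have "(l - 1) * (\<Sum>R'\<in>C. l ^ g R') = l ^ card C - 1"
    by (simp add: power_diff_1_eq)
  then show ?thesis by (simp add: C_def g_def generations_between_def)
qed

lemma sum_inverse_power_generations_between:
  fixes l :: real
  assumes fin: "finite S" and lam: "laminar S" and R: "R \<in> S" and l: "l > 1"
  shows "(\<Sum>P | P \<in> S \<and> R \<subseteq> P. (1 / l) ^ generations_between S P R) \<le> l / (l - 1)"
proof -
  define g where "g P = generations_between S P R" for P
  define C where "C = {P \<in> S. R \<subseteq> P}"
  have R0: "R \<noteq> {}" using R lam by (auto simp: laminar_def)
  have inj: "inj_on g C"
    using inj_on_generations_between[OF fin lam R0] unfolding g_def C_def .
  have sm: "summable (\<lambda>k. (1 / l) ^ k)" using l by (intro summable_geometric) auto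
  have "(\<Sum>P\<in>C. (1 / l) ^ g P) = (\<Sum>k\<in>g ` C. (1 / l) ^ k)"
    using sum.reindex[OF inj, of "\<lambda>k. (1 / l) ^ k"] by simp
  also have "\<dots> \<le> (\<Sum>k. (1 / l) ^ k)"
    using l fin by (intro sum_le_suminf sm) (auto simp: C_def)
  also have "\<dots> = l / (l - 1)"
    using l by (subst suminf_geometric) (auto simp: field_simps)
  finally show ?thesis by (simp add: C_def g_def)
qed

text \<open>
  Think of \<open>e R\<close> as the part of the mass \<open>w R\<close> that lies in no smaller member of \<open>S\<close>. Expanding the
  power as a geometric sum and exchanging the sums, the left-hand side for \<open>P\<close> is expressed through the
  left-hand sides for the smaller members, to which induction applies; the packing condition then sums
  the bounds \<open>2 * w R'\<close>, and the base of the power is such that the recursion closes.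
\<close>

lemma packing_imp_exponential_decay:
  fixes w e :: "'a set \<Rightarrow> real"
  assumes fin: "finite S" and lam: "laminar S" and A: "A > 0"
    and e: "\<And>R. R \<in> S \<Longrightarrow> 0 \<le> e R" and w: "\<And>R. R \<in> S \<Longrightarrow> 0 \<le> w R"
    and ew: "\<And>R. R \<in> S \<Longrightarrow> (\<Sum>R' | R' \<in> S \<and> R' \<subseteq> R. e R') \<le> w R"
    and packing: "\<And>R. R \<in> S \<Longrightarrow> (\<Sum>R' | R' \<in> S \<and> R' \<subseteq> R. w R') \<le> A * w R"
    and P: "P \<in> S"
  shows "(\<Sum>R | R \<in> S \<and> R \<subseteq> P. e R * (1 + 1 / (2 * A)) ^ generations_between S P R) \<le> 2 * w P"
  using P
proof (induction "card {R \<in> S. R \<subset> P}" arbitrary: P rule: less_induct)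
  case less
  define l where "l = 1 + 1 / (2 * A)"
  define g where "g = generations_between S"
  have "(\<Sum>R | R \<in> S \<and> R \<subseteq> P. e R * l ^ g P R) =
    (\<Sum>R | R \<in> S \<and> R \<subseteq> P. e R) + (l - 1) *
      (\<Sum>R | R \<in> S \<and> R \<subseteq> P. \<Sum>R' | R' \<in> {R' \<in> S. R' \<subset> P} \<and> R \<subseteq> R'. e R * l ^ g R' R)"
  proof -
    have "e R * l ^ g P R = e R + (l - 1) *
        (\<Sum>R' | R' \<in> {R' \<in> S. R' \<subset> P} \<and> R \<subseteq> R'. e R * l ^ g R' R)" if "R \<in> S" for R
    proof -
      have "{R' \<in> {R' \<in> S. R' \<subset> P}. R \<subseteq> R'} = {R' \<in> S. R \<subseteq> R' \<and> R' \<subset> P}" by blast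
      then show ?thesis
        using sum_power_generations_between[OF fin lam that, of l P]
        by (simp add: g_def algebra_simps sum_distrib_left)
    qed
    then have "(\<Sum>R | R \<in> S \<and> R \<subseteq> P. e R * l ^ g P R) =
      (\<Sum>R | R \<in> S \<and> R \<subseteq> P. e R + (l - 1) *
        (\<Sum>R' | R' \<in> {R' \<in> S. R' \<subset> P} \<and> R \<subseteq> R'. e R * l ^ g R' R))"
      by (intro sum.cong) auto
    then show ?thesis by (simp add: sum.distrib sum_distrib_left)
  qed
  also have "(\<Sum>R | R \<in> S \<and> R \<subseteq> P. \<Sum>R' | R' \<in> {R' \<in> S. R' \<subset> P} \<and> R \<subseteq> R'. e R * l ^ g R' R) =
    (\<Sum>R' | R' \<in> S \<and> R' \<subset> P. \<Sum>R | R \<in> {R \<in> S. R \<subseteq> P} \<and> R \<subseteq> R'. e R * l ^ g R' R)"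
    using fin by (intro sum.swap_restrict) auto
  also have "\<dots> \<le> (\<Sum>R' | R' \<in> S \<and> R' \<subset> P. 2 * w R')"
  proof (rule sum_mono)
    fix R' assume R': "R' \<in> {R' \<in> S. R' \<subset> P}"
    then have "{R \<in> {R \<in> S. R \<subseteq> P}. R \<subseteq> R'} = {R \<in> S. R \<subseteq> R'}" by blast
    moreover have "card {R \<in> S. R \<subset> R'} < card {R \<in> S. R \<subset> P}"
      using R' fin by (intro psubset_card_mono) auto
    ultimately show "(\<Sum>R | R \<in> {R \<in> S. R \<subseteq> P} \<and> R \<subseteq> R'. e R * l ^ g R' R) \<le> 2 * w R'"
      using less.hyps[of R'] R' by (simp add: l_def g_def)
  qed
  also have "\<dots> \<le> (\<Sum>R' | R' \<in> S \<and> R' \<subseteq> P. 2 * w R')"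
    using fin w by (intro sum_mono2) auto
  also have "\<dots> \<le> 2 * (A * w P)"
    using packing[OF less.prems] by (simp flip: sum_distrib_left)
  finally have "(\<Sum>R | R \<in> S \<and> R \<subseteq> P. e R * l ^ g P R) \<le>
      (\<Sum>R | R \<in> S \<and> R \<subseteq> P. e R) + (l - 1) * (2 * (A * w P))"
    using A by (simp add: l_def divide_right_mono)
  also have "\<dots> \<le> w P + (l - 1) * (2 * (A * w P))"
    using ew[OF less.prems] by simp
  also have "\<dots> = 2 * w P" using A by (simp add: l_def)
  finally show ?case by (simp add: l_def g_def)
qed

section \<open>Dyadic cubes\<close>

abbreviation vol :: "(real ^ 'n) set \<Rightarrow> real" where "vol \<equiv> measure lebesgue"

text \<open>
  The position of the cube of side length \<open>2 powi k\<close> that contains \<open>x\<close>, in the lattice shifted by \<open>a\<close>.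
  In these terms passing to a coarser generation is integer division by a power of \<open>2\<close>.
\<close>

definition cube_index :: "real ^ 'n \<Rightarrow> int \<Rightarrow> real ^ 'n \<Rightarrow> 'n \<Rightarrow> int" where
  "cube_index a k x = (\<lambda>i. \<lfloor>(x $ i - a $ i) / 2 powi k\<rfloor>)"

definition dyadic_cube :: "real ^ 'n \<Rightarrow> int \<Rightarrow> ('n \<Rightarrow> int) \<Rightarrow> (real ^ 'n) set" where
  "dyadic_cube a k m = {x. cube_index a k x = m}"

lemma mem_dyadic_cube: "x \<in> dyadic_cube a k m \<longleftrightarrow> cube_index a k x = m"
  by (simp add: dyadic_cube_def)

lemma mem_dyadic_cube_iff:
  "x \<in> dyadic_cube a k m \<longleftrightarrow>
    (\<forall>i. a $ i + of_int (m i) * 2 powi k \<le> x $ i \<and> x $ i < a $ i + (of_int (m i) + 1) * 2 powi k)"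
proof -
  have p: "(0::real) < 2 powi k" by simp
  show ?thesis
    unfolding mem_dyadic_cube cube_index_def fun_eq_iff floor_eq_iff
    by (simp add: pos_le_divide_eq[OF p] pos_divide_less_eq[OF p] algebra_simps)
qed

lemma translate_standard_dyadic_cube:
  "(\<lambda>x. x + a) ` standard_dyadic_cube k m = dyadic_cube a k m"
proof (intro set_eqI iffI)
  fix x assume "x \<in> dyadic_cube a k m"
  then have "x - a \<in> standard_dyadic_cube k m"
    by (simp add: mem_dyadic_cube_iff standard_dyadic_cube_def algebra_simps)
  then show "x \<in> (\<lambda>x. x + a) ` standard_dyadic_cube k m" by (rule rev_image_eqI) simp
qed (auto simp: mem_dyadic_cube_iff standard_dyadic_cube_def algebra_simps)

lemma dyadic_cube_nonempty: "dyadic_cube a k m \<noteq> {}"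
proof -
  have "(\<chi> i. a $ i + of_int (m i) * 2 powi k) \<in> dyadic_cube a k m"
    by (simp add: mem_dyadic_cube_iff algebra_simps)
  then show ?thesis by blast
qed

lemma cube_index_coarser: "cube_index a (k + int j) x i = cube_index a k x i div 2 ^ j"
proof -
  have "(x $ i - a $ i) / 2 powi (k + int j) = (x $ i - a $ i) / 2 powi k / real_of_int (2 ^ j)"
    by (simp add: power_int_add)
  then show ?thesis
    unfolding cube_index_def by (simp only: floor_divide_real_eq_div zero_le_power zero_le_numeral)
qed

lemma dyadic_cube_coarser:
  "dyadic_cube a k m \<subseteq> dyadic_cube a (k + int j) (\<lambda>i. m i div 2 ^ j)"
  by (auto simp: mem_dyadic_cube cube_index_coarser fun_eq_iff)

lemma dyadic_cubes_nested:
  assumes "k \<le> k'" "dyadic_cube a k m \<inter> dyadic_cube a k' m' \<noteq> {}"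
  shows "dyadic_cube a k m \<subseteq> dyadic_cube a k' m'"
proof -
  from assms(1) obtain j where j: "k' = k + int j" using zle_iff_zadd by blast
  obtain x where "x \<in> dyadic_cube a k m" "x \<in> dyadic_cube a k' m'" using assms(2) by blast
  then have "m' = (\<lambda>i. m i div 2 ^ j)" by (auto simp: mem_dyadic_cube cube_index_coarser j)
  then show ?thesis using dyadic_cube_coarser j by metis
qed

lemma
  fixes a :: "real ^ 'n"
  shows lmeasurable_dyadic_cube: "dyadic_cube a k m \<in> lmeasurable"
    and measure_dyadic_cube: "measure lebesgue (dyadic_cube a k m) = (2 powi k) ^ CARD('n)"
    and bounded_dyadic_cube: "bounded (dyadic_cube a k m)"
proof -
  define l u where "l = (\<chi> i. a $ i + of_int (m i) * 2 powi k)"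
    and "u = (\<chi> i. a $ i + (of_int (m i) + 1) * 2 powi k)"
  have sub: "box l u \<subseteq> dyadic_cube a k m" "dyadic_cube a k m \<subseteq> cbox l u"
    by (auto simp: mem_dyadic_cube_iff l_def u_def mem_box_cart less_imp_le)
  then show "bounded (dyadic_cube a k m)" using bounded_cbox bounded_subset by blast
  have "(cbox l u - dyadic_cube a k m) \<union> (dyadic_cube a k m - cbox l u) \<subseteq> cbox l u - box l u" using sub by blast
  then have neg: "negligible ((cbox l u - dyadic_cube a k m) \<union> (dyadic_cube a k m - cbox l u))"
    using negligible_subset negligible_frontier_interval by blast
  show "dyadic_cube a k m \<in> lmeasurable"
    by (rule lmeasurable_negligible_symdiff[OF lmeasurable_cbox neg])
  have "l \<in> cbox l u" by (simp add: l_def u_def mem_box_cart algebra_simps)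
  then have "cbox l u \<noteq> {}" by blast
  then have "measure lebesgue (cbox l u) = (\<Prod>i\<in>UNIV. u $ i - l $ i)"
    using content_cbox_cart[of l u] by simp
  also have "\<dots> = (\<Prod>i\<in>(UNIV::'n set). 2 powi k)" by (simp add: l_def u_def algebra_simps)
  also have "\<dots> = (2 powi k) ^ CARD('n)" by simp
  finally show "measure lebesgue (dyadic_cube a k m) = (2 powi k) ^ CARD('n)"
    using measure_negligible_symdiff[OF lmeasurable_cbox neg] by simp
qed

lemma power_int_2_inject: "(2::real) powi k = 2 powi k' \<Longrightarrow> k = k'"
  by (metis linorder_neqE_linordered_idom less_irrefl one_less_numeral_iff power_int_strict_increasing semiring_norm(76))

lemma dyadic_cube_eq_iff:
  fixes a :: "real ^ 'n"
  shows "dyadic_cube a k m = dyadic_cube a k' m' \<longleftrightarrow> k = k' \<and> m = m'"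
proof
  assume eq: "dyadic_cube a k m = dyadic_cube a k' m'"
  then have "((2::real) powi k) ^ CARD('n) = (2 powi k') ^ CARD('n)"
    using measure_dyadic_cube[of a k m] measure_dyadic_cube[of a k' m'] by simp
  then have "(2::real) powi k = 2 powi k'" by (rule power_eq_imp_eq_base) auto
  then have "k = k'" by (rule power_int_2_inject)
  moreover obtain x where "x \<in> dyadic_cube a k m" using dyadic_cube_nonempty by blast
  ultimately show "k = k' \<and> m = m'" using eq by (auto simp: mem_dyadic_cube)
qed auto

locale dyadic_grid =
  fixes D :: "(real ^ 'n) set set" and a :: "real ^ 'n"
  assumes D_eq: "D = {dyadic_cube a k m | k m. True}"
begin

abbreviation cube :: "int \<Rightarrow> ('n \<Rightarrow> int) \<Rightarrow> (real ^ 'n) set" where "cube \<equiv> dyadic_cube a"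

lemma cube_mem: "cube k m \<in> D" by (auto simp: D_eq)

lemma cube_cases: "Q \<in> D \<Longrightarrow> (\<And>k m. Q = cube k m \<Longrightarrow> thesis) \<Longrightarrow> thesis"
  by (auto simp: D_eq)

definition gen :: "(real ^ 'n) set \<Rightarrow> int" where "gen Q = (THE k. \<exists>m. Q = cube k m)"

lemma gen_cube [simp]: "gen (cube k m) = k"
  unfolding gen_def by (rule the_equality) (auto simp: dyadic_cube_eq_iff)

lemma laminar_grid: "laminar D"
  unfolding laminar_def
proof (intro conjI ballI)
  show "{} \<notin> D" using dyadic_cube_nonempty by (auto simp: D_eq)
  fix Q R assume "Q \<in> D" "R \<in> D"
  then obtain k m k' m' where "Q = cube k m" "R = cube k' m'" by (auto simp: D_eq)
  then show "Q \<subseteq> R \<or> R \<subseteq> Q \<or> Q \<inter> R = {}"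
    using dyadic_cubes_nested[of k k' a m m'] dyadic_cubes_nested[of k' k a m' m]
    by (cases "k \<le> k'") (auto simp: Int_commute)
qed

lemma grid_lmeasurable: "Q \<in> D \<Longrightarrow> Q \<in> lmeasurable"
  by (auto simp: D_eq lmeasurable_dyadic_cube)

lemma grid_sets: "Q \<in> D \<Longrightarrow> Q \<in> sets lebesgue"
  using grid_lmeasurable by (simp add: fmeasurableD)

lemma grid_bounded: "Q \<in> D \<Longrightarrow> bounded Q"
  by (auto simp: D_eq bounded_dyadic_cube)

lemma grid_measure_pos: "Q \<in> D \<Longrightarrow> 0 < vol Q"
  by (auto simp: D_eq measure_dyadic_cube)

lemma descendants_cube:
  "R \<in> descendants D j (cube k m) \<longleftrightarrow>
    (\<exists>m'. R = cube (k - int j) m' \<and> (\<forall>i. m' i div 2 ^ j = m i))"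
proof
  assume "R \<in> descendants D j (cube k m)"
  then have R: "R \<in> D" "R \<subseteq> cube k m" "vol (cube k m) = 2 ^ (j * CARD('n)) * vol R"
    by (auto simp: descendants_def)
  then obtain k' m' where R': "R = cube k' m'" by (auto simp: D_eq)
  have "((2::real) powi k) ^ CARD('n) = (2 powi (k' + int j)) ^ CARD('n)"
    using R(3) by (simp add: R' measure_dyadic_cube power_int_add power_mult power_mult_distrib)
  then have "(2::real) powi k = 2 powi (k' + int j)" by (rule power_eq_imp_eq_base) auto
  then have k: "k = k' + int j" by (rule power_int_2_inject)
  obtain x where "x \<in> R" using dyadic_cube_nonempty R' by blast
  then have "cube_index a k' x = m'" "cube_index a k x = m"
    using R(2) by (auto simp: R' mem_dyadic_cube)
  then have "m' i div 2 ^ j = m i" for i using cube_index_coarser[of a k' j x i] by (simp add: k)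
  then show "\<exists>m'. R = cube (k - int j) m' \<and> (\<forall>i. m' i div 2 ^ j = m i)"
    using R' k by auto
next
  assume "\<exists>m'. R = cube (k - int j) m' \<and> (\<forall>i. m' i div 2 ^ j = m i)"
  then obtain m' where R: "R = cube (k - int j) m'" and m: "(\<lambda>i. m' i div 2 ^ j) = m" by auto
  have "R \<subseteq> cube k m" using dyadic_cube_coarser[of a "k - int j" m' j] by (simp add: R m)
  moreover have "(2::real) powi k = 2 ^ j * 2 powi (k - int j)"
    by (simp add: power_int_diff)
  then have "vol (cube k m) = 2 ^ (j * CARD('n)) * vol R"
    by (simp add: R measure_dyadic_cube power_mult power_mult_distrib)
  ultimately show "R \<in> descendants D j (cube k m)"
    by (auto simp: descendants_def R cube_mem)
qed

lemma descendants_cube_image: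
  "descendants D j (cube k m) = (\<lambda>x. cube (k - int j) (cube_index a (k - int j) x)) ` cube k m"
proof (intro set_eqI iffI)
  fix R assume "R \<in> descendants D j (cube k m)"
  then obtain m' where R: "R = cube (k - int j) m'" "\<forall>i. m' i div 2 ^ j = m i"
    unfolding descendants_cube by blast
  obtain x where x: "x \<in> R" using dyadic_cube_nonempty R by blast
  then have "cube_index a (k - int j) x = m'" by (simp add: R mem_dyadic_cube)
  moreover have "x \<in> cube k m"
    using x dyadic_cube_coarser[of a "k - int j" m' j] R by auto
  ultimately show "R \<in> (\<lambda>x. cube (k - int j) (cube_index a (k - int j) x)) ` cube k m"
    using R by blast
next
  fix R assume "R \<in> (\<lambda>x. cube (k - int j) (cube_index a (k - int j) x)) ` cube k m"
  then obtain x where x: "x \<in> cube k m" "R = cube (k - int j) (cube_index a (k - int j) x)" by blast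
  have "cube_index a (k - int j) x i div 2 ^ j = m i" for i
    using cube_index_coarser[of a "k - int j" j x i] x by (simp add: mem_dyadic_cube)
  then show "R \<in> descendants D j (cube k m)" using x unfolding descendants_cube by blast
qed

lemma gen_descendants: "Q \<in> D \<Longrightarrow> R \<in> descendants D j Q \<Longrightarrow> gen R = gen Q - int j"
  by (erule cube_cases) (auto simp: descendants_cube)

lemma descendants_subset_grid: "descendants D j Q \<subseteq> D" by (auto simp: descendants_def)

lemma descendants_subset: "R \<in> descendants D j Q \<Longrightarrow> R \<subseteq> Q" by (auto simp: descendants_def)

lemma descendants_measure: "R \<in> descendants D j Q \<Longrightarrow> vol Q = 2 ^ (j * CARD('n)) * vol R"
  by (auto simp: descendants_def)

lemma Union_descendants: "Q \<in> D \<Longrightarrow> \<Union>(descendants D j Q) = Q"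
proof
  assume Q: "Q \<in> D"
  show "\<Union>(descendants D j Q) \<subseteq> Q" using descendants_subset by blast
  from Q obtain k m where Q: "Q = cube k m" by (auto simp: D_eq)
  show "Q \<subseteq> \<Union>(descendants D j Q)"
    unfolding Q descendants_cube_image by (auto simp: mem_dyadic_cube)
qed

lemma descendants_disjoint:
  assumes "Q \<in> D" "R \<in> descendants D j Q" "R' \<in> descendants D j Q" "R \<noteq> R'"
  shows "R \<inter> R' = {}"
  using assms(2-) by (rule_tac cube_cases[OF assms(1)]) (auto simp: descendants_cube mem_dyadic_cube)

lemma finite_descendants: "Q \<in> D \<Longrightarrow> finite (descendants D j Q)"
proof -
  assume "Q \<in> D"
  then obtain k m where Q: "Q = cube k m" by (auto simp: D_eq)
  have "descendants D j Q \<subseteq> cube (k - int j) ` (\<Pi>\<^sub>E i\<in>UNIV. {m i * 2 ^ j ..< (m i + 1) * 2 ^ j})"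
  proof
    fix R assume "R \<in> descendants D j Q"
    then obtain m' where R: "R = cube (k - int j) m'" "\<And>i. m' i div 2 ^ j = m i"
      unfolding Q descendants_cube by blast
    have "m' i \<in> {m i * 2 ^ j ..< (m i + 1) * 2 ^ j}" for i
    proof -
      have "(m' i div 2 ^ j) * 2 ^ j + m' i mod 2 ^ j = m' i" by (rule div_mult_mod_eq)
      moreover have "0 \<le> m' i mod 2 ^ j" "m' i mod 2 ^ j < 2 ^ j" by simp_all
      ultimately show ?thesis unfolding atLeastLessThan_iff R(2)[of i, symmetric] distrib_right
        by linarith
    qed
    then show "R \<in> cube (k - int j) ` (\<Pi>\<^sub>E i\<in>UNIV. {m i * 2 ^ j ..< (m i + 1) * 2 ^ j})"
      using R by (auto simp: PiE_UNIV_domain)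
  qed
  moreover have "finite (\<Pi>\<^sub>E i\<in>(UNIV::'n set). {m i * 2 ^ j ..< (m i + 1) * 2 ^ j})"
    by (intro finite_PiE) auto
  ultimately show ?thesis by (meson finite_imageI finite_subset)
qed

lemma ancestor: "Q \<in> D \<Longrightarrow> \<exists>P\<in>D. Q \<in> descendants D j P"
proof -
  assume "Q \<in> D"
  then obtain k m where Q: "Q = cube k m" by (auto simp: D_eq)
  have "Q \<in> descendants D j (cube (k + int j) (\<lambda>i. m i div 2 ^ j))"
    unfolding descendants_cube Q by auto
  then show ?thesis using cube_mem by blast
qed

lemma subset_imp_descendant:
  assumes "Q \<in> D" "R \<in> D" "gen R = gen Q - int j" "R \<inter> Q \<noteq> {}"
  shows "R \<in> descendants D j Q"
proof -
  obtain k m k' m' where eq: "Q = cube k m" "R = cube k' m'" using assms by (auto simp: D_eq)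
  have k: "k = k' + int j" using assms eq by simp
  obtain x where x: "x \<in> R" "x \<in> Q" using assms by blast
  then have "m' i div 2 ^ j = m i" for i
    using cube_index_coarser[of a k' j x i] by (auto simp: eq mem_dyadic_cube k)
  then show ?thesis unfolding eq descendants_cube k by auto
qed

lemma gen_mono:
  assumes "Q \<in> D" "R \<in> D" "R \<subseteq> Q"
  shows "gen R \<le> gen Q"
proof (rule ccontr)
  obtain k m k' m' where eq: "Q = cube k m" "R = cube k' m'" using assms by (auto simp: D_eq)
  assume "\<not> gen R \<le> gen Q"
  then have "k < k'" by (simp add: eq)
  moreover have "R \<inter> Q \<noteq> {}" using assms dyadic_cube_nonempty eq by (simp add: inf.absorb1)
  ultimately have "Q \<subseteq> R" using dyadic_cubes_nested[of k k' a m m'] by (auto simp: eq)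
  then have "Q = R" using assms by auto
  then show False using \<open>k < k'\<close> eq by (simp add: dyadic_cube_eq_iff)
qed

lemma gen_eq_imp_eq:
  assumes "Q \<in> D" "R \<in> D" "R \<inter> Q \<noteq> {}" "gen R = gen Q"
  shows "R = Q"
  using assms by (auto simp: D_eq mem_dyadic_cube)

end

section \<open>Localized estimates on a finite tree of cubes\<close>

lemma set_integral_disjoint_Union:
  fixes f :: "_ \<Rightarrow> _ :: {banach, second_countable_topology}"
  assumes "finite \<C>" "\<And>Z Z'. Z \<in> \<C> \<Longrightarrow> Z' \<in> \<C> \<Longrightarrow> Z \<noteq> Z' \<Longrightarrow> Z \<inter> Z' = {}"
    "\<And>Z. Z \<in> \<C> \<Longrightarrow> Z \<in> sets M" "set_integrable M P f" "\<Union>\<C> \<subseteq> P"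
  shows "(LINT x:\<Union>\<C>|M. f x) = (\<Sum>Z\<in>\<C>. LINT x:Z|M. f x)"
proof -
  have "disjoint_family_on (\<lambda>Z. Z) \<C>" using assms(2) by (simp add: disjoint_family_on_def)
  moreover have "set_integrable M Z f" if "Z \<in> \<C>" for Z
    using assms(3-5) that by (intro set_integrable_subset[OF assms(4)]) auto
  ultimately show ?thesis
    using set_integral_finite_Union[of \<C> "\<lambda>Z. Z" M f] assms(1,3) by simp
qed

lemma set_integral_mono_set:
  fixes f :: "_ \<Rightarrow> real"
  assumes "set_integrable M P f" "Q \<in> sets M" "Q \<subseteq> P" "\<And>x. x \<in> P \<Longrightarrow> 0 \<le> f x"
  shows "(LINT x:Q|M. f x) \<le> (LINT x:P|M. f x)"
  using assms set_integrable_subset[OF assms(1-3)]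
  unfolding set_lebesgue_integral_def set_integrable_def
  by (intro integral_mono) (auto split: split_indicator)

lemma norm_set_integral_le:
  fixes f :: "_ \<Rightarrow> _ :: {banach, second_countable_topology}"
  shows "norm (LINT x:Q|M. f x) \<le> (LINT x:Q|M. norm (f x))"
  unfolding set_lebesgue_integral_def
  by (rule order_trans[OF integral_norm_bound]) (auto intro!: Bochner_Integration.integral_mono' simp: abs_mult)

lemma measure_disjoint_Union:
  assumes "finite \<C>" "\<And>Z Z'. Z \<in> \<C> \<Longrightarrow> Z' \<in> \<C> \<Longrightarrow> Z \<noteq> Z' \<Longrightarrow> Z \<inter> Z' = {}"
    "\<And>Z. Z \<in> \<C> \<Longrightarrow> Z \<in> lmeasurable"
  shows "vol (\<Union>\<C>) = (\<Sum>Z\<in>\<C>. vol Z)"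
  using assms by (intro measure_Union') (auto simp: pairwise_def disjnt_def)

text \<open>
  A finite piece of a lattice from which all but every \<open>s\<close>-th generation have been removed, so that
  the children \<open>ch Q\<close> may be much smaller than \<open>Q\<close>; \<open>\<I>\<close> consists of the cubes with children, the
  remaining members of \<open>\<F>\<close> are the leaves, and \<open>M\<close> bounds the ratio of volumes.
\<close>

locale cube_tree =
  fixes \<F> \<I> :: "(real ^ 'n) set set" and ch :: "(real ^ 'n) set \<Rightarrow> (real ^ 'n) set set" and M :: real
  assumes finite_tree: "finite \<F>" and laminar_tree: "laminar \<F>"
    and lmeasurable_tree: "Q \<in> \<F> \<Longrightarrow> Q \<in> lmeasurable"
    and vol_pos: "Q \<in> \<F> \<Longrightarrow> 0 < vol Q"
    and internal_subset: "\<I> \<subseteq> \<F>"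
    and ch_subset: "Q \<in> \<I> \<Longrightarrow> ch Q \<subseteq> \<F>"
    and Union_ch: "Q \<in> \<I> \<Longrightarrow> \<Union>(ch Q) = Q"
    and ch_disjoint: "Q \<in> \<I> \<Longrightarrow> R \<in> ch Q \<Longrightarrow> R' \<in> ch Q \<Longrightarrow> R \<noteq> R' \<Longrightarrow> R \<inter> R' = {}"
    and ch_psubset: "Q \<in> \<I> \<Longrightarrow> R \<in> ch Q \<Longrightarrow> R \<subset> Q"
    and vol_ch: "Q \<in> \<I> \<Longrightarrow> R \<in> ch Q \<Longrightarrow> vol Q \<le> M * vol R"
    and below_ch: "Q \<in> \<I> \<Longrightarrow> R \<in> \<F> \<Longrightarrow> R \<subset> Q \<Longrightarrow> \<exists>Q'\<in>ch Q. R \<subseteq> Q'"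
    and leaf: "L \<in> \<F> \<Longrightarrow> L \<notin> \<I> \<Longrightarrow> R \<in> \<F> \<Longrightarrow> R \<subseteq> L \<Longrightarrow> R = L"
    and M_ge_1: "1 \<le> M"
begin

lemma tree_nonempty: "Q \<in> \<F> \<Longrightarrow> Q \<noteq> {}"
  using laminar_tree by (auto simp: laminar_def)

lemma tree_sets: "Q \<in> \<F> \<Longrightarrow> Q \<in> sets lebesgue"
  using lmeasurable_tree by (simp add: fmeasurableD)

lemma internal_tree: "Q \<in> \<I> \<Longrightarrow> Q \<in> \<F>" using internal_subset by auto

lemma ch_tree: "Q \<in> \<I> \<Longrightarrow> R \<in> ch Q \<Longrightarrow> R \<in> \<F>" using ch_subset by auto

lemma finite_ch: "Q \<in> \<I> \<Longrightarrow> finite (ch Q)"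
  using ch_subset finite_tree finite_subset by metis

lemma finite_internal: "finite \<I>"
  using internal_subset finite_tree finite_subset by metis

lemma ch_subset_imp_eq:
  assumes "Q \<in> \<I>" "R \<in> ch Q" "R' \<in> ch Q" "R \<subseteq> R'"
  shows "R = R'"
  using ch_disjoint[OF assms(1-3)] tree_nonempty[OF ch_tree[OF assms(1,2)]] assms(4) by auto

lemma between_ch:
  assumes "Q \<in> \<I>" "S \<in> ch Q" "R \<in> \<F>" "S \<subseteq> R" "R \<subset> Q"
  shows "S = R"
proof -
  obtain Q' where "Q' \<in> ch Q" "R \<subseteq> Q'" using below_ch[OF assms(1,3,5)] by auto
  moreover then have "S = Q'" using ch_subset_imp_eq[OF assms(1,2)] assms(4) by auto
  ultimately show ?thesis using assms(4) by auto
qed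

lemma comparable:
  assumes "Q \<in> \<F>" "R \<in> \<F>" "S \<in> \<F>" "S \<subseteq> Q" "S \<subseteq> R"
  shows "Q \<subseteq> R \<or> R \<subset> Q"
  using laminar_cases[OF laminar_tree assms(1,2)] tree_nonempty[OF assms(3)] assms(4,5) by auto

lemma ch_determines_parent:
  assumes "Q \<in> \<I>" "Q' \<in> \<I>" "S \<in> ch Q" "S \<in> ch Q'"
  shows "Q = Q'"
proof (rule ccontr)
  assume ne: "Q \<noteq> Q'"
  have S: "S \<subset> Q" "S \<subset> Q'" "S \<in> \<F>" using assms ch_psubset ch_tree by auto
  have "Q \<subseteq> Q' \<or> Q' \<subset> Q"
    using comparable[OF internal_tree[OF assms(1)] internal_tree[OF assms(2)] S(3)] S by auto
  then show False
    using between_ch[OF assms(2,4) internal_tree[OF assms(1)]] between_ch[OF assms(1,3) internal_tree[OF assms(2)]]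
      S ne by auto
qed

lemma parent_exists:
  assumes "Z \<in> \<F>" "P \<in> \<F>" "Z \<subset> P"
  obtains Q where "Q \<in> \<I>" "Q \<subseteq> P" "Z \<in> ch Q"
proof -
  define \<U> where "\<U> = {Q \<in> \<F>. Z \<subset> Q \<and> Q \<subseteq> P}"
  have "finite \<U>" "P \<in> \<U>" using finite_tree assms by (auto simp: \<U>_def)
  then obtain Q where Q: "Q \<in> \<U>" and min: "\<And>U. U \<in> \<U> \<Longrightarrow> U \<subseteq> Q \<Longrightarrow> Q = U"
    using finite_has_minimal2[of \<U> P] by auto
  have QF: "Q \<in> \<F>" "Z \<subset> Q" "Q \<subseteq> P" using Q by (auto simp: \<U>_def)
  have QI: "Q \<in> \<I>" using leaf[OF QF(1) _ assms(1)] QF(2) by auto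
  obtain Q' where Q': "Q' \<in> ch Q" "Z \<subseteq> Q'" using below_ch[OF QI assms(1) QF(2)] by auto
  have "Q' \<subset> Q" "Q' \<in> \<F>" using ch_psubset[OF QI Q'(1)] ch_tree[OF QI Q'(1)] by auto
  then have "Z = Q'" using min[of Q'] Q' QF by (auto simp: \<U>_def)
  then show ?thesis using that QI QF Q' by auto
qed

lemma leaf_containing:
  assumes "S \<in> \<F>" "x \<in> S"
  obtains L where "L \<in> \<F>" "L \<notin> \<I>" "x \<in> L" "L \<subseteq> S"
proof -
  define \<U> where "\<U> = {Q \<in> \<F>. x \<in> Q \<and> Q \<subseteq> S}"
  have "finite \<U>" "S \<in> \<U>" using finite_tree assms by (auto simp: \<U>_def)
  then obtain L where L: "L \<in> \<U>" and min: "\<And>U. U \<in> \<U> \<Longrightarrow> U \<subseteq> L \<Longrightarrow> L = U"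
    using finite_has_minimal2[of \<U> S] by auto
  have "L \<notin> \<I>"
  proof
    assume LI: "L \<in> \<I>"
    have "x \<in> \<Union>(ch L)" using L Union_ch[OF LI] by (auto simp: \<U>_def)
    then obtain Q where Q: "Q \<in> ch L" "x \<in> Q" by auto
    then have "Q \<subset> L" "Q \<in> \<F>" using ch_psubset[OF LI] ch_tree[OF LI] by auto
    then show False using min[of Q] Q L by (auto simp: \<U>_def)
  qed
  then show ?thesis using that L by (auto simp: \<U>_def)
qed

text \<open>
  Telescoping: with \<open>\<phi> Q = |\<integral>\<^sub>Q G|\<^sup>2 / |Q|\<close> the differences below are the squared norms of the
  martingale differences of \<open>G\<close>, so this is Bessel's inequality for them.
\<close>

lemma telescoping_le:
  fixes \<phi> :: "(real ^ 'n) set \<Rightarrow> real"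
  assumes R: "\<R> \<subseteq> \<I>" and C: "finite \<C>" and ch: "\<And>Q. Q \<in> \<R> \<Longrightarrow> ch Q \<subseteq> \<R> \<union> \<C>"
    and nonneg: "\<And>Q. 0 \<le> \<phi> Q"
  shows "(\<Sum>Q\<in>\<R>. (\<Sum>S\<in>ch Q. \<phi> S) - \<phi> Q) \<le> (\<Sum>Z\<in>\<C>. \<phi> Z)"
proof -
  have finR: "finite \<R>" using R finite_internal finite_subset by metis
  have "(\<Sum>Q\<in>\<R>. \<Sum>S\<in>ch Q. \<phi> S) = (\<Sum>S\<in>(\<Union>Q\<in>\<R>. ch Q). \<phi> S)"
  proof (rule sum.UNION_disjoint[symmetric])
    show "\<forall>Q\<in>\<R>. \<forall>Q'\<in>\<R>. Q \<noteq> Q' \<longrightarrow> ch Q \<inter> ch Q' = {}"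
      using R ch_determines_parent by (metis disjoint_iff subsetD)
  qed (use R finR finite_ch in auto)
  also have "\<dots> \<le> (\<Sum>S\<in>\<R> \<union> \<C>. \<phi> S)"
    using finR C ch nonneg by (intro sum_mono2) auto
  also have "\<dots> \<le> (\<Sum>S\<in>\<R>. \<phi> S) + (\<Sum>S\<in>\<C>. \<phi> S)"
    using finR C nonneg sum.union_inter[of \<R> \<C> \<phi>] sum_nonneg[of "\<R> \<inter> \<C>" \<phi>] by auto
  finally show ?thesis by (simp add: sum_subtractf)
qed

lemma set_integral_ch:
  fixes F :: "real ^ 'n \<Rightarrow> 'b :: {banach, second_countable_topology}"
  assumes "Q \<in> \<I>" "set_integrable lebesgue Q F"
  shows "(LINT x:Q|lebesgue. F x) = (\<Sum>R\<in>ch Q. LINT x:R|lebesgue. F x)"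
  using set_integral_disjoint_Union[of "ch Q" lebesgue Q F] assms finite_ch[OF assms(1)]
    ch_disjoint[OF assms(1)] tree_sets[OF ch_tree[OF assms(1)]] Union_ch[OF assms(1)] by auto

lemma vol_eq_sum_ch: "Q \<in> \<I> \<Longrightarrow> vol Q = (\<Sum>R\<in>ch Q. vol R)"
  using measure_disjoint_Union[of "ch Q"] finite_ch[of Q] ch_disjoint[of Q] lmeasurable_tree[OF ch_tree[of Q]]
    Union_ch[of Q] by auto

text \<open>
  The mean of \<open>G\<close> over \<open>Q\<close> is the mean of its means over the children, so the cross terms collapse.
\<close>

lemma sum_norm_differences:
  fixes G :: "real ^ 'n \<Rightarrow> 'b :: euclidean_space"
  assumes Q: "Q \<in> \<I>" and G: "set_integrable lebesgue Q G"
  defines "g \<equiv> \<lambda>R. LINT x:R|lebesgue. G x"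
  shows "(\<Sum>R\<in>ch Q. vol R * (norm (g R /\<^sub>R vol R - g Q /\<^sub>R vol Q))\<^sup>2) =
    (\<Sum>R\<in>ch Q. (norm (g R))\<^sup>2 / vol R) - (norm (g Q))\<^sup>2 / vol Q"
proof -
  define q where "q = g Q /\<^sub>R vol Q"
  have vQ: "vol Q > 0" using vol_pos internal_tree Q by auto
  have "vol R * (norm (g R /\<^sub>R vol R - q))\<^sup>2 =
      (norm (g R))\<^sup>2 / vol R - 2 * (g R \<bullet> q) + vol R * (norm q)\<^sup>2" if "R \<in> ch Q" for R
  proof -
    have "vol R > 0" using vol_pos ch_tree Q that by auto
    then show ?thesis unfolding power2_norm_eq_inner
      by (simp add: inner_simps inner_commute field_simps)
  qed
  then have "(\<Sum>R\<in>ch Q. vol R * (norm (g R /\<^sub>R vol R - q))\<^sup>2) =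
    (\<Sum>R\<in>ch Q. (norm (g R))\<^sup>2 / vol R) - 2 * ((\<Sum>R\<in>ch Q. g R) \<bullet> q) + (\<Sum>R\<in>ch Q. vol R) * (norm q)\<^sup>2"
    by (simp add: sum.distrib sum_subtractf sum_distrib_left sum_distrib_right inner_sum_left)
  also have "(\<Sum>R\<in>ch Q. g R) = g Q" unfolding g_def using set_integral_ch[OF Q G] by simp
  also have "(\<Sum>R\<in>ch Q. vol R) = vol Q" using vol_eq_sum_ch[OF Q] by simp
  also have "g Q \<bullet> q = vol Q * (norm q)\<^sup>2" using vQ by (simp add: q_def power_mult_distrib power2_eq_square flip: power2_norm_eq_inner)
  also have "vol Q * (norm q)\<^sup>2 = (norm (g Q))\<^sup>2 / vol Q"
    using vQ by (simp add: q_def power_mult_distrib power2_eq_square field_simps)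
  finally show ?thesis by (simp add: q_def)
qed

lemma bessel:
  fixes G :: "real ^ 'n \<Rightarrow> 'b :: euclidean_space"
  assumes R: "\<R> \<subseteq> \<I>" and C: "finite \<C>" and ch: "\<And>Q. Q \<in> \<R> \<Longrightarrow> ch Q \<subseteq> \<R> \<union> \<C>"
    and G: "\<And>Q. Q \<in> \<R> \<Longrightarrow> set_integrable lebesgue Q G"
  defines "g \<equiv> \<lambda>R. LINT x:R|lebesgue. G x"
  shows "(\<Sum>Q\<in>\<R>. \<Sum>R\<in>ch Q. vol R * (norm (g R /\<^sub>R vol R - g Q /\<^sub>R vol Q))\<^sup>2) \<le>
    (\<Sum>Z\<in>\<C>. (norm (g Z))\<^sup>2 / vol Z)"
proof -
  have "(\<Sum>Q\<in>\<R>. \<Sum>R\<in>ch Q. vol R * (norm (g R /\<^sub>R vol R - g Q /\<^sub>R vol Q))\<^sup>2) =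
    (\<Sum>Q\<in>\<R>. (\<Sum>R\<in>ch Q. (norm (g R))\<^sup>2 / vol R) - (norm (g Q))\<^sup>2 / vol Q)"
    using R unfolding g_def by (intro sum.cong refl sum_norm_differences G) auto
  also have "\<dots> \<le> (\<Sum>Z\<in>\<C>. (norm (g Z))\<^sup>2 / vol Z)"
    by (rule telescoping_le[OF R C ch]) auto
  finally show ?thesis .
qed

subsection \<open>The region between a cube and its stopping cubes\<close>

text \<open>
  For stopping cubes \<open>\<B>\<close> below \<open>P\<close>, the region consists of the cubes that are treated at \<open>P\<close>, and the
  cells are the pieces over which functions are averaged: the maximal stopping cubes, and the leaves
  outside of them.
\<close>

definition region :: "(real ^ 'n) set \<Rightarrow> (real ^ 'n) set set \<Rightarrow> (real ^ 'n) set set" where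
  "region P \<B> = {Q \<in> \<I>. Q \<subseteq> P \<and> (\<forall>R\<in>\<B>. \<not> Q \<subseteq> R)}"

definition cells :: "(real ^ 'n) set \<Rightarrow> (real ^ 'n) set set \<Rightarrow> (real ^ 'n) set set" where
  "cells P \<B> = maximal_sets {R \<in> \<F>. R \<subseteq> P \<and> (R \<in> \<B> \<or> R \<notin> \<I>)}"

lemma region_internal: "region P \<B> \<subseteq> \<I>" by (auto simp: region_def)

lemma cells_subset: "cells P \<B> \<subseteq> \<F>"
  using maximal_sets_subset by (fastforce simp: cells_def)

lemma finite_cells: "finite (cells P \<B>)"
  using cells_subset finite_tree finite_subset by metis

lemma cells_below: "Z \<in> cells P \<B> \<Longrightarrow> Z \<subseteq> P"
  by (simp add: cells_def maximal_sets_def)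

lemma cells_disjoint: "Z \<in> cells P \<B> \<Longrightarrow> Z' \<in> cells P \<B> \<Longrightarrow> Z \<noteq> Z' \<Longrightarrow> Z \<inter> Z' = {}"
  unfolding cells_def
  by (rule maximal_sets_disjoint) (auto intro: laminar_subset[OF laminar_tree])

lemma sum_vol_cells_le: "P \<in> \<F> \<Longrightarrow> (\<Sum>Z\<in>cells P \<B>. vol Z) \<le> vol P"
proof -
  assume P: "P \<in> \<F>"
  have "(\<Sum>Z\<in>cells P \<B>. vol Z) = vol (\<Union>(cells P \<B>))"
    by (rule measure_disjoint_Union[symmetric, OF finite_cells cells_disjoint])
      (auto intro: lmeasurable_tree subsetD[OF cells_subset])
  also have "\<dots> \<le> vol P"
    using cells_below lmeasurable_tree[OF P] finite_cells[of P \<B>] cells_subset[of P \<B>] tree_sets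
    by (intro measure_mono_fmeasurable sets.finite_Union) auto
  finally show ?thesis .
qed

lemma ch_region_under_stopping:
  assumes Q: "Q \<in> region P \<B>" and S: "S \<in> ch Q" and B: "R \<in> \<B>" "R \<in> \<F>" "S \<subseteq> R"
  shows "S = R"
proof -
  have QI: "Q \<in> \<I>" and nQ: "\<not> Q \<subseteq> R" using Q B by (auto simp: region_def)
  have "R \<subset> Q"
    using comparable[OF internal_tree[OF QI] B(2) ch_tree[OF QI S]] ch_psubset[OF QI S] B nQ by auto
  then show ?thesis using between_ch[OF QI S B(2,3)] by auto
qed

lemma ch_region:
  assumes Q: "Q \<in> region P \<B>" and S: "S \<in> ch Q" and B: "\<B> \<subseteq> \<F>"
  shows "S \<in> region P \<B> \<union> cells P \<B>"
proof (cases "S \<in> region P \<B>")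
  case False
  have QI: "Q \<in> \<I>" "Q \<subseteq> P" using Q by (auto simp: region_def)
  have SP: "S \<subseteq> P" "S \<in> \<F>" using ch_psubset[OF QI(1) S] ch_tree[OF QI(1) S] QI by auto
  have "S \<in> \<B> \<or> S \<notin> \<I>"
  proof (rule ccontr)
    assume *: "\<not> (S \<in> \<B> \<or> S \<notin> \<I>)"
    then obtain R where "R \<in> \<B>" "S \<subseteq> R" using False SP by (auto simp: region_def)
    then show False using ch_region_under_stopping[OF Q S] B * by auto
  qed
  moreover have "S = U" if "U \<in> \<F>" "U \<in> \<B> \<or> U \<notin> \<I>" "S \<subseteq> U" for U
    using that ch_region_under_stopping[OF Q S _ that(1,3)] leaf[OF that(1) _ SP(2)] by auto
  ultimately have "S \<in> cells P \<B>" using SP by (auto simp: cells_def maximal_sets_def)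
  then show ?thesis by auto
qed auto

text \<open>
  Consequently averaging a function over the cells does not change its integrals over the children of
  the cubes in the region, the only integrals that the operators of the region use.
\<close>

lemma ch_region_cover:
  assumes Q: "Q \<in> region P \<B>" and S: "S \<in> ch Q" and B: "\<B> \<subseteq> \<F>"
  shows "S = \<Union>{Z \<in> cells P \<B>. Z \<subseteq> S}"
proof (intro equalityI subsetI)
  fix x assume x: "x \<in> S"
  have QI: "Q \<in> \<I>" "Q \<subseteq> P" using Q by (auto simp: region_def)
  have S': "S \<in> \<F>" "S \<subset> Q" using ch_tree[OF QI(1) S] ch_psubset[OF QI(1) S] by auto
  obtain L where L: "L \<in> \<F>" "L \<notin> \<I>" "x \<in> L" "L \<subseteq> S" using leaf_containing[OF S'(1) x] .
  define \<U> where "\<U> = {R \<in> \<F>. R \<subseteq> P \<and> (R \<in> \<B> \<or> R \<notin> \<I>)}"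
  have "finite \<U>" "L \<in> \<U>" using finite_tree L S' QI by (auto simp: \<U>_def)
  then obtain Z where Z: "Z \<in> maximal_sets \<U>" "L \<subseteq> Z" using maximal_sets_above by metis
  then have ZU: "Z \<in> \<F>" "Z \<in> \<B> \<or> Z \<notin> \<I>" by (auto simp: maximal_sets_def \<U>_def)
  have "Z \<subseteq> S"
  proof (rule ccontr)
    assume "\<not> Z \<subseteq> S"
    then have SZ: "S \<subset> Z" using comparable[OF ZU(1) S'(1) L(1) Z(2) L(4)] by auto
    show False
      using ZU(2) ch_region_under_stopping[OF Q S _ ZU(1)] leaf[OF ZU(1) _ S'(1)] SZ by auto
  qed
  then show "x \<in> \<Union>{Z \<in> cells P \<B>. Z \<subseteq> S}" using Z L by (auto simp: cells_def \<U>_def)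
qed auto

end

lemma
  fixes c :: "(real ^ 'n) set \<Rightarrow> 'b::euclidean_space"
  assumes fin: "finite \<C>" and dis: "\<And>Z Z'. Z \<in> \<C> \<Longrightarrow> Z' \<in> \<C> \<Longrightarrow> Z \<noteq> Z' \<Longrightarrow> Z \<inter> Z' = {}"
    and meas: "\<And>Z. Z \<in> \<C> \<Longrightarrow> Z \<in> lmeasurable"
  defines "h \<equiv> \<lambda>x. \<Sum>Z\<in>\<C>. indicat_real Z x *\<^sub>R c Z"
  shows in_L2_step: "in_L2 h"
    and L2_step: "(LINT x|lebesgue. (norm (h x))\<^sup>2) = (\<Sum>Z\<in>\<C>. vol Z * (norm (c Z))\<^sup>2)"
    and set_integral_step: "S \<in> sets lebesgue \<Longrightarrow> (LINT x:S|lebesgue. h x) = (\<Sum>Z\<in>\<C>. vol (Z \<inter> S) *\<^sub>R c Z)"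
proof -
  have sq: "(norm (h x))\<^sup>2 = (\<Sum>Z\<in>\<C>. (norm (c Z))\<^sup>2 * indicat_real Z x)" for x
  proof (cases "\<exists>Z\<in>\<C>. x \<in> Z")
    case True
    then obtain Z where Z: "Z \<in> \<C>" "x \<in> Z" by auto
    have "indicat_real Z' x = (if Z' = Z then 1 else 0)" if "Z' \<in> \<C>" for Z'
      using dis[OF Z(1) that] Z that by (auto simp: indicator_def)
    then have "h x = (\<Sum>Z'\<in>\<C>. if Z' = Z then c Z else 0)"
      "(\<Sum>Z\<in>\<C>. (norm (c Z))\<^sup>2 * indicat_real Z x) = (\<Sum>Z'\<in>\<C>. if Z' = Z then (norm (c Z))\<^sup>2 else 0)"
      unfolding h_def by (auto intro!: sum.cong)
    then show ?thesis using Z fin by simp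
  next
    case False then show ?thesis by (simp add: h_def)
  qed
  have sets: "Z \<in> sets lebesgue" if "Z \<in> \<C>" for Z using meas[OF that] by (simp add: fmeasurableD)
  have int: "integrable lebesgue (indicat_real Z)" if "Z \<in> \<C>" for Z
    using meas[OF that] by (auto simp: fmeasurable_def infinity_ennreal_def intro!: integrable_real_indicator)
  have "integrable lebesgue (\<lambda>x. (norm (h x))\<^sup>2)"
    unfolding sq by (intro Bochner_Integration.integrable_sum integrable_mult_right int)
  moreover have "h \<in> borel_measurable lebesgue"
    unfolding h_def by (intro borel_measurable_sum borel_measurable_scaleR borel_measurable_indicator sets
        borel_measurable_const)
  ultimately show "in_L2 h" by (simp add: in_L2_def)
  show "(LINT x|lebesgue. (norm (h x))\<^sup>2) = (\<Sum>Z\<in>\<C>. vol Z * (norm (c Z))\<^sup>2)"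
    unfolding sq using int by (subst Bochner_Integration.integral_sum) (auto simp: mult.commute)
  assume S: "S \<in> sets lebesgue"
  have "(LINT x:S|lebesgue. h x) = (LINT x|lebesgue. (\<Sum>Z\<in>\<C>. indicat_real (Z \<inter> S) x *\<^sub>R c Z))"
    unfolding set_lebesgue_integral_def h_def
    by (intro Bochner_Integration.integral_cong) (auto simp: scaleR_sum_right indicator_def intro!: sum.cong)
  also have "\<dots> = (\<Sum>Z\<in>\<C>. vol (Z \<inter> S) *\<^sub>R c Z)"
  proof -
    have "integrable lebesgue (indicat_real (Z \<inter> S))" if "Z \<in> \<C>" for Z
      using fmeasurable_Int_fmeasurable[OF meas[OF that] S] by (auto simp: fmeasurable_def infinity_ennreal_def intro!: integrable_real_indicator)
    then show ?thesis
      by (subst Bochner_Integration.integral_sum) (auto intro!: sum.cong)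
  qed
  finally show "(LINT x:S|lebesgue. h x) = (\<Sum>Z\<in>\<C>. vol (Z \<inter> S) *\<^sub>R c Z)" .
qed

text \<open>
  If \<open>T\<close> has a kernel that equals \<open>c R S\<close> on \<open>R \<times> S\<close> for \<open>R, S\<close> in \<open>\<C>\<close> and vanishes elsewhere, this is the
  integral of \<open>A (T F) \<bullet> G\<close>.
\<close>

definition block_form ::
  "'k::real_or_complex ^ 'd ^ 'd \<Rightarrow> (real ^ 'n) set set \<Rightarrow>
    ((real ^ 'n) set \<Rightarrow> (real ^ 'n) set \<Rightarrow> 'k) \<Rightarrow> (real ^ 'n \<Rightarrow> 'k ^ 'd) \<Rightarrow> (real ^ 'n \<Rightarrow> 'k ^ 'd) \<Rightarrow> real" where
  "block_form A \<C> c F G = (\<Sum>R\<in>\<C>.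
     (A *v (\<Sum>S\<in>\<C>. c R S *s (LINT x:S|lebesgue. F x))) \<bullet> (LINT x:R|lebesgue. G x))"

lemma norm_vec_sq: "(norm (v :: 'k::real_normed_vector ^ 'd))\<^sup>2 = (\<Sum>i\<in>UNIV. (norm (v $ i))\<^sup>2)"
  by (simp add: norm_vec_def L2_set_def sum_nonneg)

context cube_tree
begin

text \<open>
  The parent of a cell lies in no stopping cube, by maximality of the cell, so \<open>\<alpha>\<close> controls the average
  over the parent; passing to the cell costs the factor \<open>M\<close>.
\<close>

lemma average_on_cell_le:
  fixes F :: "real ^ 'n \<Rightarrow> 'b :: euclidean_space"
  assumes P: "P \<in> \<F>" and Bs: "\<And>R. R \<in> \<B> \<Longrightarrow> R \<in> \<F> \<and> R \<subset> P" and F: "set_integrable lebesgue P F"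
    and avg: "\<And>Q. Q \<in> \<F> \<Longrightarrow> Q \<subseteq> P \<Longrightarrow> \<forall>R\<in>\<B>. \<not> Q \<subseteq> R \<Longrightarrow> (LINT x:Q|lebesgue. norm (F x)) \<le> \<alpha> * vol Q"
    and \<alpha>: "0 \<le> \<alpha>" and Z: "Z \<in> cells P \<B>"
  shows "norm (LINT x:Z|lebesgue. F x) \<le> M * \<alpha> * vol Z"
proof -
  have ZF: "Z \<in> \<F>" "Z \<subseteq> P" using Z cells_subset cells_below by auto
  have nF: "set_integrable lebesgue P (\<lambda>x. norm (F x))"
    using F unfolding set_integrable_def
    by (rule Bochner_Integration.integrable_bound[OF integrable_norm])
      (use F in \<open>auto simp: set_integrable_def intro!: borel_measurable_integrable dest: integrable_norm\<close>)
  have "(LINT x:Z|lebesgue. norm (F x)) \<le> M * \<alpha> * vol Z"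
  proof (cases "Z = P")
    case True
    have "(LINT x:P|lebesgue. norm (F x)) \<le> \<alpha> * vol P" using avg[of P] P Bs by auto
    also have "\<dots> \<le> M * (\<alpha> * vol P)" using mult_right_mono[OF M_ge_1, of "\<alpha> * vol P"] \<alpha> vol_pos[OF P] by simp
    finally show ?thesis using True by (simp add: mult.assoc)
  next
    case False
    then have "Z \<subset> P" using ZF by auto
    then obtain Q where Q: "Q \<in> \<I>" "Q \<subseteq> P" "Z \<in> ch Q" using parent_exists[OF ZF(1) P] by metis
    have QF: "Q \<in> \<F>" "Z \<subset> Q" using internal_tree Q(1) ch_psubset Q by auto
    have "\<not> Q \<subseteq> R" if "R \<in> \<B>" for R
    proof
      assume "Q \<subseteq> R"
      then have R: "Z \<subset> R" "R \<subseteq> P" "R \<in> \<F>" using QF Bs[OF that] by auto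
      have "Z \<subseteq> R \<Longrightarrow> Z = R"
        using Z R(2,3) that by (simp add: cells_def maximal_sets_def)
      then show False using R(1) by blast
    qed
    then have "(LINT x:Q|lebesgue. norm (F x)) \<le> \<alpha> * vol Q" using avg QF Q by auto
    moreover have "(LINT x:Z|lebesgue. norm (F x)) \<le> (LINT x:Q|lebesgue. norm (F x))"
      using QF Q ZF tree_sets by (intro set_integral_mono_set set_integrable_subset[OF nF]) auto
    moreover have "\<alpha> * vol Q \<le> \<alpha> * (M * vol Z)" using vol_ch[OF Q(1,3)] \<alpha> by (rule mult_left_mono)
    ultimately show ?thesis by (simp add: mult_ac)
  qed
  then show ?thesis by (rule order_trans[OF norm_set_integral_le])
qed

lemma sum_cells_le:
  fixes F :: "real ^ 'n \<Rightarrow> 'b :: euclidean_space"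
  assumes P: "P \<in> \<F>" and Bs: "\<And>R. R \<in> \<B> \<Longrightarrow> R \<in> \<F> \<and> R \<subset> P" and F: "set_integrable lebesgue P F"
    and avg: "\<And>Q. Q \<in> \<F> \<Longrightarrow> Q \<subseteq> P \<Longrightarrow> \<forall>R\<in>\<B>. \<not> Q \<subseteq> R \<Longrightarrow> (LINT x:Q|lebesgue. norm (F x)) \<le> \<alpha> * vol Q"
    and \<alpha>: "0 \<le> \<alpha>"
  shows "(\<Sum>Z\<in>cells P \<B>. (norm (LINT x:Z|lebesgue. F x))\<^sup>2 / vol Z) \<le> (M * \<alpha>)\<^sup>2 * vol P"
proof -
  have "(norm (LINT x:Z|lebesgue. F x))\<^sup>2 / vol Z \<le> (M * \<alpha>)\<^sup>2 * vol Z" if Z: "Z \<in> cells P \<B>" for Z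
  proof -
    have v: "0 < vol Z" using vol_pos cells_subset Z by auto
    have "(norm (LINT x:Z|lebesgue. F x))\<^sup>2 \<le> (M * \<alpha> * vol Z)\<^sup>2"
      by (intro power_mono average_on_cell_le[OF P Bs F avg \<alpha> Z]) auto
    then show ?thesis using v by (simp add: divide_le_eq power2_eq_square mult_ac)
  qed
  then have "(\<Sum>Z\<in>cells P \<B>. (norm (LINT x:Z|lebesgue. F x))\<^sup>2 / vol Z) \<le>
      (\<Sum>Z\<in>cells P \<B>. (M * \<alpha>)\<^sup>2 * vol Z)" by (rule sum_mono)
  also have "\<dots> \<le> (M * \<alpha>)\<^sup>2 * vol P"
    unfolding sum_distrib_left[symmetric] by (intro mult_left_mono sum_vol_cells_le[OF P]) auto
  finally show ?thesis .
qed

text \<open>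
  The hypothesis on the blocks is applied to each component of the function that is constant on the
  cells with the same averages as \<open>F\<close>.
\<close>

lemma sum_blocks_region_le:
  fixes c :: "(real ^ 'n) set \<Rightarrow> (real ^ 'n) set \<Rightarrow> (real ^ 'n) set \<Rightarrow> 'k::real_or_complex"
    and F :: "real ^ 'n \<Rightarrow> 'k ^ 'd"
  assumes bnd: "\<And>h. in_L2 h \<Longrightarrow>
      (\<Sum>Q\<in>\<I>. \<Sum>R\<in>ch Q. vol R * (norm (\<Sum>S\<in>ch Q. c Q R S * (LINT x:S|lebesgue. h x)))\<^sup>2)
        \<le> B\<^sup>2 * (LINT x|lebesgue. (norm (h x))\<^sup>2)"
    and Bs: "\<B> \<subseteq> \<F>" and F: "set_integrable lebesgue P F"
  shows "(\<Sum>Q\<in>region P \<B>. \<Sum>R\<in>ch Q. vol R * (norm (\<Sum>S\<in>ch Q. c Q R S *s (LINT x:S|lebesgue. F x)))\<^sup>2)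
    \<le> B\<^sup>2 * (\<Sum>Z\<in>cells P \<B>. (norm (LINT x:Z|lebesgue. F x))\<^sup>2 / vol Z)"
proof -
  define f where "f Z = (LINT x:Z|lebesgue. F x)" for Z
  define h where "h i x = (\<Sum>Z\<in>cells P \<B>. indicat_real Z x *\<^sub>R (f Z $ i /\<^sub>R vol Z))" for i x
  note cell = finite_cells[of P \<B>] cells_disjoint[of _ P \<B>] lmeasurable_tree[OF subsetD[OF cells_subset[of P \<B>]]]
  have hS: "(LINT x:S|lebesgue. h i x) = f S $ i" if Q: "Q \<in> region P \<B>" and S: "S \<in> ch Q" for Q S i
  proof -
    have QI: "Q \<in> \<I>" "Q \<subseteq> P" using Q by (auto simp: region_def)
    have SF: "S \<in> \<F>" "S \<subseteq> P" using ch_tree[OF QI(1) S] ch_psubset[OF QI(1) S] QI by auto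
    define \<C> where "\<C> = {Z \<in> cells P \<B>. Z \<subseteq> S}"
    have SU: "S = \<Union>\<C>" unfolding \<C>_def by (rule ch_region_cover[OF Q S Bs])
    have out: "Z \<inter> S = {}" if "Z \<in> cells P \<B>" "Z \<notin> \<C>" for Z
    proof -
      have "Z \<inter> Z' = {}" if "Z' \<in> \<C>" for Z'
        using cells_disjoint[of Z P \<B> Z'] \<open>Z \<in> cells P \<B>\<close> \<open>Z \<notin> \<C>\<close> that
        by (cases "Z = Z'") (auto simp: \<C>_def)
      then have "Z \<inter> \<Union>\<C> = {}" by auto
      then show ?thesis using SU by simp
    qed
    have "(LINT x:S|lebesgue. h i x) = (\<Sum>Z\<in>cells P \<B>. vol (Z \<inter> S) *\<^sub>R (f Z $ i /\<^sub>R vol Z))"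
      unfolding h_def by (intro set_integral_step cell tree_sets SF)
    also have "\<dots> = (\<Sum>Z\<in>\<C>. f Z $ i)"
    proof (rule sum.mono_neutral_cong_right[OF finite_cells])
      show "\<forall>Z\<in>cells P \<B> - \<C>. vol (Z \<inter> S) *\<^sub>R (f Z $ i /\<^sub>R vol Z) = 0" using out by auto
      fix Z assume "Z \<in> \<C>"
      then have "Z \<inter> S = Z" "vol Z > 0" using vol_pos cells_subset by (auto simp: \<C>_def)
      then show "vol (Z \<inter> S) *\<^sub>R (f Z $ i /\<^sub>R vol Z) = f Z $ i" by simp
    qed (auto simp: \<C>_def)
    also have "\<dots> = (\<Sum>Z\<in>\<C>. f Z) $ i" by simp
    also have "(\<Sum>Z\<in>\<C>. f Z) = f (\<Union>\<C>)"
      unfolding f_def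
    proof (rule set_integral_disjoint_Union[symmetric, OF _ _ _ F])
      show "finite \<C>" using finite_cells by (simp add: \<C>_def)
      show "Z \<inter> Z' = {}" if "Z \<in> \<C>" "Z' \<in> \<C>" "Z \<noteq> Z'" for Z Z'
        using that cells_disjoint[of Z P \<B> Z'] by (simp add: \<C>_def)
      show "Z \<in> sets lebesgue" if "Z \<in> \<C>" for Z
        using that tree_sets[OF subsetD[OF cells_subset[of P \<B>]]] by (simp add: \<C>_def)
      show "\<Union>\<C> \<subseteq> P" using SU SF by simp
    qed
    also have "\<Union>\<C> = S" using SU by simp
    finally show ?thesis .
  qed
  have "(\<Sum>Q\<in>region P \<B>. \<Sum>R\<in>ch Q. vol R * (norm (\<Sum>S\<in>ch Q. c Q R S *s f S))\<^sup>2) =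
    (\<Sum>Q\<in>region P \<B>. \<Sum>R\<in>ch Q. \<Sum>i\<in>UNIV. vol R * (norm (\<Sum>S\<in>ch Q. c Q R S * (LINT x:S|lebesgue. h i x)))\<^sup>2)"
    unfolding norm_vec_sq sum_distrib_left by (intro sum.cong refl) (simp add: hS)
  also have "\<dots> = (\<Sum>Q\<in>region P \<B>. \<Sum>i\<in>UNIV. \<Sum>R\<in>ch Q. vol R * (norm (\<Sum>S\<in>ch Q. c Q R S * (LINT x:S|lebesgue. h i x)))\<^sup>2)"
    by (intro sum.cong refl sum.swap)
  also have "\<dots> = (\<Sum>i\<in>UNIV. \<Sum>Q\<in>region P \<B>. \<Sum>R\<in>ch Q. vol R * (norm (\<Sum>S\<in>ch Q. c Q R S * (LINT x:S|lebesgue. h i x)))\<^sup>2)"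
    by (rule sum.swap)
  also have "\<dots> \<le> (\<Sum>i\<in>UNIV. B\<^sup>2 * (LINT x|lebesgue. (norm (h i x))\<^sup>2))"
  proof (rule sum_mono)
    fix i
    have "(\<Sum>Q\<in>region P \<B>. \<Sum>R\<in>ch Q. vol R * (norm (\<Sum>S\<in>ch Q. c Q R S * (LINT x:S|lebesgue. h i x)))\<^sup>2)
      \<le> (\<Sum>Q\<in>\<I>. \<Sum>R\<in>ch Q. vol R * (norm (\<Sum>S\<in>ch Q. c Q R S * (LINT x:S|lebesgue. h i x)))\<^sup>2)"
      by (intro sum_mono2 finite_internal region_internal sum_nonneg) auto
    also have "\<dots> \<le> B\<^sup>2 * (LINT x|lebesgue. (norm (h i x))\<^sup>2)"
      unfolding h_def by (intro bnd in_L2_step cell)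
    finally show "(\<Sum>Q\<in>region P \<B>. \<Sum>R\<in>ch Q. vol R * (norm (\<Sum>S\<in>ch Q. c Q R S * (LINT x:S|lebesgue. h i x)))\<^sup>2)
      \<le> B\<^sup>2 * (LINT x|lebesgue. (norm (h i x))\<^sup>2)" .
  qed
  also have "\<dots> = B\<^sup>2 * (\<Sum>i\<in>UNIV. \<Sum>Z\<in>cells P \<B>. vol Z * (norm (f Z $ i /\<^sub>R vol Z))\<^sup>2)"
    unfolding sum_distrib_left[symmetric] h_def
    by (intro arg_cong[where f="\<lambda>t. B\<^sup>2 * t"] sum.cong refl L2_step cell)
  also have "\<dots> = B\<^sup>2 * (\<Sum>Z\<in>cells P \<B>. (norm (f Z))\<^sup>2 / vol Z)"
  proof -
    have "(\<Sum>i\<in>UNIV. vol Z * (norm (f Z $ i /\<^sub>R vol Z))\<^sup>2) = (norm (f Z))\<^sup>2 / vol Z" if "Z \<in> cells P \<B>" for Z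
    proof -
      have "vol Z > 0" using vol_pos cells_subset that by auto
      then show ?thesis
        by (simp add: norm_vec_sq power_mult_distrib divide_inverse sum_distrib_left[symmetric] sum_distrib_right[symmetric])
          (simp add: power2_eq_square)
    qed
    then show ?thesis by (subst sum.swap) simp
  qed
  finally show ?thesis by (simp add: f_def)
qed

text \<open>
  As the outputs have mean zero, \<open>G\<close> may be replaced by its martingale difference on each cube. Then
  Cauchy--Schwarz splits the sum into the square function of the operators applied to \<open>F\<close> and the one of
  the martingale differences of \<open>G\<close>; both are bounded by averages over the cells.
\<close>

lemma region_estimate:
  fixes c :: "(real ^ 'n) set \<Rightarrow> (real ^ 'n) set \<Rightarrow> (real ^ 'n) set \<Rightarrow> 'k::real_or_complex"
    and F G :: "real ^ 'n \<Rightarrow> 'k ^ 'd"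
  assumes mean0: "\<And>Q S. Q \<in> \<I> \<Longrightarrow> S \<in> ch Q \<Longrightarrow> (\<Sum>R\<in>ch Q. vol R *\<^sub>R c Q R S) = 0"
    and bnd: "\<And>h. in_L2 h \<Longrightarrow>
      (\<Sum>Q\<in>\<I>. \<Sum>R\<in>ch Q. vol R * (norm (\<Sum>S\<in>ch Q. c Q R S * (LINT x:S|lebesgue. h x)))\<^sup>2)
        \<le> B\<^sup>2 * (LINT x|lebesgue. (norm (h x))\<^sup>2)"
    and B: "0 \<le> B" and A: "\<And>v. norm (A *v v) \<le> \<kappa> * norm v" and \<kappa>: "0 \<le> \<kappa>"
    and P: "P \<in> \<F>" and Bs: "\<And>R. R \<in> \<B> \<Longrightarrow> R \<in> \<F> \<and> R \<subset> P"
    and F: "set_integrable lebesgue P F" and G: "set_integrable lebesgue P G"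
    and avgF: "\<And>Q. Q \<in> \<F> \<Longrightarrow> Q \<subseteq> P \<Longrightarrow> \<forall>R\<in>\<B>. \<not> Q \<subseteq> R \<Longrightarrow> (LINT x:Q|lebesgue. norm (F x)) \<le> \<alpha> * vol Q"
    and avgG: "\<And>Q. Q \<in> \<F> \<Longrightarrow> Q \<subseteq> P \<Longrightarrow> \<forall>R\<in>\<B>. \<not> Q \<subseteq> R \<Longrightarrow> (LINT x:Q|lebesgue. norm (G x)) \<le> \<beta> * vol Q"
    and \<alpha>: "0 \<le> \<alpha>" and \<beta>: "0 \<le> \<beta>"
  shows "(\<Sum>Q\<in>region P \<B>. \<bar>block_form A (ch Q) (c Q) F G\<bar>) \<le> \<kappa> * B * M\<^sup>2 * \<alpha> * \<beta> * vol P"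
proof -
  define f g where "f Z = (LINT x:Z|lebesgue. F x)" and "g Z = (LINT x:Z|lebesgue. G x)" for Z
  define y where "y Q R = (\<Sum>S\<in>ch Q. c Q R S *s f S)" for Q R
  define d where "d Q R = g R /\<^sub>R vol R - g Q /\<^sub>R vol Q" for Q R
  define I where "I = (SIGMA Q:region P \<B>. ch Q)"
  have BF: "\<B> \<subseteq> \<F>" using Bs by auto
  have RI: "Q \<in> \<I>" "Q \<subseteq> P" "Q \<in> \<F>" if "Q \<in> region P \<B>" for Q
    using that internal_tree by (auto simp: region_def)
  have finR: "finite (region P \<B>)" using region_internal finite_internal finite_subset by metis
  have finch: "\<forall>Q\<in>region P \<B>. finite (ch Q)" using RI finite_ch by auto
  have form: "block_form A (ch Q) (c Q) F G = (\<Sum>R\<in>ch Q. vol R * ((A *v y Q R) \<bullet> d Q R))"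
    if Q: "Q \<in> region P \<B>" for Q
  proof -
    have v: "vol R > 0" if "R \<in> ch Q" for R using vol_pos ch_tree RI Q that by auto
    have "(\<Sum>R\<in>ch Q. vol R *\<^sub>R y Q R) = (\<Sum>S\<in>ch Q. \<Sum>R\<in>ch Q. vol R *\<^sub>R (c Q R S *s f S))"
      unfolding y_def scaleR_sum_right by (rule sum.swap)
    also have "\<dots> = (\<Sum>S\<in>ch Q. (\<Sum>R\<in>ch Q. vol R *\<^sub>R c Q R S) *s f S)"
      by (intro sum.cong refl) (simp add: vec_eq_iff sum_distrib_right)
    also have "\<dots> = 0" using mean0 RI Q by simp
    finally have "(\<Sum>R\<in>ch Q. vol R *\<^sub>R y Q R) = 0" .
    then have "(\<Sum>R\<in>ch Q. vol R * ((A *v y Q R) \<bullet> (g Q /\<^sub>R vol Q))) = 0"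
    proof -
      have "(\<Sum>R\<in>ch Q. vol R * ((A *v y Q R) \<bullet> (g Q /\<^sub>R vol Q))) =
        (A *v (\<Sum>R\<in>ch Q. vol R *\<^sub>R y Q R)) \<bullet> (g Q /\<^sub>R vol Q)"
        using bounded_linear_matrix_vector_mult[of A]
        by (simp only: inner_sum_left linear_sum[OF bounded_linear.linear] linear_scale[OF bounded_linear.linear]
            inner_scaleR_left)
      then show ?thesis using \<open>(\<Sum>R\<in>ch Q. vol R *\<^sub>R y Q R) = 0\<close> by simp
    qed
    then have "(\<Sum>R\<in>ch Q. vol R * ((A *v y Q R) \<bullet> d Q R)) = (\<Sum>R\<in>ch Q. vol R * ((A *v y Q R) \<bullet> (g R /\<^sub>R vol R)))"
      by (simp add: d_def inner_diff_right right_diff_distrib sum_subtractf)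
    also have "\<dots> = (\<Sum>R\<in>ch Q. (A *v y Q R) \<bullet> g R)"
      using v by (intro sum.cong refl) (auto simp: less_imp_neq[THEN not_sym])
    finally show ?thesis by (simp add: block_form_def y_def f_def g_def)
  qed
  have "(\<Sum>Q\<in>region P \<B>. \<bar>block_form A (ch Q) (c Q) F G\<bar>) \<le>
    (\<Sum>Q\<in>region P \<B>. \<Sum>R\<in>ch Q. \<bar>sqrt (vol R) * (\<kappa> * norm (y Q R))\<bar> * \<bar>sqrt (vol R) * norm (d Q R)\<bar>)"
  proof (rule sum_mono)
    fix Q assume Q: "Q \<in> region P \<B>"
    have "\<bar>vol R * ((A *v y Q R) \<bullet> d Q R)\<bar> \<le>
      \<bar>sqrt (vol R) * (\<kappa> * norm (y Q R))\<bar> * \<bar>sqrt (vol R) * norm (d Q R)\<bar>" for R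
    proof -
      have "\<bar>(A *v y Q R) \<bullet> d Q R\<bar> \<le> (\<kappa> * norm (y Q R)) * norm (d Q R)"
        by (rule order_trans[OF Cauchy_Schwarz_ineq2 mult_right_mono[OF A]]) simp
      then have "\<bar>vol R * ((A *v y Q R) \<bullet> d Q R)\<bar> \<le> vol R * ((\<kappa> * norm (y Q R)) * norm (d Q R))"
        by (simp add: abs_mult mult_left_mono)
      also have "\<dots> = \<bar>sqrt (vol R) * (\<kappa> * norm (y Q R))\<bar> * \<bar>sqrt (vol R) * norm (d Q R)\<bar>"
        using \<kappa> by (simp add: abs_mult mult_ac flip: real_sqrt_mult)
      finally show ?thesis .
    qed
    then show "\<bar>block_form A (ch Q) (c Q) F G\<bar> \<le>
      (\<Sum>R\<in>ch Q. \<bar>sqrt (vol R) * (\<kappa> * norm (y Q R))\<bar> * \<bar>sqrt (vol R) * norm (d Q R)\<bar>)"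
      unfolding form[OF Q] by (intro order_trans[OF sum_abs sum_mono])
  qed
  also have "\<dots> = (\<Sum>(Q, R)\<in>I. \<bar>sqrt (vol R) * (\<kappa> * norm (y Q R))\<bar> * \<bar>sqrt (vol R) * norm (d Q R)\<bar>)"
    unfolding I_def by (rule sum.Sigma[OF finR finch])
  also have "\<dots> \<le> L2_set (\<lambda>(Q, R). sqrt (vol R) * (\<kappa> * norm (y Q R))) I * L2_set (\<lambda>(Q, R). sqrt (vol R) * norm (d Q R)) I"
    using L2_set_mult_ineq[of "\<lambda>(Q, R). sqrt (vol R) * (\<kappa> * norm (y Q R))" "\<lambda>(Q, R). sqrt (vol R) * norm (d Q R)" I]
    by (simp add: case_prod_unfold)
  also have "\<dots> \<le> sqrt ((\<kappa> * B * (M * \<alpha>))\<^sup>2 * vol P) * sqrt ((M * \<beta>)\<^sup>2 * vol P)"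
  proof (intro mult_mono)
    have "(\<Sum>(Q, R)\<in>I. (sqrt (vol R) * (\<kappa> * norm (y Q R)))\<^sup>2) =
      \<kappa>\<^sup>2 * (\<Sum>Q\<in>region P \<B>. \<Sum>R\<in>ch Q. vol R * (norm (y Q R))\<^sup>2)"
      unfolding I_def sum.Sigma[OF finR finch, symmetric] sum_distrib_left
      by (intro sum.cong refl) (simp add: power_mult_distrib mult_ac)
    also have "\<dots> \<le> \<kappa>\<^sup>2 * (B\<^sup>2 * (\<Sum>Z\<in>cells P \<B>. (norm (f Z))\<^sup>2 / vol Z))"
      unfolding y_def f_def by (intro mult_left_mono sum_blocks_region_le[OF bnd BF F]) auto
    also have "\<dots> \<le> \<kappa>\<^sup>2 * (B\<^sup>2 * ((M * \<alpha>)\<^sup>2 * vol P))"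
      unfolding f_def by (intro mult_left_mono sum_cells_le[OF P Bs F avgF \<alpha>]) auto
    finally have "(\<Sum>(Q, R)\<in>I. (sqrt (vol R) * (\<kappa> * norm (y Q R)))\<^sup>2) \<le> (\<kappa> * B * (M * \<alpha>))\<^sup>2 * vol P"
      by (simp add: power_mult_distrib mult_ac)
    then show "L2_set (\<lambda>(Q, R). sqrt (vol R) * (\<kappa> * norm (y Q R))) I \<le> sqrt ((\<kappa> * B * (M * \<alpha>))\<^sup>2 * vol P)"
      unfolding L2_set_def by (intro real_sqrt_le_mono) (simp add: case_prod_unfold)
    have "(\<Sum>(Q, R)\<in>I. (sqrt (vol R) * norm (d Q R))\<^sup>2) =
      (\<Sum>Q\<in>region P \<B>. \<Sum>R\<in>ch Q. vol R * (norm (d Q R))\<^sup>2)"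
      unfolding I_def sum.Sigma[OF finR finch, symmetric]
      by (intro sum.cong refl) (simp add: power_mult_distrib mult_ac)
    also have "\<dots> \<le> (\<Sum>Z\<in>cells P \<B>. (norm (g Z))\<^sup>2 / vol Z)"
      unfolding d_def g_def
      by (intro bessel region_internal finite_cells subsetI ch_region[OF _ _ BF] set_integrable_subset[OF G])
        (use RI tree_sets in auto)
    also have "\<dots> \<le> (M * \<beta>)\<^sup>2 * vol P"
      unfolding g_def by (intro sum_cells_le[OF P Bs G avgG \<beta>])
    finally show "L2_set (\<lambda>(Q, R). sqrt (vol R) * norm (d Q R)) I \<le> sqrt ((M * \<beta>)\<^sup>2 * vol P)"
      unfolding L2_set_def by (intro real_sqrt_le_mono) (simp add: case_prod_unfold)
  qed (auto simp: L2_set_nonneg)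
  also have "\<dots> = \<kappa> * B * M\<^sup>2 * \<alpha> * \<beta> * vol P"
    using \<kappa> B \<alpha> \<beta> M_ge_1 by (simp add: real_sqrt_mult power2_eq_square mult_ac)
  finally show ?thesis .
qed

end

section \<open>A Carleson embedding for sparse families\<close>

text \<open>
  The Cauchy--Schwarz inequality in a form that allows \<open>I\<close> to be estimated piece by piece, with a
  different weight on every piece.
\<close>

lemma square_le_of_weighted_means:
  fixes I X Y :: real
  assumes "\<And>t. t > 0 \<Longrightarrow> 2 * I \<le> t * X + Y / t" and "0 \<le> I" "0 \<le> X" "0 \<le> Y"
  shows "I\<^sup>2 \<le> X * Y"
proof (cases "I = 0")
  case False
  then have I: "I > 0" using assms by simp
  have "X \<noteq> 0"
  proof
    assume "X = 0"
    then have "2 * I \<le> Y / ((Y + 1) / I)" using assms(1)[of "(Y + 1) / I"] I assms(4) by simp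
    also have "\<dots> = Y / (Y + 1) * I" by simp
    also have "\<dots> \<le> 1 * I" using I assms(4) by (intro mult_right_mono) auto
    finally show False using I by simp
  qed
  then have X: "X > 0" using assms by simp
  have "2 * I \<le> I + Y / (I / X)" using assms(1)[of "I / X"] I X by simp
  then show ?thesis using I X by (simp add: field_simps power2_eq_square)
qed (use assms in auto)

lemma four_mult_le: "4 * (p * q) \<le> (p + q :: real)\<^sup>2"
  using sum_squares_bound[of p q] by (simp add: power2_sum)

definition core :: "'a set set \<Rightarrow> 'a set \<Rightarrow> 'a set" where
  "core S R = R - \<Union>{R' \<in> S. R' \<subset> R}"

lemma core_subset: "core S R \<subseteq> R" by (auto simp: core_def)

lemma core_disjoint:
  assumes "laminar S" "R \<in> S" "R' \<in> S" "R \<noteq> R'"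
  shows "core S R \<inter> core S R' = {}"
  by (cases rule: laminar_cases[OF assms(1-3)]) (use assms(2-4) in \<open>auto simp: core_def psubset_eq\<close>)

lemma Union_core:
  assumes "finite S" "P \<in> S"
  shows "(\<Union>R\<in>{R \<in> S. R \<subseteq> P}. core S R) = P"
proof (intro equalityI subsetI)
  fix x assume x: "x \<in> P"
  define \<U> where "\<U> = {R \<in> S. x \<in> R \<and> R \<subseteq> P}"
  have "finite \<U>" "P \<in> \<U>" using assms x by (auto simp: \<U>_def)
  then obtain R where R: "R \<in> \<U>" and min: "\<And>U. U \<in> \<U> \<Longrightarrow> U \<subseteq> R \<Longrightarrow> R = U"
    using finite_has_minimal2[of \<U> P] by auto
  have "x \<notin> R'" if "R' \<in> S" "R' \<subset> R" for R'
    using min[of R'] R that by (auto simp: \<U>_def)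
  then have "x \<in> core S R" using R by (auto simp: core_def \<U>_def)
  then show "x \<in> (\<Union>R\<in>{R \<in> S. R \<subseteq> P}. core S R)" using R by (auto simp: \<U>_def)
qed (auto simp: core_def)

lemma sets_core: "finite S \<Longrightarrow> S \<subseteq> sets M \<Longrightarrow> R \<in> S \<Longrightarrow> core S R \<in> sets M"
  unfolding core_def by (intro sets.Diff sets.finite_Union) auto

lemma set_integral_core:
  fixes f :: "_ \<Rightarrow> _ :: {banach, second_countable_topology}"
  assumes "finite S" "laminar S" "S \<subseteq> sets M" "P \<in> S" "set_integrable M P f"
  shows "(LINT x:P|M. f x) = (\<Sum>R | R \<in> S \<and> R \<subseteq> P. LINT x:core S R|M. f x)"
proof -
  let ?S = "{R \<in> S. R \<subseteq> P}"
  have sets: "core S R \<in> sets M" if "R \<in> ?S" for R using sets_core[OF assms(1,3)] that by auto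
  have "disjoint_family_on (core S) ?S"
    using core_disjoint[OF assms(2)] by (auto simp: disjoint_family_on_def)
  moreover have "set_integrable M (core S R) f" if "R \<in> ?S" for R
    using core_subset[of S R] that by (intro set_integrable_subset[OF assms(5)] sets) auto
  ultimately have "(LINT x:(\<Union>R\<in>?S. core S R)|M. f x) = (\<Sum>R\<in>?S. LINT x:core S R|M. f x)"
    using assms(1) sets by (intro set_integral_finite_Union) auto
  then show ?thesis unfolding Union_core[OF assms(1,4)] .
qed

lemma set_integral_nonneg_pointwise:
  fixes f :: "_ \<Rightarrow> real"
  assumes "\<And>x. x \<in> A \<Longrightarrow> 0 \<le> f x"
  shows "0 \<le> (LINT x:A|M. f x)"
  unfolding set_lebesgue_integral_def
  by (rule Bochner_Integration.integral_nonneg) (auto simp: indicator_def assms)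

text \<open>
  Decompose \<open>P\<close> into the cores of the members \<open>R\<close> of \<open>S\<close> below it and apply Cauchy--Schwarz with the weight
  \<open>l ^ k\<close>, where \<open>k\<close> is the generation of \<open>R\<close> below \<open>P\<close>. The factor with \<open>U P\<close> is controlled by
  exponential decay, even with these growing weights. In the other factor each core is counted once
  for every member of \<open>S\<close> above it, with geometrically decreasing weights.
\<close>

lemma carleson_embedding:
  fixes S :: "(real ^ 'n) set set" and U \<psi> :: "(real ^ 'n) set \<Rightarrow> real ^ 'n \<Rightarrow> real"
  assumes fin: "finite S" and lam: "laminar S" and meas: "\<And>R. R \<in> S \<Longrightarrow> R \<in> lmeasurable"
    and pos: "\<And>R. R \<in> S \<Longrightarrow> 0 < vol R"
    and U0: "\<And>P x. 0 \<le> U P x" and U: "\<And>P R. P \<in> S \<Longrightarrow> R \<in> S \<Longrightarrow> set_integrable lebesgue R (U P)"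
    and \<psi>0: "\<And>P x. 0 \<le> \<psi> P x" and \<psi>: "\<And>P. P \<in> S \<Longrightarrow> set_integrable lebesgue P (\<psi> P)"
    and \<Phi>0: "\<And>x. 0 \<le> \<Phi> x" and \<Phi>: "integrable lebesgue \<Phi>"
    and le: "\<And>P x. P \<in> S \<Longrightarrow> (\<psi> P x)\<^sup>2 \<le> U P x * \<Phi> x"
    and A: "0 < A" and packing: "\<And>P R. P \<in> S \<Longrightarrow> R \<in> S \<Longrightarrow>
      (\<Sum>R' | R' \<in> S \<and> R' \<subseteq> R. LINT x:R'|lebesgue. U P x) \<le> A * (LINT x:R|lebesgue. U P x)"
    and mass: "\<And>P. P \<in> S \<Longrightarrow> (LINT x:P|lebesgue. U P x) \<le> d * vol P" and d: "0 \<le> d"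
  shows "(\<Sum>P\<in>S. (LINT x:P|lebesgue. \<psi> P x)\<^sup>2 / vol P) \<le> 2 * d * (2 * A + 1) * (LINT x|lebesgue. \<Phi> x)"
proof -
  define l where "l = 1 + 1 / (2 * A)"
  have l: "l > 1" "l / (l - 1) = 2 * A + 1" using A by (auto simp: l_def field_simps)
  define g where "g = generations_between S"
  define E where "E = core S"
  have sets: "S \<subseteq> sets lebesgue" using meas by (auto simp: fmeasurableD)
  have Esets: "E R \<in> sets lebesgue" if "R \<in> S" for R unfolding E_def using sets_core[OF fin sets that] .
  have \<Phi>s: "set_integrable lebesgue R \<Phi>" if "R \<in> sets lebesgue" for R
    unfolding set_integrable_def using integrable_mult_indicator[OF that \<Phi>] .
  define \<phi> where "\<phi> R = (LINT x:E R|lebesgue. \<Phi> x)" for R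
  have \<phi>0: "0 \<le> \<phi> R" for R unfolding \<phi>_def by (rule set_integral_nonneg_pointwise[OF \<Phi>0])
  have one: "(LINT x:P|lebesgue. \<psi> P x)\<^sup>2 / vol P \<le> 2 * d * (\<Sum>R | R \<in> S \<and> R \<subseteq> P. (1 / l) ^ g P R * \<phi> R)"
    if P: "P \<in> S" for P
  proof -
    define e where "e R = (LINT x:E R|lebesgue. U P x)" for R
    define X where "X = (\<Sum>R | R \<in> S \<and> R \<subseteq> P. e R * l ^ g P R)"
    define Y where "Y = (\<Sum>R | R \<in> S \<and> R \<subseteq> P. (1 / l) ^ g P R * \<phi> R)"
    have e0: "0 \<le> e R" for R unfolding e_def by (rule set_integral_nonneg_pointwise[OF U0])
    have w0: "0 \<le> (LINT x:R|lebesgue. U P x)" for R by (rule set_integral_nonneg_pointwise[OF U0])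
    have "X \<le> 2 * (LINT x:P|lebesgue. U P x)"
      unfolding X_def g_def l_def
    proof (rule packing_imp_exponential_decay[OF fin lam A, where w="\<lambda>R. LINT x:R|lebesgue. U P x"])
      show "(\<Sum>R' | R' \<in> S \<and> R' \<subseteq> R. e R') \<le> (LINT x:R|lebesgue. U P x)" if "R \<in> S" for R
        unfolding e_def E_def using set_integral_core[OF fin lam sets that U[OF P that]] by simp
    qed (use e0 w0 packing P in auto)
    also have "\<dots> \<le> 2 * (d * vol P)" using mass[OF P] by simp
    finally have X: "X \<le> 2 * d * vol P" by simp
    have XY0: "0 \<le> X" "0 \<le> Y" unfolding X_def Y_def using e0 \<phi>0 l by (auto intro!: sum_nonneg)
    have "2 * (LINT x:P|lebesgue. \<psi> P x) \<le> t * X + Y / t" if t: "t > 0" for t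
    proof -
      have "2 * (LINT x:E R|lebesgue. \<psi> P x) \<le> t * (e R * l ^ g P R) + (1 / l) ^ g P R * \<phi> R / t"
        if R: "R \<in> S" "R \<subseteq> P" for R
      proof -
        define b where "b = t * l ^ g P R"
        have b: "b > 0" using t l by (simp add: b_def)
        have ER: "E R \<subseteq> P" using core_subset[of S R] R by (auto simp: E_def)
        have iU: "set_integrable lebesgue (E R) (U P)"
          by (rule set_integrable_subset[OF U[OF P P] Esets[OF R(1)] ER])
        have i\<psi>: "set_integrable lebesgue (E R) (\<psi> P)"
          by (rule set_integrable_subset[OF \<psi>[OF P] Esets[OF R(1)] ER])
        have i\<Phi>: "set_integrable lebesgue (E R) \<Phi>" by (rule \<Phi>s[OF Esets[OF R(1)]])
        have "2 * \<psi> P x \<le> b * U P x + (1 / b) * \<Phi> x" for x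
        proof -
          have "(2 * \<psi> P x)\<^sup>2 \<le> 4 * (U P x * \<Phi> x)" using le[OF P, of x] by (simp add: power_mult_distrib)
          also have "\<dots> = 4 * ((b * U P x) * ((1 / b) * \<Phi> x))" using b by simp
          also have "\<dots> \<le> (b * U P x + (1 / b) * \<Phi> x)\<^sup>2"
            by (rule four_mult_le)
          finally show ?thesis
            by (rule power2_le_imp_le) (use b U0 \<Phi>0 in auto)
        qed
        then have "(LINT x:E R|lebesgue. 2 * \<psi> P x) \<le> (LINT x:E R|lebesgue. b * U P x + (1 / b) * \<Phi> x)"
          by (intro set_integral_mono set_integral_add set_integrable_mult_right) (use iU i\<psi> i\<Phi> in auto)
        also have "\<dots> = b * e R + (1 / b) * \<phi> R"
          by (subst set_integral_add(2)) (use iU i\<Phi> in \<open>auto simp: e_def \<phi>_def\<close>)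
        finally have "2 * (LINT x:E R|lebesgue. \<psi> P x) \<le> b * e R + (1 / b) * \<phi> R" by simp
        then show ?thesis by (simp add: b_def power_one_over mult_ac)
      qed
      then have "(\<Sum>R | R \<in> S \<and> R \<subseteq> P. 2 * (LINT x:E R|lebesgue. \<psi> P x)) \<le>
        (\<Sum>R | R \<in> S \<and> R \<subseteq> P. t * (e R * l ^ g P R) + (1 / l) ^ g P R * \<phi> R / t)"
        by (intro sum_mono) auto
      then show ?thesis
        using set_integral_core[OF fin lam sets P \<psi>[OF P]]
        by (simp add: X_def Y_def E_def sum.distrib sum_distrib_left sum_divide_distrib)
    qed
    then have "(LINT x:P|lebesgue. \<psi> P x)\<^sup>2 \<le> X * Y"
      by (rule square_le_of_weighted_means) (use XY0 set_integral_nonneg_pointwise[OF \<psi>0] in auto)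
    also have "\<dots> \<le> (2 * d * vol P) * Y" using X XY0 by (intro mult_right_mono)
    finally show ?thesis using pos[OF P] by (simp add: Y_def divide_le_eq mult_ac)
  qed
  have "(\<Sum>P\<in>S. \<Sum>R | R \<in> S \<and> R \<subseteq> P. (1 / l) ^ g P R * \<phi> R) =
    (\<Sum>R\<in>S. \<Sum>P | P \<in> S \<and> R \<subseteq> P. (1 / l) ^ g P R * \<phi> R)"
    by (rule sum.swap_restrict[OF fin fin])
  also have "\<dots> = (\<Sum>R\<in>S. (\<Sum>P | P \<in> S \<and> R \<subseteq> P. (1 / l) ^ g P R) * \<phi> R)"
    by (simp add: sum_distrib_right)
  also have "\<dots> \<le> (\<Sum>R\<in>S. (2 * A + 1) * \<phi> R)"
    using sum_inverse_power_generations_between[OF fin lam _ l(1)] \<phi>0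
    unfolding l(2) g_def by (intro sum_mono mult_right_mono) auto
  also have "\<dots> = (2 * A + 1) * (\<Sum>R\<in>S. \<phi> R)" by (simp add: sum_distrib_left)
  also have "\<dots> \<le> (2 * A + 1) * (LINT x|lebesgue. \<Phi> x)"
  proof (rule mult_left_mono)
    have "(\<Sum>R\<in>S. \<phi> R) = (LINT x:(\<Union>R\<in>S. E R)|lebesgue. \<Phi> x)"
      unfolding \<phi>_def using core_disjoint[OF lam] fin Esets \<Phi>s
      by (intro set_integral_finite_Union[symmetric]) (auto simp: disjoint_family_on_def E_def)
    also have "\<dots> \<le> (LINT x:UNIV|lebesgue. \<Phi> x)"
      using fin Esets \<Phi>0 by (intro set_integral_mono_set \<Phi>s sets.finite_UN) auto
    finally show "(\<Sum>R\<in>S. \<phi> R) \<le> (LINT x|lebesgue. \<Phi> x)" by (simp add: set_lebesgue_integral_def)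
  qed (use A in simp)
  finally have *: "(\<Sum>P\<in>S. \<Sum>R | R \<in> S \<and> R \<subseteq> P. (1 / l) ^ g P R * \<phi> R) \<le>
    (2 * A + 1) * (LINT x|lebesgue. \<Phi> x)" .
  have "(\<Sum>P\<in>S. (LINT x:P|lebesgue. \<psi> P x)\<^sup>2 / vol P) \<le>
    (\<Sum>P\<in>S. 2 * d * (\<Sum>R | R \<in> S \<and> R \<subseteq> P. (1 / l) ^ g P R * \<phi> R))"
    by (intro sum_mono one)
  also have "\<dots> = 2 * d * (\<Sum>P\<in>S. \<Sum>R | R \<in> S \<and> R \<subseteq> P. (1 / l) ^ g P R * \<phi> R)"
    by (simp add: sum_distrib_left)
  also have "\<dots> \<le> 2 * d * ((2 * A + 1) * (LINT x|lebesgue. \<Phi> x))"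
    using * d by (intro mult_left_mono) auto
  finally show ?thesis by (simp add: mult.assoc)
qed

section \<open>Packing from the scalar \<open>A\<^sub>\<infinity>\<close> condition\<close>

lemma A_infinity_bound:
  assumes "A_infinity D w < ennreal A" "Q \<in> D"
  shows "(\<integral>\<^sup>+x\<in>Q. local_maximal D Q w x \<partial>lebesgue) / ennreal (vol Q) \<le> ennreal A * ennreal (average Q w)"
proof -
  obtain C where C: "C < ennreal A"
    "\<forall>Q\<in>D. (\<integral>\<^sup>+x\<in>Q. local_maximal D Q w x \<partial>lebesgue) / ennreal (vol Q) \<le> C * ennreal (average Q w)"
    using assms(1) unfolding A_infinity_def Inf_less_iff by auto
  then have "(\<integral>\<^sup>+x\<in>Q. local_maximal D Q w x \<partial>lebesgue) / ennreal (vol Q) \<le> C * ennreal (average Q w)"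
    using assms(2) by auto
  also have "\<dots> \<le> ennreal A * ennreal (average Q w)" using C(1) by (intro mult_right_mono) auto
  finally show ?thesis .
qed

context dyadic_grid
begin

text \<open>
  On the core of \<open>R\<close> the maximal function of \<open>P\<close> is at least the average over \<open>R\<close>, the cores are disjoint,
  and sparseness lets the volume of the core replace that of \<open>R\<close>.
\<close>

lemma packing_of_A_infinity:
  assumes fin: "finite S" and S: "S \<subseteq> D" and sparse: "\<And>R. R \<in> S \<Longrightarrow> vol R \<le> 2 * vol (core S R)"
    and w0: "\<And>x. 0 \<le> w x" and A: "A_infinity D w < ennreal A" "0 \<le> A" and P: "P \<in> D"
  shows "(\<Sum>R | R \<in> S \<and> R \<subseteq> P. LINT x:R|lebesgue. w x) \<le> 2 * A * (LINT x:P|lebesgue. w x)"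
proof -
  let ?S = "{R \<in> S. R \<subseteq> P}"
  define E where "E = core S"
  define av where "av R = average R w" for R
  have lam: "laminar S" using laminar_subset[OF laminar_grid S] .
  have SD: "R \<in> D" if "R \<in> S" for R using S that by auto
  have int: "(LINT x:R|lebesgue. w x) = av R * vol R" if "R \<in> D" for R
    using grid_measure_pos[OF that] by (simp add: av_def average_def)
  have av0: "0 \<le> av R" for R
    unfolding av_def average_def using set_integral_nonneg_pointwise[of R w lebesgue, OF w0] by simp
  have Es: "E R \<in> sets lebesgue" if "R \<in> S" for R
    unfolding E_def by (rule sets_core[OF fin _ that]) (intro subsetI grid_sets SD)
  have Efin: "emeasure lebesgue (E R) = ennreal (vol (E R))" if "R \<in> S" for R
  proof -
    have "E R \<in> lmeasurable"
      by (rule fmeasurableI2[OF grid_lmeasurable[OF SD[OF that]] _ Es[OF that]]) (simp add: E_def core_subset)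
    then show ?thesis by (rule emeasure_eq_measure2)
  qed
  have "ennreal (\<Sum>R\<in>?S. av R * vol (E R)) = (\<Sum>R\<in>?S. ennreal (av R) * emeasure lebesgue (E R))"
    using av0 by (subst sum_ennreal[symmetric]) (auto simp: Efin ennreal_mult intro!: sum.cong)
  also have "\<dots> = (\<integral>\<^sup>+x. (\<Sum>R\<in>?S. ennreal (av R) * indicator (E R) x) \<partial>lebesgue)"
    using Es by (subst nn_integral_sum) (auto intro!: sum.cong borel_measurable_times_ennreal borel_measurable_indicator
        simp: nn_integral_cmult_indicator)
  also have "\<dots> \<le> (\<integral>\<^sup>+x\<in>P. local_maximal D P w x \<partial>lebesgue)"
  proof (rule nn_integral_mono)
    fix x
    show "(\<Sum>R\<in>?S. ennreal (av R) * indicator (E R) x) \<le> local_maximal D P w x * indicator P x"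
    proof (cases "\<exists>R\<in>?S. x \<in> E R")
      case True
      then obtain R where R: "R \<in> ?S" "x \<in> E R" by auto
      have "indicator (E R') x = (if R' = R then 1 else 0 :: ennreal)" if "R' \<in> ?S" for R'
        using core_disjoint[OF lam, of R R'] R that by (auto simp: indicator_def E_def)
      then have "(\<Sum>R\<in>?S. ennreal (av R) * indicator (E R) x) = (\<Sum>R'\<in>?S. if R' = R then ennreal (av R) else 0)"
        by (intro sum.cong) auto
      also have "\<dots> = ennreal (av R)" using R fin by simp
      also have "\<dots> \<le> local_maximal D P w x"
      proof -
        have x: "x \<in> P" "x \<in> R" using R core_subset[of S R] by (auto simp: E_def)
        then have "ennreal \<bar>average R w\<bar> \<le> (SUP R\<in>{R \<in> D. R \<subseteq> P \<and> x \<in> R}. ennreal \<bar>average R w\<bar>)"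
          using R SD by (intro SUP_upper) auto
        then show ?thesis using x av0[of R] by (simp add: local_maximal_def av_def)
      qed
      finally show ?thesis using R core_subset[of S R] by (auto simp: E_def indicator_def)
    next
      case False
      then have "(\<Sum>R\<in>?S. ennreal (av R) * indicator (E R) x) = 0" by (intro sum.neutral) auto
      then show ?thesis by simp
    qed
  qed
  also have "\<dots> = (\<integral>\<^sup>+x\<in>P. local_maximal D P w x \<partial>lebesgue) / ennreal (vol P) * ennreal (vol P)"
    using grid_measure_pos[OF P] by (simp add: divide_ennreal_def mult.assoc inverse_ennreal flip: ennreal_mult)
  also have "\<dots> \<le> ennreal A * ennreal (av P) * ennreal (vol P)"
    unfolding av_def by (intro mult_right_mono A_infinity_bound A P) auto
  also have "\<dots> = ennreal (A * (av P * vol P))" using A(2) av0 by (simp add: ennreal_mult mult.assoc)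
  finally have "(\<Sum>R\<in>?S. av R * vol (E R)) \<le> A * (av P * vol P)"
    using A(2) av0 by (subst (asm) ennreal_le_iff) auto
  moreover have "(\<Sum>R\<in>?S. LINT x:R|lebesgue. w x) \<le> 2 * (\<Sum>R\<in>?S. av R * vol (E R))"
    unfolding sum_distrib_left
  proof (rule sum_mono)
    fix R assume R: "R \<in> ?S"
    have "av R * vol R \<le> av R * (2 * vol (E R))"
      using sparse R av0 unfolding E_def by (intro mult_left_mono) auto
    then show "(LINT x:R|lebesgue. w x) \<le> 2 * (av R * vol (E R))" using int R SD by simp
  qed
  ultimately show ?thesis unfolding int[OF P] by simp
qed

end

section \<open>Normalizing by the averages of the weights\<close>

lemma norm_vector_scalar_mult:
  fixes c :: "'k::real_normed_field" and v :: "'k ^ 'd"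
  shows "norm (c *s v) = norm c * norm v"
proof (rule power2_eq_imp_eq)
  show "(norm (c *s v))\<^sup>2 = (norm c * norm v)\<^sup>2"
    by (simp add: norm_vec_sq power_mult_distrib norm_mult sum_distrib_left)
qed auto

lemma scaleR_matrix_vector_mult:
  fixes A :: "'k::real_or_complex ^ 'd ^ 'e"
  shows "(c *\<^sub>R A) *v v = c *\<^sub>R (A *v v)"
  by (simp add: vec_eq_iff matrix_vector_mult_def scaleR_sum_right)

lemma norm_axis_one: "norm (axis i (1 :: 'k::real_normed_field)) = 1"
proof -
  have "(norm (axis i (1 :: 'k)))\<^sup>2 = (\<Sum>j\<in>UNIV. if j = i then 1 else 0)"
    unfolding norm_vec_sq by (intro sum.cong) (auto simp: axis_def)
  then show ?thesis by (simp add: power2_eq_1_iff) (metis norm_ge_zero not_one_le_zero neg_0_le_iff_le)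
qed

lemma adjoint_norm_le:
  fixes X Y :: "'v::real_inner \<Rightarrow> 'v"
  assumes "\<And>v w. X v \<bullet> w = v \<bullet> Y w" "\<And>v. norm (X v) \<le> \<kappa> * norm v"
  shows "norm (Y w) \<le> \<kappa> * norm w"
proof (cases "Y w = 0")
  case True
  show ?thesis
    using order_trans[OF norm_ge_zero assms(2)[of w]] by (simp add: True)
next
  case False
  have "norm (Y w) * norm (Y w) = X (Y w) \<bullet> w"
    using assms(1) by (simp add: power2_norm_eq_inner flip: power2_eq_square)
  also have "\<dots> \<le> (\<kappa> * norm (Y w)) * norm w"
    by (rule order_trans[OF norm_cauchy_schwarz mult_right_mono[OF assms(2)]]) simp
  finally have "norm (Y w) * norm (Y w) \<le> norm (Y w) * (\<kappa> * norm w)" by (simp add: mult_ac)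
  then show ?thesis using False by simp
qed

lemma matrix_opnorm_nonneg: "0 \<le> matrix_opnorm A"
  unfolding matrix_opnorm_def by (rule onorm_pos_le) simp

lemma inner_matrix_vector_mult_le: "(A *v v) \<bullet> v \<le> matrix_opnorm A * (norm v)\<^sup>2"
proof -
  have "(A *v v) \<bullet> v \<le> norm (A *v v) * norm v" by (rule norm_cauchy_schwarz)
  also have "\<dots> \<le> (matrix_opnorm A * norm v) * norm v"
    by (intro mult_right_mono norm_matrix_vector_mult_le) simp
  finally show ?thesis by (simp add: power2_eq_square mult.assoc)
qed

lemma regularized_sqrt:
  fixes P :: "'k::real_or_complex ^ 'd ^ 'd"
  assumes P: "positive_semidefinite P" and \<delta>: "0 < \<delta>"
  obtains S N :: "'k ^ 'd ^ 'd" where "\<And>v w. (S *v v) \<bullet> w = v \<bullet> (S *v w)" "\<And>v w. (N *v v) \<bullet> w = v \<bullet> (N *v w)"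
    "\<And>v. S *v (N *v v) = v" "\<And>v. (norm (S *v v))\<^sup>2 = (P *v v) \<bullet> v + \<delta> * (norm v)\<^sup>2"
proof -
  define H where "H = P + \<delta> *\<^sub>R mat 1"
  have H: "H *v v = P *v v + \<delta> *\<^sub>R v" for v
    by (simp add: H_def matrix_vector_mult_add_rdistrib scaleR_matrix_vector_mult)
  have pH: "positive_semidefinite H"
    using P \<delta> positive_semidefinite_nonneg[OF P] positive_semidefinite_self_adjoint[OF P]
    unfolding positive_semidefinite_iff[of H] by (auto simp: H inner_simps)
  define S where "S = matrix_sqrt H"
  have S: "(S *v v) \<bullet> w = v \<bullet> (S *v w)" for v w
    unfolding S_def by (rule positive_semidefinite_self_adjoint[OF positive_semidefinite_matrix_sqrt[OF pH]])
  have nS: "(norm (S *v v))\<^sup>2 = (P *v v) \<bullet> v + \<delta> * (norm v)\<^sup>2" for v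
    unfolding S_def norm_matrix_sqrt_mult[OF pH] by (simp add: H inner_simps power2_norm_eq_inner)
  have "inj ((*v) S)"
  proof (rule injI)
    fix v w assume "S *v v = S *v w"
    then have "S *v (v - w) = 0" by (simp add: matrix_vector_mult_diff_distrib)
    then have "\<delta> * (norm (v - w))\<^sup>2 \<le> 0"
      using nS[of "v - w"] positive_semidefinite_nonneg[OF P, of "v - w"] by simp
    then show "v = w" using \<delta> by (simp add: mult_le_0_iff)
  qed
  then obtain N where "N ** S = mat 1" using matrix_left_invertible_injective[of S] by auto
  then have SN: "S ** N = mat 1" using matrix_left_right_inverse[of N S] by simp
  have inv: "S *v (N *v v) = v" for v by (simp add: matrix_vector_mul_assoc SN)
  have "(N *v v) \<bullet> w = v \<bullet> (N *v w)" for v w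
    using S[of "N *v v" "N *v w"] by (simp add: inv)
  then show ?thesis using that S inv nS by blast
qed

text \<open>
  The averages may be singular, so they are regularized before they are inverted; the parameter
  can be taken so small, depending on the cube, that the joint bound \<open>K\<close> deteriorates
  by an arbitrarily small amount.
\<close>

lemma normalizers:
  fixes P1 P2 :: "'k::real_or_complex ^ 'd ^ 'd"
  assumes P1: "positive_semidefinite P1" and P2: "positive_semidefinite P2"
    and K: "(matrix_opnorm (matrix_sqrt P2 ** matrix_sqrt P1))\<^sup>2 \<le> K" and \<eta>: "0 < \<eta>"
  obtains S1 N1 S2 N2 :: "'k ^ 'd ^ 'd" where
    "\<And>v w. (N1 *v v) \<bullet> w = v \<bullet> (N1 *v w)" "\<And>v. S1 *v (N1 *v v) = v" "\<And>v. (P1 *v v) \<bullet> v \<le> (norm (S1 *v v))\<^sup>2"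
    "\<And>v w. (N2 *v v) \<bullet> w = v \<bullet> (N2 *v w)" "\<And>v. S2 *v (N2 *v v) = v" "\<And>v. (P2 *v v) \<bullet> v \<le> (norm (S2 *v v))\<^sup>2"
    "\<And>v w. (S2 *v v) \<bullet> w = v \<bullet> (S2 *v w)" "\<And>v. norm (S2 *v (S1 *v v)) \<le> sqrt (K + \<eta>) * norm v"
proof -
  define n1 n2 where "n1 = matrix_opnorm P1" and "n2 = matrix_opnorm P2"
  have n: "0 \<le> n1" "0 \<le> n2" by (auto simp: n1_def n2_def matrix_opnorm_nonneg)
  have K0: "0 \<le> K" using K order_trans zero_le_power2 by blast
  define \<delta> where "\<delta> = min 1 (\<eta> / (n1 + n2 + 1))"
  have \<delta>: "0 < \<delta>" "\<delta> \<le> 1" using n \<eta> by (auto simp: \<delta>_def)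
  have "\<delta> * (n1 + n2 + 1) \<le> \<eta> / (n1 + n2 + 1) * (n1 + n2 + 1)"
    using n by (intro mult_right_mono) (auto simp: \<delta>_def)
  then have \<delta>\<eta>: "\<delta> * (n1 + n2 + 1) \<le> \<eta>" using n by simp
  obtain S1 N1 where 1: "\<And>v w. (S1 *v v) \<bullet> w = v \<bullet> (S1 *v w)" "\<And>v w. (N1 *v v) \<bullet> w = v \<bullet> (N1 *v w)"
    "\<And>v. S1 *v (N1 *v v) = v" "\<And>v. (norm (S1 *v v))\<^sup>2 = (P1 *v v) \<bullet> v + \<delta> * (norm v)\<^sup>2"
    using regularized_sqrt[OF P1 \<delta>(1)] by metis
  obtain S2 N2 where 2: "\<And>v w. (S2 *v v) \<bullet> w = v \<bullet> (S2 *v w)" "\<And>v w. (N2 *v v) \<bullet> w = v \<bullet> (N2 *v w)"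
    "\<And>v. S2 *v (N2 *v v) = v" "\<And>v. (norm (S2 *v v))\<^sup>2 = (P2 *v v) \<bullet> v + \<delta> * (norm v)\<^sup>2"
    using regularized_sqrt[OF P2 \<delta>(1)] by metis
  define R1 R2 where "R1 = matrix_sqrt P1" and "R2 = matrix_sqrt P2"
  have R: "(R1 *v v) \<bullet> w = v \<bullet> (R1 *v w)" "(R2 *v v) \<bullet> w = v \<bullet> (R2 *v w)" for v w
    unfolding R1_def R2_def
    by (intro positive_semidefinite_self_adjoint positive_semidefinite_matrix_sqrt P1 P2)+
  have nR: "(norm (R1 *v v))\<^sup>2 = (P1 *v v) \<bullet> v" "(norm (R2 *v v))\<^sup>2 = (P2 *v v) \<bullet> v" for v
    unfolding R1_def R2_def by (intro norm_matrix_sqrt_mult P1 P2)+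
  have "norm (R2 *v (R1 *v v)) \<le> sqrt K * norm v" for v
  proof -
    have "norm (R2 *v (R1 *v v)) \<le> matrix_opnorm (R2 ** R1) * norm v"
      using norm_matrix_vector_mult_le[of "R2 ** R1" v] by (simp add: matrix_vector_mul_assoc)
    also have "matrix_opnorm (R2 ** R1) \<le> sqrt K"
      using K unfolding R1_def R2_def by (rule real_le_rsqrt)
    finally show ?thesis by (simp add: mult_right_mono)
  qed
  then have R12: "norm (R1 *v (R2 *v v)) \<le> sqrt K * norm v" for v
    by (rule adjoint_norm_le[where X="\<lambda>v. R2 *v (R1 *v v)", rotated]) (simp only: R)
  have "norm (S1 *v (R2 *v v)) \<le> sqrt (K + \<delta> * n2) * norm v" for v
  proof (rule power2_le_imp_le)
    have "(norm (S1 *v (R2 *v v)))\<^sup>2 = (norm (R1 *v (R2 *v v)))\<^sup>2 + \<delta> * ((P2 *v v) \<bullet> v)"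
      unfolding 1(4) nR ..
    also have "\<dots> \<le> (sqrt K * norm v)\<^sup>2 + \<delta> * (n2 * (norm v)\<^sup>2)"
      unfolding n2_def using \<delta> by (intro add_mono power_mono R12 mult_left_mono inner_matrix_vector_mult_le) auto
    also have "\<dots> = (sqrt (K + \<delta> * n2) * norm v)\<^sup>2"
      using K0 n \<delta> by (simp add: power_mult_distrib distrib_right mult.assoc)
    finally show "(norm (S1 *v (R2 *v v)))\<^sup>2 \<le> (sqrt (K + \<delta> * n2) * norm v)\<^sup>2" .
  qed (use K0 n \<delta> in auto)
  then have R2S1: "norm (R2 *v (S1 *v v)) \<le> sqrt (K + \<delta> * n2) * norm v" for v
    by (rule adjoint_norm_le[where X="\<lambda>v. S1 *v (R2 *v v)", rotated]) (simp only: R 1(1))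
  have "norm (S2 *v (S1 *v v)) \<le> sqrt (K + \<eta>) * norm v" for v
  proof (rule power2_le_imp_le)
    have "(norm (S2 *v (S1 *v v)))\<^sup>2 = (norm (R2 *v (S1 *v v)))\<^sup>2 + \<delta> * ((P1 *v v) \<bullet> v + \<delta> * (norm v)\<^sup>2)"
      unfolding 2(4) nR 1(4) ..
    also have "\<dots> \<le> (sqrt (K + \<delta> * n2) * norm v)\<^sup>2 + \<delta> * (n1 * (norm v)\<^sup>2 + 1 * (norm v)\<^sup>2)"
      unfolding n1_def using \<delta>
      by (intro add_mono power_mono R2S1 mult_left_mono inner_matrix_vector_mult_le mult_right_mono) auto
    also have "\<dots> = (K + \<delta> * (n1 + n2 + 1)) * (norm v)\<^sup>2"
      using K0 n \<delta> by (simp add: power_mult_distrib algebra_simps)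
    also have "\<dots> \<le> (K + \<eta>) * (norm v)\<^sup>2" using \<delta>\<eta> by (intro mult_right_mono) auto
    also have "\<dots> = (sqrt (K + \<eta>) * norm v)\<^sup>2" using K0 \<eta> by (simp add: power_mult_distrib)
    finally show "(norm (S2 *v (S1 *v v)))\<^sup>2 \<le> (sqrt (K + \<eta>) * norm v)\<^sup>2" .
  qed (use K0 \<eta> in auto)
  moreover have "(P1 *v v) \<bullet> v \<le> (norm (S1 *v v))\<^sup>2" "(P2 *v v) \<bullet> v \<le> (norm (S2 *v v))\<^sup>2" for v
    using 1(4)[of v] 2(4)[of v] \<delta> by simp_all
  ultimately show ?thesis
    by (intro that[of N1 S1 N2 S2] 1 2)
qed

text \<open>
  The sum on the right is the squared Hilbert--Schmidt norm of the adjoint of \<open>N\<close> times the square root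
  of \<open>V\<close>, and an operator and its adjoint have the same Hilbert--Schmidt norm. In the application \<open>N\<close>
  is a normalizer, and the sum is a sum of scalar weights.
\<close>

lemma norm_normalized_sqrt_le:
  fixes N V :: "'k::real_or_complex ^ 'd ^ 'd"
  assumes V: "positive_semidefinite V" and N: "\<And>v w. (N *v v) \<bullet> w = v \<bullet> (N *v w)"
  shows "(norm (N *v (matrix_sqrt V *v f)))\<^sup>2 \<le>
    (\<Sum>i\<in>UNIV. (V *v (N *v axis i 1)) \<bullet> (N *v axis i 1)) * (norm f)\<^sup>2"
proof -
  define R where "R = matrix_sqrt V"
  define y where "y = N *v (R *v f)"
  have R: "(R *v v) \<bullet> w = v \<bullet> (R *v w)" for v w
    unfolding R_def by (rule positive_semidefinite_self_adjoint[OF positive_semidefinite_matrix_sqrt[OF V]])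
  define h where "h = (\<Sum>i\<in>UNIV. (norm (R *v (N *v axis i 1)))\<^sup>2)"
  have "R *v (N *v y) = R *v (N *v (\<Sum>i\<in>UNIV. (y $ i) *s axis i 1))" by (simp add: basis_expansion)
  also have "\<dots> = (\<Sum>i\<in>UNIV. (y $ i) *s (R *v (N *v axis i 1)))"
    by (simp add: linear_sum[OF matrix_vector_mul_linear] vector_scalar_commute)
  finally have "norm (R *v (N *v y)) \<le> (\<Sum>i\<in>UNIV. norm ((y $ i) *s (R *v (N *v axis i 1))))"
    by (simp only: norm_sum)
  also have "\<dots> = (\<Sum>i\<in>UNIV. \<bar>norm (y $ i)\<bar> * \<bar>norm (R *v (N *v axis i 1))\<bar>)"
    by (simp add: norm_vector_scalar_mult)
  also have "\<dots> \<le> L2_set (\<lambda>i. norm (y $ i)) UNIV * L2_set (\<lambda>i. norm (R *v (N *v axis i 1))) UNIV"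
    by (rule L2_set_mult_ineq)
  also have "\<dots> = norm y * sqrt h" by (simp add: norm_vec_def L2_set_def h_def)
  finally have *: "norm (R *v (N *v y)) \<le> norm y * sqrt h" .
  have "norm y * norm y = f \<bullet> (R *v (N *v y))"
  proof -
    have "norm y * norm y = y \<bullet> y" by (simp add: power2_norm_eq_inner flip: power2_eq_square)
    also have "\<dots> = (R *v f) \<bullet> (N *v y)" using N[of "R *v f" y] by (simp add: y_def)
    finally show ?thesis by (simp add: R)
  qed
  also have "\<dots> \<le> norm f * (norm y * sqrt h)"
    by (rule order_trans[OF norm_cauchy_schwarz mult_left_mono[OF *]]) simp
  finally have "norm y * norm y \<le> norm y * (norm f * sqrt h)" by (simp add: mult_ac)
  then have "norm y \<le> norm f * sqrt h"
    by (cases "y = 0") (auto simp: h_def sum_nonneg)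
  then have "(norm y)\<^sup>2 \<le> (norm f * sqrt h)\<^sup>2" by (rule power_mono) simp
  also have "\<dots> = h * (norm f)\<^sup>2" by (simp add: power_mult_distrib h_def sum_nonneg mult.commute)
  also have "h = (\<Sum>i\<in>UNIV. (V *v (N *v axis i 1)) \<bullet> (N *v axis i 1))"
    by (simp add: h_def R_def norm_matrix_sqrt_mult[OF V])
  finally show ?thesis by (simp add: y_def R_def)
qed

section \<open>Matrix weights on cubes\<close>

lemma
  fixes f :: "_ \<Rightarrow> 'b::euclidean_space" and T :: "'b \<Rightarrow> 'c::euclidean_space"
  assumes T: "bounded_linear T" and f: "set_integrable M A f"
  shows set_integrable_bounded_linear: "set_integrable M A (\<lambda>x. T (f x))"
    and set_integral_bounded_linear: "(LINT x:A|M. T (f x)) = T (LINT x:A|M. f x)"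
proof -
  have *: "T (indicat_real A x *\<^sub>R f x) = indicat_real A x *\<^sub>R T (f x)" for x
    by (rule linear_scale[OF bounded_linear.linear[OF T]])
  show "set_integrable M A (\<lambda>x. T (f x))"
    using integrable_bounded_linear[OF T f[unfolded set_integrable_def]] by (simp add: set_integrable_def *)
  show "(LINT x:A|M. T (f x)) = T (LINT x:A|M. f x)"
    using integral_bounded_linear[OF T f[unfolded set_integrable_def]] by (simp add: set_lebesgue_integral_def *)
qed

lemma bounded_linear_matrix_apply:
  "bounded_linear (\<lambda>A :: 'k::real_or_complex ^ 'd ^ 'd. A *v e)"
  unfolding linear_conv_bounded_linear[symmetric] linear_iff
  by (simp add: matrix_vector_mult_add_rdistrib scaleR_matrix_vector_mult)

lemma bounded_linear_matrix_form:
  "bounded_linear (\<lambda>A :: 'k::real_or_complex ^ 'd ^ 'd. (A *v e) \<bullet> e')"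
  by (rule bounded_linear_compose[OF bounded_linear_inner_left bounded_linear_matrix_apply])

lemma in_L2_set_integrable:
  fixes F :: "real ^ 'n \<Rightarrow> 'b::euclidean_space"
  assumes "in_L2 F" "P \<in> lmeasurable"
  shows "set_integrable lebesgue P F"
  unfolding set_integrable_def
proof (rule Bochner_Integration.integrable_bound)
  have P: "P \<in> sets lebesgue" "emeasure lebesgue P < \<infinity>" using assms(2) by (auto simp: fmeasurable_def)
  show "integrable lebesgue (\<lambda>x. indicat_real P x + (norm (F x))\<^sup>2)"
    using assms P by (intro Bochner_Integration.integrable_add integrable_real_indicator) (auto simp: in_L2_def)
  show "(\<lambda>x. indicat_real P x *\<^sub>R F x) \<in> borel_measurable lebesgue"
    using assms P by (intro borel_measurable_scaleR borel_measurable_indicator) (auto simp: in_L2_def)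
  have "norm (F x) \<le> 1 + (norm (F x))\<^sup>2" for x
    using sum_squares_bound[of 1 "norm (F x)"] norm_ge_zero[of "F x"] by (simp del: norm_ge_zero)
  then show "AE x in lebesgue. norm (indicat_real P x *\<^sub>R F x) \<le> norm (indicat_real P x + (norm (F x))\<^sup>2)"
    by (intro always_eventually allI) (auto simp: indicator_def)
qed

lemma (in dyadic_grid) locally_integrable_grid:
  assumes "locally_integrable f" "Q \<in> D"
  shows "set_integrable lebesgue Q f"
proof -
  obtain r where r: "Q \<subseteq> cball 0 r"
    using grid_bounded[OF assms(2)] unfolding bounded_iff by (auto simp: subset_iff)
  have "set_integrable lebesgue (cball 0 r) f"
    using assms(1) by (simp add: locally_integrable_def)
  then show ?thesis by (rule set_integrable_subset[OF _ grid_sets[OF assms(2)] r])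
qed

lemma (in dyadic_grid)
  assumes "matrix_weight V" "Q \<in> D"
  shows positive_semidefinite_average: "positive_semidefinite (average Q V)"
    and set_integral_matrix_form: "(LINT x:Q|lebesgue. (V x *v e) \<bullet> e') = vol Q * ((average Q V *v e) \<bullet> e')"
proof -
  have int: "set_integrable lebesgue Q V" and psd: "\<And>x. positive_semidefinite (V x)"
    using assms by (auto intro!: locally_integrable_grid simp: matrix_weight_def)
  have eq: "(LINT x:Q|lebesgue. (V x *v e) \<bullet> e') = vol Q * ((average Q V *v e) \<bullet> e')" for e e'
    using set_integral_bounded_linear[OF bounded_linear_matrix_form int, of e e'] grid_measure_pos[OF assms(2)]
    by (simp add: average_def scaleR_matrix_vector_mult)
  then show "(LINT x:Q|lebesgue. (V x *v e) \<bullet> e') = vol Q * ((average Q V *v e) \<bullet> e')" .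
  have "(average Q V *v v) \<bullet> w = v \<bullet> (average Q V *v w)" for v w
  proof -
    have "(V x *v v) \<bullet> w = (V x *v w) \<bullet> v" for x
      using positive_semidefinite_self_adjoint[OF psd] by (simp add: inner_commute)
    then have "vol Q * ((average Q V *v v) \<bullet> w) = vol Q * ((average Q V *v w) \<bullet> v)"
      unfolding eq[symmetric] by simp
    then show ?thesis using grid_measure_pos[OF assms(2)] by (simp add: inner_commute)
  qed
  moreover have "0 \<le> (average Q V *v v) \<bullet> v" for v
  proof -
    have "0 \<le> vol Q * ((average Q V *v v) \<bullet> v)"
      unfolding eq[symmetric] by (rule set_integral_nonneg_pointwise) (rule positive_semidefinite_nonneg[OF psd])
    then show ?thesis using grid_measure_pos[OF assms(2)] by (simp add: zero_le_mult_iff)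
  qed
  ultimately show "positive_semidefinite (average Q V)" by (simp add: positive_semidefinite_iff)
qed

text \<open>
  The trace of the normalized weight, \<open>\<Sum>\<^sub>i (V e\<^sub>i) \<bullet> e\<^sub>i\<close> with \<open>e\<^sub>i\<close> the columns of \<open>N P\<close>, is a sum of
  scalar weights with \<open>A\<^sub>\<infinity>\<close> bounds, hence satisfies a packing condition; since \<open>N P\<close> normalizes the
  average of \<open>V\<close> over \<open>P\<close>, its mass on \<open>P\<close> is at most \<open>d |P|\<close>.
\<close>

lemma (in dyadic_grid) weighted_carleson_embedding:
  fixes V :: "real ^ 'n \<Rightarrow> 'k::real_or_complex ^ 'd ^ 'd"
  assumes fin: "finite S" and S: "\<And>R. R \<in> S \<Longrightarrow> R \<in> D"
    and sparse: "\<And>R. R \<in> S \<Longrightarrow> vol R \<le> 2 * vol (core S R)"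
    and V: "matrix_weight V" and f: "in_L2 f" and F: "in_L2 (\<lambda>x. matrix_sqrt (V x) *v f x)"
    and A: "\<And>e. A_infinity D (\<lambda>x. (V x *v e) \<bullet> e) < ennreal A" "0 < A"
    and N: "\<And>P v w. P \<in> S \<Longrightarrow> (N P *v v) \<bullet> w = v \<bullet> (N P *v w)"
    and SN: "\<And>P v. P \<in> S \<Longrightarrow> B P *v (N P *v v) = v"
    and le: "\<And>P v. P \<in> S \<Longrightarrow> (average P V *v v) \<bullet> v \<le> (norm (B P *v v))\<^sup>2"
  shows "(\<Sum>P\<in>S. (LINT x:P|lebesgue. norm (N P *v (matrix_sqrt (V x) *v f x)))\<^sup>2 / vol P) \<le>
    2 * real CARD('d) * (4 * A + 1) * (L2_norm f)\<^sup>2"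
proof -
  have psd: "positive_semidefinite (V x)" for x using V by (simp add: matrix_weight_def)
  have iV: "set_integrable lebesgue Q V" if "Q \<in> D" for Q
    using V by (intro locally_integrable_grid that) (simp add: matrix_weight_def)
  define w where "w e x = (V x *v e) \<bullet> e" for e x
  have w0: "0 \<le> w e x" for e x by (simp add: w_def positive_semidefinite_nonneg[OF psd])
  have iw: "set_integrable lebesgue Q (w e)" if "Q \<in> D" for Q e
    unfolding w_def by (rule set_integrable_bounded_linear[OF bounded_linear_matrix_form iV[OF that]])
  define e where "e P i = N P *v axis i 1" for P i
  define U where "U P x = (\<Sum>i\<in>UNIV. w (e P i) x)" for P x
  have iU: "(LINT x:Q|lebesgue. U P x) = (\<Sum>i\<in>UNIV. LINT x:Q|lebesgue. w (e P i) x)" if "Q \<in> D" for P Q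
  proof -
    have "(LINT x:Q|lebesgue. U P x) = (LINT x|lebesgue. (\<Sum>i\<in>UNIV. indicat_real Q x *\<^sub>R w (e P i) x))"
      by (simp add: set_lebesgue_integral_def U_def sum_distrib_left)
    also have "\<dots> = (\<Sum>i\<in>UNIV. LINT x:Q|lebesgue. w (e P i) x)"
      unfolding set_lebesgue_integral_def
      using iw[OF that] by (intro Bochner_Integration.integral_sum) (simp add: set_integrable_def)
    finally show ?thesis .
  qed
  have "(\<Sum>P\<in>S. (LINT x:P|lebesgue. norm (N P *v (matrix_sqrt (V x) *v f x)))\<^sup>2 / vol P) \<le>
    2 * real CARD('d) * (2 * (2 * A) + 1) * (LINT x|lebesgue. (norm (f x))\<^sup>2)"
  proof (rule carleson_embedding[OF fin, where U=U])
    show "laminar S" using laminar_subset[OF laminar_grid] S by (simp add: subset_iff)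
    show "R \<in> lmeasurable" "0 < vol R" if "R \<in> S" for R
      using that S grid_lmeasurable grid_measure_pos by auto
    show "0 \<le> U P x" for P x unfolding U_def by (intro sum_nonneg w0)
    show "set_integrable lebesgue R (U P)" if "R \<in> S" for P R
      using iw[OF S[OF that]] unfolding U_def set_integrable_def scaleR_sum_right
      by (intro Bochner_Integration.integrable_sum)
    show "set_integrable lebesgue P (\<lambda>x. norm (N P *v (matrix_sqrt (V x) *v f x)))" if "P \<in> S" for P
    proof -
      have "set_integrable lebesgue P (\<lambda>x. N P *v (matrix_sqrt (V x) *v f x))"
        by (rule set_integrable_bounded_linear[OF bounded_linear_matrix_vector_mult
              in_L2_set_integrable[OF F grid_lmeasurable[OF S[OF that]]]])
      then show ?thesis by (rule set_integrable_norm)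
    qed
    show "integrable lebesgue (\<lambda>x. (norm (f x))\<^sup>2)" using f by (simp add: in_L2_def)
    show "(norm (N P *v (matrix_sqrt (V x) *v f x)))\<^sup>2 \<le> U P x * (norm (f x))\<^sup>2" if "P \<in> S" for P x
      unfolding U_def w_def e_def by (intro norm_normalized_sqrt_le psd N that)
    show "(\<Sum>R' | R' \<in> S \<and> R' \<subseteq> R. LINT x:R'|lebesgue. U P x) \<le> 2 * A * (LINT x:R|lebesgue. U P x)"
      if "R \<in> S" for P R
    proof -
      have "(\<Sum>R' | R' \<in> S \<and> R' \<subseteq> R. LINT x:R'|lebesgue. U P x) =
        (\<Sum>R' | R' \<in> S \<and> R' \<subseteq> R. \<Sum>i\<in>UNIV. LINT x:R'|lebesgue. w (e P i) x)"
        using S by (intro sum.cong refl iU) auto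
      also have "\<dots> = (\<Sum>i\<in>UNIV. \<Sum>R' | R' \<in> S \<and> R' \<subseteq> R. LINT x:R'|lebesgue. w (e P i) x)"
        by (rule sum.swap)
      also have "\<dots> \<le> (\<Sum>i\<in>UNIV. 2 * A * (LINT x:R|lebesgue. w (e P i) x))"
        using A S that unfolding w_def[abs_def]
        by (intro sum_mono packing_of_A_infinity[OF fin _ sparse] positive_semidefinite_nonneg[OF psd]) auto
      finally show ?thesis unfolding iU[OF S[OF that]] by (simp add: sum_distrib_left)
    qed
    show "(LINT x:P|lebesgue. U P x) \<le> real CARD('d) * vol P" if P: "P \<in> S" for P
    proof -
      have "(LINT x:P|lebesgue. U P x) = (\<Sum>i\<in>UNIV. vol P * ((average P V *v e P i) \<bullet> e P i))"
        unfolding iU[OF S[OF P]] w_def by (intro sum.cong refl set_integral_matrix_form[OF V S[OF P]])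
      also have "\<dots> \<le> (\<Sum>i\<in>(UNIV :: 'd set). vol P * 1)"
      proof (intro sum_mono mult_left_mono)
        fix i
        have "(average P V *v e P i) \<bullet> e P i \<le> (norm (B P *v e P i))\<^sup>2" by (rule le[OF P])
        also have "\<dots> = 1" by (simp add: e_def SN[OF P] norm_axis_one)
        finally show "(average P V *v e P i) \<bullet> e P i \<le> 1" .
      qed simp
      finally show ?thesis by (simp add: mult.commute)
    qed
  qed (use A in auto)
  also have "(LINT x|lebesgue. (norm (f x))\<^sup>2) = (L2_norm f)\<^sup>2"
    unfolding L2_norm_def by (simp add: Bochner_Integration.integral_nonneg)
  finally show ?thesis by simp
qed

section \<open>The sparse bound on a finite tree\<close>

text \<open>
  Chebyshev's inequality over the maximal members, which are disjoint.
\<close>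

lemma measure_large_averages:
  fixes u :: "real ^ 'n \<Rightarrow> real"
  assumes fin: "finite \<U>" and lam: "laminar \<U>" and meas: "\<And>R. R \<in> \<U> \<Longrightarrow> R \<in> lmeasurable \<and> R \<subseteq> P"
    and P: "0 < vol P" and u: "set_integrable lebesgue P u" and u0: "\<And>x. 0 \<le> u x" and l: "0 < l"
    and large: "\<And>R. R \<in> \<U> \<Longrightarrow> l * ((LINT x:P|lebesgue. u x) / vol P) * vol R < (LINT x:R|lebesgue. u x)"
  shows "vol (\<Union>\<U>) \<le> vol P / l"
proof -
  define a where "a R = (LINT x:R|lebesgue. u x)" for R
  define \<M> where "\<M> = maximal_sets \<U>"
  have MU: "\<M> \<subseteq> \<U>" unfolding \<M>_def by (rule maximal_sets_subset)
  have finM: "finite \<M>" using MU fin by (rule finite_subset)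
  have M: "R \<in> \<U>" "R \<in> lmeasurable" "R \<in> sets lebesgue" "R \<subseteq> P" if "R \<in> \<M>" for R
    using meas MU that by (auto simp: fmeasurableD)
  have dis: "R \<inter> R' = {}" if "R \<in> \<M>" "R' \<in> \<M>" "R \<noteq> R'" for R R'
    using maximal_sets_disjoint[OF lam] that by (simp add: \<M>_def)
  have Un: "\<Union>\<U> = \<Union>\<M>"
  proof (intro equalityI Union_least)
    fix R assume "R \<in> \<U>"
    then obtain R' where "R' \<in> \<M>" "R \<subseteq> R'" using maximal_sets_above[OF fin] unfolding \<M>_def by metis
    then show "R \<subseteq> \<Union>\<M>" by auto
  qed (use MU in auto)
  have sum_a: "(\<Sum>R\<in>\<M>. a R) \<le> a P"
  proof -
    have "(\<Sum>R\<in>\<M>. a R) = a (\<Union>\<M>)"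
      unfolding a_def using M(4) by (intro set_integral_disjoint_Union[symmetric, OF finM dis M(3) u]) auto
    also have "\<dots> \<le> a P" unfolding a_def using M finM u0
      by (intro set_integral_mono_set[OF u] sets.finite_Union) auto
    finally show ?thesis .
  qed
  have a0: "0 \<le> a R" for R unfolding a_def by (rule set_integral_nonneg_pointwise[OF u0])
  have vU: "vol (\<Union>\<M>) = (\<Sum>R\<in>\<M>. vol R)" by (rule measure_disjoint_Union[OF finM dis M(2)])
  show ?thesis
  proof (cases "\<M> = {}")
    case True
    then show ?thesis using P l by (simp add: Un)
  next
    case False
    then obtain R0 where R0: "R0 \<in> \<M>" by auto
    have "0 < a P"
    proof -
      have "0 \<le> l * (a P / vol P) * vol R0" using l a0 P by simp
      also have "\<dots> < a R0" using large[OF M(1)[OF R0]] by (simp add: a_def)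
      also have "\<dots> \<le> (\<Sum>R\<in>\<M>. a R)" using R0 finM a0 by (intro member_le_sum) auto
      finally show ?thesis using sum_a by simp
    qed
    have "(l * (a P / vol P)) * (\<Sum>R\<in>\<M>. vol R) \<le> (\<Sum>R\<in>\<M>. a R)"
      unfolding sum_distrib_left using large M(1) by (intro sum_mono less_imp_le) (auto simp: a_def)
    also have "\<dots> \<le> a P" by (rule sum_a)
    finally show ?thesis using \<open>0 < a P\<close> P l unfolding Un vU by (simp add: field_simps)
  qed
qed

text \<open>
  Constant matrices commute with the scalars \<open>c R S\<close>.
\<close>

lemma block_form_factor:
  fixes S1 S2 :: "'k::real_or_complex ^ 'd ^ 'd"
  assumes S2: "\<And>v w. (S2 *v v) \<bullet> w = v \<bullet> (S2 *v w)"
    and F: "\<And>S. S \<in> \<C> \<Longrightarrow> set_integrable lebesgue S F" and G: "\<And>S. S \<in> \<C> \<Longrightarrow> set_integrable lebesgue S G"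
  shows "block_form (mat 1) \<C> c (\<lambda>x. S1 *v F x) (\<lambda>x. S2 *v G x) = block_form (S2 ** S1) \<C> c F G"
proof -
  have "(\<Sum>S\<in>\<C>. c R S *s (LINT x:S|lebesgue. S1 *v F x)) = S1 *v (\<Sum>S\<in>\<C>. c R S *s (LINT x:S|lebesgue. F x))" for R
    by (simp add: set_integral_bounded_linear[OF bounded_linear_matrix_vector_mult F]
        linear_sum[OF matrix_vector_mul_linear] vector_scalar_commute)
  then show ?thesis
    unfolding block_form_def
    by (intro sum.cong refl)
      (simp add: set_integral_bounded_linear[OF bounded_linear_matrix_vector_mult G] S2[symmetric]
        matrix_vector_mul_assoc[symmetric])
qed

context dyadic_grid
begin

lemma sparse_of_stopping:
  assumes fin: "finite S" and S: "\<And>R. R \<in> S \<Longrightarrow> R \<in> D" and P: "P \<in> S"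
    and Z: "Z \<in> sets lebesgue" "Z \<subseteq> P" "2 * vol Z \<le> vol P"
    and sub: "\<And>R. R \<in> S \<Longrightarrow> R \<subset> P \<Longrightarrow> R \<subseteq> Z"
  shows "vol P \<le> 2 * vol (core S P)"
proof -
  have PD: "P \<in> lmeasurable" using S[OF P] grid_lmeasurable by simp
  have Zl: "Z \<in> lmeasurable" by (rule fmeasurableI2[OF PD Z(2,1)])
  have "vol (P - Z) = vol P - vol Z" using PD Zl Z(2) by (simp add: measurable_measure_Diff fmeasurableD)
  moreover have "vol (P - Z) \<le> vol (core S P)"
  proof (rule measure_mono_fmeasurable)
    show "P - Z \<subseteq> core S P" using sub by (auto simp: core_def)
    show "P - Z \<in> sets lebesgue" using PD Z by (simp add: fmeasurableD sets.Diff)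
    have "core S P \<in> sets lebesgue" by (rule sets_core[OF fin _ P]) (intro subsetI grid_sets S)
    then show "core S P \<in> lmeasurable" by (rule fmeasurableI2[OF PD core_subset])
  qed
  ultimately show ?thesis using Z by simp
qed

text \<open>
  At every cube \<open>P\<close> the functions are normalized by \<open>N1 P\<close> and \<open>N2 P\<close>, approximate inverse square roots
  of the averages of \<open>V\<close> and \<open>W\<close>, and \<open>P\<close> stops where the averages of the normalized functions become
  large. The contributions of the regions of the stopping family are summed by Cauchy--Schwarz and the
  weighted embedding.
\<close>

lemma weighted_tree_estimate:
  fixes c :: "(real ^ 'n) set \<Rightarrow> (real ^ 'n) set \<Rightarrow> (real ^ 'n) set \<Rightarrow> 'k::real_or_complex"
    and V W :: "real ^ 'n \<Rightarrow> 'k ^ 'd ^ 'd"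
  assumes tree: "cube_tree \<F> \<I> ch M" and FD: "\<And>Q. Q \<in> \<F> \<Longrightarrow> Q \<in> D"
    and mean0: "\<And>Q S. Q \<in> \<I> \<Longrightarrow> S \<in> ch Q \<Longrightarrow> (\<Sum>R\<in>ch Q. vol R *\<^sub>R c Q R S) = 0"
    and bnd: "\<And>h. in_L2 h \<Longrightarrow>
      (\<Sum>Q\<in>\<I>. \<Sum>R\<in>ch Q. vol R * (norm (\<Sum>S\<in>ch Q. c Q R S * (LINT x:S|lebesgue. h x)))\<^sup>2)
        \<le> B\<^sup>2 * (LINT x|lebesgue. (norm (h x))\<^sup>2)"
    and B: "0 \<le> B" and V: "matrix_weight V" and W: "matrix_weight W"
    and f: "in_L2 f" and F: "in_L2 (\<lambda>x. matrix_sqrt (V x) *v f x)"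
    and g: "in_L2 g" and G: "in_L2 (\<lambda>x. matrix_sqrt (W x) *v g x)"
    and AV: "\<And>e. A_infinity D (\<lambda>x. (V x *v e) \<bullet> e) < ennreal AV" "0 < AV"
    and AW: "\<And>e. A_infinity D (\<lambda>x. (W x *v e) \<bullet> e) < ennreal AW" "0 < AW"
    and K: "\<And>Q. Q \<in> D \<Longrightarrow> (matrix_opnorm (matrix_sqrt (average Q W) ** matrix_sqrt (average Q V)))\<^sup>2 \<le> K"
    and \<eta>: "0 < \<eta>"
  shows "(\<Sum>Q\<in>\<I>. \<bar>block_form (mat 1) (ch Q) (c Q) (\<lambda>x. matrix_sqrt (V x) *v f x) (\<lambda>x. matrix_sqrt (W x) *v g x)\<bar>)
    \<le> 32 * real CARD('d) * B * M\<^sup>2 * sqrt ((K + \<eta>) * (4 * AV + 1) * (4 * AW + 1)) * L2_norm f * L2_norm g"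
proof -
  interpret cube_tree \<F> \<I> ch M by (rule tree)
  define good where "good P X \<longleftrightarrow> (case X of (S1, N1, S2, N2) \<Rightarrow>
    (\<forall>v w. (N1 *v v) \<bullet> w = v \<bullet> (N1 *v w)) \<and> (\<forall>v. S1 *v (N1 *v v) = v) \<and>
    (\<forall>v. (average P V *v v) \<bullet> v \<le> (norm (S1 *v v))\<^sup>2) \<and>
    (\<forall>v w. (N2 *v v) \<bullet> w = v \<bullet> (N2 *v w)) \<and> (\<forall>v. S2 *v (N2 *v v) = v) \<and>
    (\<forall>v. (average P W *v v) \<bullet> v \<le> (norm (S2 *v v))\<^sup>2) \<and>
    (\<forall>v w. (S2 *v v) \<bullet> w = v \<bullet> (S2 *v w)) \<and> (\<forall>v. norm (S2 *v (S1 *v v)) \<le> sqrt (K + \<eta>) * norm v))"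
    for P and X :: "('k ^ 'd ^ 'd) \<times> ('k ^ 'd ^ 'd) \<times> ('k ^ 'd ^ 'd) \<times> ('k ^ 'd ^ 'd)"
  have "\<forall>P\<in>D. \<exists>X. good P X"
  proof
    fix P assume P: "P \<in> D"
    show "\<exists>X. good P X"
    proof (rule normalizers[OF positive_semidefinite_average[OF V P]
          positive_semidefinite_average[OF W P] K[OF P] \<eta>])
      fix S1 N1 S2 N2 :: "'k ^ 'd ^ 'd"
      assume "\<And>v w. (N1 *v v) \<bullet> w = v \<bullet> (N1 *v w)" "\<And>v. S1 *v (N1 *v v) = v"
        "\<And>v. (average P V *v v) \<bullet> v \<le> (norm (S1 *v v))\<^sup>2"
        "\<And>v w. (N2 *v v) \<bullet> w = v \<bullet> (N2 *v w)" "\<And>v. S2 *v (N2 *v v) = v"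
        "\<And>v. (average P W *v v) \<bullet> v \<le> (norm (S2 *v v))\<^sup>2"
        "\<And>v w. (S2 *v v) \<bullet> w = v \<bullet> (S2 *v w)" "\<And>v. norm (S2 *v (S1 *v v)) \<le> sqrt (K + \<eta>) * norm v"
      then have "good P (S1, N1, S2, N2)" by (simp add: good_def)
      then show ?thesis ..
    qed
  qed
  then obtain X where X: "\<forall>P\<in>D. good P (X P)" using bchoice[of D good] by auto
  define S1 N1 S2 N2 where "S1 P = fst (X P)" and "N1 P = fst (snd (X P))"
    and "S2 P = fst (snd (snd (X P)))" and "N2 P = snd (snd (snd (X P)))" for P
  have 1: "(N1 P *v v) \<bullet> w = v \<bullet> (N1 P *v w)" "S1 P *v (N1 P *v v) = v"
      "(average P V *v v) \<bullet> v \<le> (norm (S1 P *v v))\<^sup>2"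
      "(N2 P *v v) \<bullet> w = v \<bullet> (N2 P *v w)" "S2 P *v (N2 P *v v) = v"
      "(average P W *v v) \<bullet> v \<le> (norm (S2 P *v v))\<^sup>2"
      "(S2 P *v v) \<bullet> w = v \<bullet> (S2 P *v w)" "norm (S2 P *v (S1 P *v v)) \<le> sqrt (K + \<eta>) * norm v"
    if "P \<in> D" for P v w
  proof -
    have "good P (S1 P, N1 P, S2 P, N2 P)"
      using X[rule_format, OF that] by (simp add: S1_def S2_def N1_def N2_def)
    note good1 = this[unfolded good_def prod.case]
    note good2 = good1[THEN conjunct2]
    note good3 = good2[THEN conjunct2]
    note good4 = good3[THEN conjunct2]
    note good5 = good4[THEN conjunct2]
    note good6 = good5[THEN conjunct2]
    note good7 = good6[THEN conjunct2]
    note good8 = good7[THEN conjunct2]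
    show "(N1 P *v v) \<bullet> w = v \<bullet> (N1 P *v w)" by (rule good1[THEN conjunct1, rule_format])
    show "S1 P *v (N1 P *v v) = v" by (rule good2[THEN conjunct1, rule_format])
    show "(average P V *v v) \<bullet> v \<le> (norm (S1 P *v v))\<^sup>2" by (rule good3[THEN conjunct1, rule_format])
    show "(N2 P *v v) \<bullet> w = v \<bullet> (N2 P *v w)" by (rule good4[THEN conjunct1, rule_format])
    show "S2 P *v (N2 P *v v) = v" by (rule good5[THEN conjunct1, rule_format])
    show "(average P W *v v) \<bullet> v \<le> (norm (S2 P *v v))\<^sup>2" by (rule good6[THEN conjunct1, rule_format])
    show "(S2 P *v v) \<bullet> w = v \<bullet> (S2 P *v w)" by (rule good7[THEN conjunct1, rule_format])
    show "norm (S2 P *v (S1 P *v v)) \<le> sqrt (K + \<eta>) * norm v" by (rule good8[rule_format])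
  qed
  define F' G' where "F' x = matrix_sqrt (V x) *v f x" and "G' x = matrix_sqrt (W x) *v g x" for x
  have iF: "set_integrable lebesgue Q F'" and iG: "set_integrable lebesgue Q G'" if "Q \<in> D" for Q
    unfolding F'_def G'_def
    by (rule in_L2_set_integrable[OF F grid_lmeasurable[OF that]],
        rule in_L2_set_integrable[OF G grid_lmeasurable[OF that]])
  have iNF: "set_integrable lebesgue Q (\<lambda>x. N1 P *v F' x)" and iNG: "set_integrable lebesgue Q (\<lambda>x. N2 P *v G' x)"
    if "Q \<in> D" for P Q
    by (rule set_integrable_bounded_linear[OF bounded_linear_matrix_vector_mult iF[OF that]],
        rule set_integrable_bounded_linear[OF bounded_linear_matrix_vector_mult iG[OF that]])
  define a where "a P Q = (LINT x:Q|lebesgue. norm (N1 P *v F' x))" for P Q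
  define b where "b P Q = (LINT x:Q|lebesgue. norm (N2 P *v G' x))" for P Q
  have ab0: "0 \<le> a P Q" "0 \<le> b P Q" for P Q
    unfolding a_def b_def by (simp_all add: set_integral_nonneg_pointwise)
  \<comment> \<open>The factor \<open>4\<close> makes either kind of stopping cube fill at most a quarter of \<open>P\<close>, hence both together at most half.\<close>
  define \<B>1 where "\<B>1 P = {R \<in> \<F>. R \<subset> P \<and> 4 * (a P P / vol P) * vol R < a P R}" for P
  define \<B>2 where "\<B>2 P = {R \<in> \<F>. R \<subset> P \<and> 4 * (b P P / vol P) * vol R < b P R}" for P
  define \<B> where "\<B> P = \<B>1 P \<union> \<B>2 P" for P
  have \<B>: "R \<in> \<F> \<and> R \<subset> P" if "R \<in> \<B> P" for P R
    using that by (auto simp: \<B>_def \<B>1_def \<B>2_def)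
  obtain S where SF: "S \<subseteq> \<F>"
    and cover: "\<And>Q. Q \<in> \<F> \<Longrightarrow> \<exists>P\<in>S. Q \<subseteq> P \<and> (\<forall>R\<in>\<B> P. \<not> Q \<subseteq> R)"
    and below: "\<And>P R. P \<in> S \<Longrightarrow> R \<in> S \<Longrightarrow> R \<subset> P \<Longrightarrow> \<exists>B\<in>\<B> P. R \<subseteq> B"
    using stopping_family[OF finite_tree laminar_tree \<B>] by metis
  have finS: "finite S" using SF finite_tree by (rule finite_subset)
  have S: "P \<in> \<F>" "P \<in> D" if "P \<in> S" for P using SF FD that by auto
  have half: "vol (\<Union>(\<B>1 P)) \<le> vol P / 4" "vol (\<Union>(\<B>2 P)) \<le> vol P / 4" if P: "P \<in> S" for P
  proof -
    have sub: "\<B>1 P \<subseteq> \<F>" "\<B>2 P \<subseteq> \<F>" by (auto simp: \<B>1_def \<B>2_def)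
    have vP: "0 < vol P" using grid_measure_pos S(2)[OF P] by simp
    show "vol (\<Union>(\<B>1 P)) \<le> vol P / 4"
      by (rule measure_large_averages[OF finite_subset[OF sub(1) finite_tree] laminar_subset[OF laminar_tree sub(1)] _ vP
            set_integrable_norm[OF iNF[OF S(2)[OF P], of P]]])
        (auto simp: \<B>1_def a_def lmeasurable_tree)
    show "vol (\<Union>(\<B>2 P)) \<le> vol P / 4"
      by (rule measure_large_averages[OF finite_subset[OF sub(2) finite_tree] laminar_subset[OF laminar_tree sub(2)] _ vP
            set_integrable_norm[OF iNG[OF S(2)[OF P], of P]]])
        (auto simp: \<B>2_def b_def lmeasurable_tree)
  qed
  have sparse: "vol P \<le> 2 * vol (core S P)" if P: "P \<in> S" for P
  proof (rule sparse_of_stopping[OF finS S(2) P])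
    have fin: "finite (\<B>1 P)" "finite (\<B>2 P)" using finite_tree by (auto simp: \<B>1_def \<B>2_def)
    have m: "\<Union>(\<B>1 P) \<in> lmeasurable" "\<Union>(\<B>2 P) \<in> lmeasurable"
      using fin lmeasurable_tree by (intro fmeasurable.finite_Union; auto simp: \<B>1_def \<B>2_def)+
    show "\<Union>(\<B>1 P) \<union> \<Union>(\<B>2 P) \<in> sets lebesgue" using m by (intro sets.Un fmeasurableD)
    show "\<Union>(\<B>1 P) \<union> \<Union>(\<B>2 P) \<subseteq> P" by (auto simp: \<B>1_def \<B>2_def)
    show "2 * vol (\<Union>(\<B>1 P) \<union> \<Union>(\<B>2 P)) \<le> vol P"
      using measure_Un_le[of "\<Union>(\<B>1 P)" lebesgue "\<Union>(\<B>2 P)"] m half[OF P] by (auto simp: fmeasurableD)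
    show "R \<subseteq> \<Union>(\<B>1 P) \<union> \<Union>(\<B>2 P)" if R: "R \<in> S" "R \<subset> P" for R
    proof -
      obtain B where "B \<in> \<B> P" "R \<subseteq> B" using below[OF P R] by auto
      then show ?thesis by (auto simp: \<B>_def)
    qed
  qed
  define t where "t Q = \<bar>block_form (mat 1) (ch Q) (c Q) F' G'\<bar>" for Q
  \<comment> \<open>Here \<open>4 (a P P / |P|)\<close> and \<open>4 (b P P / |P|)\<close> bound the averages over all cubes that are not inside a stopping cube.\<close>
  have local: "(\<Sum>Q\<in>region P (\<B> P). t Q) \<le> sqrt (K + \<eta>) * B * M\<^sup>2 * (4 * (a P P / vol P)) * (4 * (b P P / vol P)) * vol P"
    if P: "P \<in> S" for P
  proof -
    have PD: "P \<in> D" and vP: "0 < vol P" using S[OF P] grid_measure_pos by auto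
    have "(\<Sum>Q\<in>region P (\<B> P). t Q) =
      (\<Sum>Q\<in>region P (\<B> P). \<bar>block_form (S2 P ** S1 P) (ch Q) (c Q) (\<lambda>x. N1 P *v F' x) (\<lambda>x. N2 P *v G' x)\<bar>)"
    proof (rule sum.cong[OF refl])
      fix Q assume "Q \<in> region P (\<B> P)"
      then have QI: "Q \<in> \<I>" by (simp add: region_def)
      have "set_integrable lebesgue R (\<lambda>x. N1 P *v F' x)" "set_integrable lebesgue R (\<lambda>x. N2 P *v G' x)" if "R \<in> ch Q" for R
        by (intro iNF iNG FD ch_tree[OF QI that])+
      from block_form_factor[OF 1(7)[OF PD] this, of "ch Q" "c Q" "S1 P"]
      show "t Q = \<bar>block_form (S2 P ** S1 P) (ch Q) (c Q) (\<lambda>x. N1 P *v F' x) (\<lambda>x. N2 P *v G' x)\<bar>"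
        unfolding t_def by (simp add: 1(2)[OF PD] 1(5)[OF PD])
    qed
    also have "\<dots> \<le> sqrt (K + \<eta>) * B * M\<^sup>2 * (4 * (a P P / vol P)) * (4 * (b P P / vol P)) * vol P"
    proof (rule region_estimate[OF mean0 bnd B _ _ S(1)[OF P] \<B> iNF[OF PD] iNG[OF PD]])
      show "norm ((S2 P ** S1 P) *v v) \<le> sqrt (K + \<eta>) * norm v" for v
        using 1(8)[OF PD] by (simp add: matrix_vector_mul_assoc)
      show "0 \<le> sqrt (K + \<eta>)" using order_trans[OF zero_le_power2 K[OF PD]] \<eta> by simp
      fix Q assume Q: "Q \<in> \<F>" "Q \<subseteq> P" "\<forall>R\<in>\<B> P. \<not> Q \<subseteq> R"
      have "Q \<notin> \<B>1 P" "Q \<notin> \<B>2 P" using Q(3) by (auto simp: \<B>_def)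
      then have "Q = P \<or> a P Q \<le> 4 * (a P P / vol P) * vol Q" "Q = P \<or> b P Q \<le> 4 * (b P P / vol P) * vol Q"
        using Q by (auto simp: \<B>1_def \<B>2_def)
      moreover have "a P P \<le> 4 * (a P P / vol P) * vol P" "b P P \<le> 4 * (b P P / vol P) * vol P"
        using vP ab0 by simp_all
      ultimately show "(LINT x:Q|lebesgue. norm (N1 P *v F' x)) \<le> 4 * (a P P / vol P) * vol Q"
        "(LINT x:Q|lebesgue. norm (N2 P *v G' x)) \<le> 4 * (b P P / vol P) * vol Q"
        unfolding a_def b_def by auto
    qed (use ab0 vP in auto)
    finally show ?thesis .
  qed
  have K0: "0 \<le> K"
  proof -
    obtain Q where "Q \<in> D" using cube_mem by auto
    then show ?thesis using order_trans[OF zero_le_power2 K] by auto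
  qed
  have finI: "finite \<I>" by (rule finite_internal)
  have "(\<Sum>Q\<in>\<I>. t Q) \<le> (\<Sum>Q\<in>\<I>. \<Sum>P | P \<in> S \<and> Q \<in> region P (\<B> P). t Q)"
  proof (rule sum_mono)
    fix Q assume QI: "Q \<in> \<I>"
    then obtain P where P: "P \<in> S" "Q \<in> region P (\<B> P)"
      using cover[OF internal_tree[OF QI]] by (auto simp: region_def)
    have "t Q \<le> (\<Sum>P\<in>{P}. t Q)" by simp
    also have "\<dots> \<le> (\<Sum>P | P \<in> S \<and> Q \<in> region P (\<B> P). t Q)"
      using P finS by (intro sum_mono2) (auto simp: t_def)
    finally show "t Q \<le> (\<Sum>P | P \<in> S \<and> Q \<in> region P (\<B> P). t Q)" .
  qed
  also have "\<dots> = (\<Sum>P\<in>S. \<Sum>Q | Q \<in> \<I> \<and> Q \<in> region P (\<B> P). t Q)"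
    by (rule sum.swap_restrict[OF finI finS])
  also have "\<dots> = (\<Sum>P\<in>S. \<Sum>Q\<in>region P (\<B> P). t Q)"
    by (intro sum.cong refl) (auto simp: region_def)
  also have "\<dots> \<le> (\<Sum>P\<in>S. (16 * sqrt (K + \<eta>) * B * M\<^sup>2) * (\<bar>a P P / sqrt (vol P)\<bar> * \<bar>b P P / sqrt (vol P)\<bar>))"
  proof (rule sum_mono)
    fix P assume P: "P \<in> S"
    have vP: "0 < vol P" using S[OF P] grid_measure_pos by auto
    have "\<bar>a P P / sqrt (vol P)\<bar> * \<bar>b P P / sqrt (vol P)\<bar> = a P P * b P P / vol P"
      using ab0 vP by simp
    then show "(\<Sum>Q\<in>region P (\<B> P). t Q) \<le>
      (16 * sqrt (K + \<eta>) * B * M\<^sup>2) * (\<bar>a P P / sqrt (vol P)\<bar> * \<bar>b P P / sqrt (vol P)\<bar>)"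
      using local[OF P] vP by (simp add: field_simps)
  qed
  also have "\<dots> \<le> (16 * sqrt (K + \<eta>) * B * M\<^sup>2) *
      (L2_set (\<lambda>P. a P P / sqrt (vol P)) S * L2_set (\<lambda>P. b P P / sqrt (vol P)) S)"
    unfolding sum_distrib_left[symmetric] using K0 \<eta> B
    by (intro mult_left_mono L2_set_mult_ineq) auto
  also have "\<dots> \<le> (16 * sqrt (K + \<eta>) * B * M\<^sup>2) *
      (sqrt (2 * real CARD('d) * (4 * AV + 1) * (L2_norm f)\<^sup>2) * sqrt (2 * real CARD('d) * (4 * AW + 1) * (L2_norm g)\<^sup>2))"
  proof (intro mult_left_mono mult_mono)
    have sq: "(x / sqrt (vol P))\<^sup>2 = x\<^sup>2 / vol P" for x P by (simp add: power_divide)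
    have "(\<Sum>P\<in>S. (a P P)\<^sup>2 / vol P) \<le> 2 * real CARD('d) * (4 * AV + 1) * (L2_norm f)\<^sup>2"
      unfolding a_def F'_def
      by (rule weighted_carleson_embedding[OF finS S(2) sparse V f F AV, of N1 S1]) (use S 1 in auto)
    then show "L2_set (\<lambda>P. a P P / sqrt (vol P)) S \<le> sqrt (2 * real CARD('d) * (4 * AV + 1) * (L2_norm f)\<^sup>2)"
      unfolding L2_set_def sq by (rule real_sqrt_le_mono)
    have "(\<Sum>P\<in>S. (b P P)\<^sup>2 / vol P) \<le> 2 * real CARD('d) * (4 * AW + 1) * (L2_norm g)\<^sup>2"
      unfolding b_def G'_def
      by (rule weighted_carleson_embedding[OF finS S(2) sparse W g G AW, of N2 S2]) (use S 1 in auto)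
    then show "L2_set (\<lambda>P. b P P / sqrt (vol P)) S \<le> sqrt (2 * real CARD('d) * (4 * AW + 1) * (L2_norm g)\<^sup>2)"
      unfolding L2_set_def sq by (rule real_sqrt_le_mono)
  qed (use K0 \<eta> B AV AW in \<open>auto simp: L2_set_nonneg\<close>)
  also have "\<dots> = 32 * real CARD('d) * B * M\<^sup>2 * sqrt ((K + \<eta>) * (4 * AV + 1) * (4 * AW + 1)) * L2_norm f * L2_norm g"
    unfolding real_sqrt_mult by (simp add: L2_norm_def mult_ac Bochner_Integration.integral_nonneg)
  finally show ?thesis by (simp add: t_def F'_def[abs_def] G'_def[abs_def])
qed

end

section \<open>Square integrable functions\<close>

lemma integrable_norm_mult:
  fixes f :: "real ^ 'n \<Rightarrow> 'b::euclidean_space" and g :: "real ^ 'n \<Rightarrow> 'c::euclidean_space"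
  assumes "in_L2 f" "in_L2 g"
  shows "integrable lebesgue (\<lambda>x. norm (f x) * norm (g x))"
proof (rule Bochner_Integration.integrable_bound)
  show "integrable lebesgue (\<lambda>x. (norm (f x))\<^sup>2 + (norm (g x))\<^sup>2)" using assms by (simp add: in_L2_def)
  show "(\<lambda>x. norm (f x) * norm (g x)) \<in> borel_measurable lebesgue"
    using assms by (intro borel_measurable_times borel_measurable_norm) (auto simp: in_L2_def)
  have "norm (f x) * norm (g x) \<le> (norm (f x))\<^sup>2 + (norm (g x))\<^sup>2" for x
    using sum_squares_bound[of "norm (f x)" "norm (g x)"] mult_nonneg_nonneg[of "norm (f x)" "norm (g x)"]
    by (simp del: mult_nonneg_nonneg)
  then show "AE x in lebesgue. norm (norm (f x) * norm (g x)) \<le> norm ((norm (f x))\<^sup>2 + (norm (g x))\<^sup>2)"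
    by (simp add: abs_mult)
qed

lemma L2_norm_nonneg: "0 \<le> L2_norm f"
  by (simp add: L2_norm_def)

lemma L2_norm_sq: "(L2_norm f)\<^sup>2 = (LINT x|lebesgue. (norm (f x))\<^sup>2)"
  by (simp add: L2_norm_def Bochner_Integration.integral_nonneg)

lemma L2_cauchy_schwarz:
  fixes f :: "real ^ 'n \<Rightarrow> 'b::euclidean_space" and g :: "real ^ 'n \<Rightarrow> 'c::euclidean_space"
  assumes f: "in_L2 f" and g: "in_L2 g"
  shows "(LINT x|lebesgue. norm (f x) * norm (g x)) \<le> L2_norm f * L2_norm g"
proof (rule power2_le_imp_le)
  have i: "integrable lebesgue (\<lambda>x. norm (f x) * norm (g x))" using integrable_norm_mult[OF f g] .
  have i2: "integrable lebesgue (\<lambda>x. (norm (f x))\<^sup>2)" "integrable lebesgue (\<lambda>x. (norm (g x))\<^sup>2)"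
    using f g by (auto simp: in_L2_def)
  have "(LINT x|lebesgue. norm (f x) * norm (g x))\<^sup>2 \<le> (LINT x|lebesgue. (norm (f x))\<^sup>2) * (LINT x|lebesgue. (norm (g x))\<^sup>2)"
  proof (rule square_le_of_weighted_means)
    fix t :: real assume t: "t > 0"
    have "2 * (norm (f x) * norm (g x)) \<le> t * (norm (f x))\<^sup>2 + (norm (g x))\<^sup>2 / t" for x
    proof -
      have "2 * (sqrt t * norm (f x)) * (norm (g x) / sqrt t) \<le> (sqrt t * norm (f x))\<^sup>2 + (norm (g x) / sqrt t)\<^sup>2"
        by (rule sum_squares_bound)
      then show ?thesis using t by (simp add: power_mult_distrib power_divide)
    qed
    then have "(LINT x|lebesgue. 2 * (norm (f x) * norm (g x))) \<le> (LINT x|lebesgue. t * (norm (f x))\<^sup>2 + (norm (g x))\<^sup>2 / t)"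
      using i i2 by (intro integral_mono) auto
    then show "2 * (LINT x|lebesgue. norm (f x) * norm (g x)) \<le> t * (LINT x|lebesgue. (norm (f x))\<^sup>2) + (LINT x|lebesgue. (norm (g x))\<^sup>2) / t"
      using i i2 by simp
  qed (auto intro!: Bochner_Integration.integral_nonneg)
  then show "(LINT x|lebesgue. norm (f x) * norm (g x))\<^sup>2 \<le> (L2_norm f * L2_norm g)\<^sup>2"
    by (simp add: power_mult_distrib L2_norm_sq)
qed (simp add: L2_norm_nonneg)

lemma L2_inner:
  fixes f g :: "real ^ 'n \<Rightarrow> 'b::euclidean_space"
  assumes f: "in_L2 f" and g: "in_L2 g"
  shows "integrable lebesgue (\<lambda>x. f x \<bullet> g x)" and "\<bar>LINT x|lebesgue. f x \<bullet> g x\<bar> \<le> L2_norm f * L2_norm g"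
proof -
  have m: "f \<in> borel_measurable lebesgue" "g \<in> borel_measurable lebesgue" using f g by (auto simp: in_L2_def)
  have "\<bar>f x \<bullet> g x\<bar> \<le> norm (f x) * norm (g x)" for x by (rule Cauchy_Schwarz_ineq2)
  then show i: "integrable lebesgue (\<lambda>x. f x \<bullet> g x)"
    by (intro Bochner_Integration.integrable_bound[OF integrable_norm_mult[OF f g]] borel_measurable_inner m) (simp add: abs_mult)
  have "\<bar>LINT x|lebesgue. f x \<bullet> g x\<bar> \<le> (LINT x|lebesgue. \<bar>f x \<bullet> g x\<bar>)" by (rule integral_abs_bound)
  also have "\<dots> \<le> (LINT x|lebesgue. norm (f x) * norm (g x))"
    by (intro integral_mono integrable_abs i integrable_norm_mult f g Cauchy_Schwarz_ineq2)
  also have "\<dots> \<le> L2_norm f * L2_norm g" by (rule L2_cauchy_schwarz[OF f g])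
  finally show "\<bar>LINT x|lebesgue. f x \<bullet> g x\<bar> \<le> L2_norm f * L2_norm g" .
qed

lemma in_L2_scaleR:
  fixes f :: "real ^ 'n \<Rightarrow> 'b::euclidean_space"
  shows "in_L2 f \<Longrightarrow> in_L2 (\<lambda>x. c *\<^sub>R f x)"
  unfolding in_L2_def by (auto simp: power_mult_distrib)

lemma in_L2_add:
  fixes f g :: "real ^ 'n \<Rightarrow> 'b::euclidean_space"
  assumes "in_L2 f" "in_L2 g"
  shows "in_L2 (\<lambda>x. f x + g x)"
  unfolding in_L2_def
proof
  have "(norm (f x + g x))\<^sup>2 = (norm (f x))\<^sup>2 + 2 * (f x \<bullet> g x) + (norm (g x))\<^sup>2" for x
    by (simp add: power2_norm_eq_inner inner_simps inner_commute)
  then show "integrable lebesgue (\<lambda>x. (norm (f x + g x))\<^sup>2)"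
    using assms L2_inner(1)[OF assms] by (simp add: in_L2_def)
qed (use assms in \<open>auto simp: in_L2_def\<close>)

lemma in_L2_diff:
  fixes f g :: "real ^ 'n \<Rightarrow> 'b::euclidean_space"
  shows "in_L2 f \<Longrightarrow> in_L2 g \<Longrightarrow> in_L2 (\<lambda>x. f x - g x)"
  using in_L2_add[of f "\<lambda>x. (- 1) *\<^sub>R g x"] in_L2_scaleR[of g "- 1"] by simp

lemma in_L2_sum:
  fixes f :: "'i \<Rightarrow> real ^ 'n \<Rightarrow> 'b::euclidean_space"
  shows "(\<And>i. i \<in> I \<Longrightarrow> in_L2 (f i)) \<Longrightarrow> in_L2 (\<lambda>x. \<Sum>i\<in>I. f i x)"
proof (induction I rule: infinite_finite_induct)
  case (insert i I)
  have "in_L2 (\<lambda>x. f i x + (\<Sum>i\<in>I. f i x))" by (intro in_L2_add insert) (auto intro: insert.prems)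
  then show ?case using insert.hyps by simp
qed (auto simp: in_L2_def)

lemma L2_norm_triangle:
  fixes f g :: "real ^ 'n \<Rightarrow> 'b::euclidean_space"
  assumes f: "in_L2 f" and g: "in_L2 g"
  shows "L2_norm (\<lambda>x. f x + g x) \<le> L2_norm f + L2_norm g"
proof (rule power2_le_imp_le)
  have i: "integrable lebesgue (\<lambda>x. (norm (f x))\<^sup>2)" "integrable lebesgue (\<lambda>x. (norm (g x))\<^sup>2)"
    "integrable lebesgue (\<lambda>x. f x \<bullet> g x)"
    using f g L2_inner(1)[OF f g] by (auto simp: in_L2_def)
  have "(norm (f x + g x))\<^sup>2 = (norm (f x))\<^sup>2 + 2 * (f x \<bullet> g x) + (norm (g x))\<^sup>2" for x
    by (simp add: power2_norm_eq_inner inner_simps inner_commute)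
  then have "(L2_norm (\<lambda>x. f x + g x))\<^sup>2 = (L2_norm f)\<^sup>2 + 2 * (LINT x|lebesgue. f x \<bullet> g x) + (L2_norm g)\<^sup>2"
    unfolding L2_norm_sq using i by simp
  also have "\<dots> \<le> (L2_norm f + L2_norm g)\<^sup>2"
    using L2_inner(2)[OF f g] by (simp add: power2_sum)
  finally show "(L2_norm (\<lambda>x. f x + g x))\<^sup>2 \<le> (L2_norm f + L2_norm g)\<^sup>2" .
qed (simp add: L2_norm_nonneg)

lemma L2_norm_sum_orthogonal:
  fixes p :: "'i \<Rightarrow> real ^ 'n \<Rightarrow> 'b::euclidean_space"
  assumes fin: "finite I" and L: "\<And>i. i \<in> I \<Longrightarrow> in_L2 (p i)"
    and orth: "\<And>i j. i \<in> I \<Longrightarrow> j \<in> I \<Longrightarrow> i \<noteq> j \<Longrightarrow> (LINT x|lebesgue. p i x \<bullet> p j x) = 0"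
  shows "(L2_norm (\<lambda>x. \<Sum>i\<in>I. p i x))\<^sup>2 = (\<Sum>i\<in>I. (L2_norm (p i))\<^sup>2)"
proof -
  have i: "integrable lebesgue (\<lambda>x. p i x \<bullet> p j x)" if "i \<in> I" "j \<in> I" for i j
    using L2_inner(1) L that by blast
  have "(L2_norm (\<lambda>x. \<Sum>i\<in>I. p i x))\<^sup>2 = (LINT x|lebesgue. (\<Sum>i\<in>I. \<Sum>j\<in>I. p i x \<bullet> p j x))"
  proof -
    have "(\<Sum>i\<in>I. p i x) \<bullet> (\<Sum>i\<in>I. p i x) = (\<Sum>i\<in>I. \<Sum>j\<in>I. p i x \<bullet> p j x)" for x
      by (subst inner_sum_left) (simp add: inner_sum_right)
    then show ?thesis unfolding L2_norm_sq power2_norm_eq_inner by simp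
  qed
  also have "\<dots> = (\<Sum>i\<in>I. LINT x|lebesgue. (\<Sum>j\<in>I. p i x \<bullet> p j x))"
    by (intro Bochner_Integration.integral_sum Bochner_Integration.integrable_sum i)
  also have "\<dots> = (\<Sum>i\<in>I. \<Sum>j\<in>I. LINT x|lebesgue. p i x \<bullet> p j x)"
    by (intro sum.cong refl Bochner_Integration.integral_sum i)
  also have "\<dots> = (\<Sum>i\<in>I. \<Sum>j\<in>I. if j = i then (L2_norm (p i))\<^sup>2 else 0)"
    by (intro sum.cong refl) (auto simp: orth L2_norm_sq power2_norm_eq_inner)
  also have "\<dots> = (\<Sum>i\<in>I. (L2_norm (p i))\<^sup>2)" using fin by simp
  finally show ?thesis .
qed

lemma set_integral_norm_sq_le:
  fixes h :: "real ^ 'n \<Rightarrow> 'b::euclidean_space"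
  assumes h: "in_L2 h" and L: "L \<in> lmeasurable"
  shows "(norm (LINT x:L|lebesgue. h x))\<^sup>2 \<le> vol L * (LINT x:L|lebesgue. (norm (h x))\<^sup>2)"
proof -
  have Ls: "L \<in> sets lebesgue" using L by (simp add: fmeasurableD)
  have ih: "set_integrable lebesgue L (\<lambda>x. norm (h x))" by (intro set_integrable_norm in_L2_set_integrable h L)
  have ih2: "set_integrable lebesgue L (\<lambda>x. (norm (h x))\<^sup>2)"
    using h unfolding set_integrable_def in_L2_def by (intro integrable_mult_indicator[OF Ls]) simp
  have i1: "set_integrable lebesgue L (\<lambda>x. t :: real)" for t
    using L by (auto simp: set_integrable_def fmeasurable_def intro!: integrable_real_mult_indicator integrable_real_indicator integrable_mult_left)
  have "(LINT x:L|lebesgue. norm (h x))\<^sup>2 \<le> vol L * (LINT x:L|lebesgue. (norm (h x))\<^sup>2)"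
  proof (rule square_le_of_weighted_means)
    fix t :: real assume t: "t > 0"
    have "2 * norm (h x) \<le> t + (1 / t) * (norm (h x))\<^sup>2" for x
    proof -
      have "2 * sqrt t * (norm (h x) / sqrt t) \<le> (sqrt t)\<^sup>2 + (norm (h x) / sqrt t)\<^sup>2"
        by (rule sum_squares_bound)
      then show ?thesis using t by (simp add: power_divide)
    qed
    then have "(LINT x:L|lebesgue. 2 * norm (h x)) \<le> (LINT x:L|lebesgue. t + (1 / t) * (norm (h x))\<^sup>2)"
      by (intro set_integral_mono set_integral_add set_integrable_mult_right) (use ih ih2 i1 in auto)
    also have "\<dots> = t * vol L + (1 / t) * (LINT x:L|lebesgue. (norm (h x))\<^sup>2)"
      by (subst set_integral_add(2)) (use ih2 i1 Ls in \<open>auto simp: set_lebesgue_integral_def\<close>)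
    finally show "2 * (LINT x:L|lebesgue. norm (h x)) \<le> t * vol L + (LINT x:L|lebesgue. (norm (h x))\<^sup>2) / t" by simp
  qed (auto intro!: set_integral_nonneg_pointwise)
  moreover have "(norm (LINT x:L|lebesgue. h x))\<^sup>2 \<le> (LINT x:L|lebesgue. norm (h x))\<^sup>2"
    by (intro power_mono norm_set_integral_le) simp
  ultimately show ?thesis by simp
qed

section \<open>Finite trees inside a dyadic lattice\<close>

context dyadic_grid
begin

definition tree_below :: "(real ^ 'n) set set \<Rightarrow> int \<Rightarrow> nat \<Rightarrow> nat \<Rightarrow> (real ^ 'n) set set" where
  "tree_below \<T> k s n = {R \<in> D. (\<exists>P\<in>\<T>. R \<subseteq> P) \<and> (\<exists>l\<le>n. gen R = k - int (s * l))}"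

definition inner_tree_below :: "(real ^ 'n) set set \<Rightarrow> int \<Rightarrow> nat \<Rightarrow> nat \<Rightarrow> (real ^ 'n) set set" where
  "inner_tree_below \<T> k s n = {R \<in> D. (\<exists>P\<in>\<T>. R \<subseteq> P) \<and> (\<exists>l<n. gen R = k - int (s * l))}"

lemma grid_nonempty: "Q \<in> D \<Longrightarrow> Q \<noteq> {}"
  using laminar_grid by (auto simp: laminar_def)

lemma cube_tree_below:
  assumes s: "0 < s" and fin: "finite \<T>" and T: "\<And>P. P \<in> \<T> \<Longrightarrow> P \<in> D \<and> gen P = k"
  shows "cube_tree (tree_below \<T> k s n) (inner_tree_below \<T> k s n) (descendants D s) (2 ^ (s * CARD('n)))"
proof
  let ?F = "tree_below \<T> k s n" and ?I = "inner_tree_below \<T> k s n"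
  have FD: "Q \<in> D" if "Q \<in> ?F" for Q using that by (simp add: tree_below_def)
  have ID: "Q \<in> D" if "Q \<in> ?I" for Q using that by (simp add: inner_tree_below_def)
  have "?F \<subseteq> (\<Union>P\<in>\<T>. \<Union>l\<le>n. descendants D (s * l) P)"
  proof
    fix R assume "R \<in> ?F"
    then obtain P l where R: "R \<in> D" "P \<in> \<T>" "R \<subseteq> P" "l \<le> n" "gen R = k - int (s * l)"
      by (auto simp: tree_below_def)
    have "R \<inter> P \<noteq> {}" using grid_nonempty[OF R(1)] R(3) by auto
    then have "R \<in> descendants D (s * l) P" using subset_imp_descendant T R by auto
    then show "R \<in> (\<Union>P\<in>\<T>. \<Union>l\<le>n. descendants D (s * l) P)" using R by auto
  qed
  moreover have "finite (\<Union>P\<in>\<T>. \<Union>l\<le>n. descendants D (s * l) P)"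
    using fin T finite_descendants by auto
  ultimately show "finite ?F" by (rule finite_subset)
  show "laminar ?F" by (rule laminar_subset[OF laminar_grid]) (auto simp: tree_below_def)
  show "Q \<in> lmeasurable" "0 < vol Q" if "Q \<in> ?F" for Q
    using FD[OF that] grid_lmeasurable grid_measure_pos by auto
  show "?I \<subseteq> ?F"
  proof
    fix Q assume "Q \<in> ?I"
    then obtain l where "Q \<in> D" "\<exists>P\<in>\<T>. Q \<subseteq> P" "l < n" "gen Q = k - int (s * l)"
      unfolding inner_tree_below_def by blast
    then show "Q \<in> ?F" unfolding tree_below_def mem_Collect_eq
      by (intro conjI exI[of _ l]) simp_all
  qed
  show "descendants D s Q \<subseteq> ?F" if Q: "Q \<in> ?I" for Q
  proof
    fix R assume R: "R \<in> descendants D s Q"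
    from Q obtain P l where "P \<in> \<T>" "Q \<subseteq> P" "l < n" "gen Q = k - int (s * l)"
      by (auto simp: inner_tree_below_def)
    moreover then have "gen R = k - int (s * Suc l)"
      using gen_descendants[OF ID[OF Q] R] by simp
    moreover have "R \<in> D" "R \<subseteq> Q" using R descendants_subset[OF R] descendants_subset_grid[of s Q] by auto
    ultimately show "R \<in> ?F" unfolding tree_below_def mem_Collect_eq
      by (intro conjI bexI[of _ P] exI[of _ "Suc l"]) auto
  qed
  show "\<Union>(descendants D s Q) = Q" if "Q \<in> ?I" for Q by (rule Union_descendants[OF ID[OF that]])
  show "R \<inter> R' = {}" if "Q \<in> ?I" "R \<in> descendants D s Q" "R' \<in> descendants D s Q" "R \<noteq> R'" for Q R R'
    by (rule descendants_disjoint[OF ID[OF that(1)] that(2-4)])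
  show "R \<subset> Q" if "Q \<in> ?I" "R \<in> descendants D s Q" for Q R
    using descendants_subset[OF that(2)] gen_descendants[OF ID[OF that(1)] that(2)] s by auto
  show "vol Q \<le> 2 ^ (s * CARD('n)) * vol R" if "Q \<in> ?I" "R \<in> descendants D s Q" for Q R
    using descendants_measure[OF that(2)] by simp
  show "\<exists>Q'\<in>descendants D s Q. R \<subseteq> Q'" if Q: "Q \<in> ?I" and R: "R \<in> ?F" "R \<subset> Q" for Q R
  proof -
    obtain l l' where l: "gen Q = k - int (s * l)" "gen R = k - int (s * l')"
      using Q R by (auto simp: tree_below_def inner_tree_below_def)
    have meet: "R \<inter> Q \<noteq> {}" using grid_nonempty[OF FD[OF R(1)]] R(2) by auto
    have "gen R \<noteq> gen Q" using gen_eq_imp_eq[OF ID[OF Q] FD[OF R(1)] meet] R(2) by auto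
    moreover have "gen R \<le> gen Q" using gen_mono[OF ID[OF Q] FD[OF R(1)]] R(2) by auto
    ultimately have "int (s * l) < int (s * l')" using l by linarith
    then have "l < l'" using s by simp
    then obtain m where m: "l' = Suc l + m" using less_iff_Suc_add by auto
    obtain Q' where Q': "Q' \<in> D" "R \<in> descendants D (s * m) Q'" using ancestor[OF FD[OF R(1)]] by auto
    have "gen Q' = gen Q - int s"
      using gen_descendants[OF Q'] l m by (simp add: algebra_simps)
    moreover have "Q' \<inter> Q \<noteq> {}" using meet descendants_subset[OF Q'(2)] by auto
    ultimately have "Q' \<in> descendants D s Q" by (rule subset_imp_descendant[OF ID[OF Q] Q'(1)])
    then show ?thesis using descendants_subset[OF Q'(2)] by auto
  qed
  show "R = L" if L: "L \<in> ?F" "L \<notin> ?I" and R: "R \<in> ?F" "R \<subseteq> L" for L R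
  proof -
    have gL: "gen L = k - int (s * n)"
      using L by (auto simp: tree_below_def inner_tree_below_def le_less)
    obtain l' where "l' \<le> n" "gen R = k - int (s * l')" using R by (auto simp: tree_below_def)
    moreover then have "int (s * l') \<le> int (s * n)" by (simp only: of_nat_le_iff mult_le_mono2)
    moreover have "gen R \<le> gen L" using gen_mono[OF FD[OF L(1)] FD[OF R(1)]] R(2) by auto
    ultimately have "gen R = gen L" using gL by linarith
    then show ?thesis using gen_eq_imp_eq[OF FD[OF L(1)] FD[OF R(1)]] R(2) grid_nonempty[OF FD[OF R(1)]] by auto
  qed
qed simp

text \<open>
  Ancestors in the largest occurring generation serve as the tops of the tree.
\<close>

lemma slice_in_tree:
  assumes s: "0 < s" and fin: "finite \<Q>" and Q: "\<And>Q. Q \<in> \<Q> \<Longrightarrow> Q \<in> D \<and> gen Q mod int s = j"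
  obtains \<T> k n where "finite \<T>" "\<And>P. P \<in> \<T> \<Longrightarrow> P \<in> D \<and> gen P = k" "\<Q> \<subseteq> inner_tree_below \<T> k s n"
proof (cases "\<Q> = {}")
  case True
  show ?thesis by (rule that[of "{}" 0 0]) (auto simp: True)
next
  case False
  define k m where "k = Max (gen ` \<Q>)" and "m = Min (gen ` \<Q>)"
  have km: "m \<le> gen Q" "gen Q \<le> k" if "Q \<in> \<Q>" for Q
    using fin that by (auto simp: k_def m_def)
  have "k \<in> gen ` \<Q>" unfolding k_def using fin False by (intro Max_in) auto
  then have kj: "k mod int s = j" using Q by auto
  define l where "l Q = nat ((k - gen Q) div int s)" for Q
  have l: "gen Q = k - int (s * l Q)" if "Q \<in> \<Q>" for Q
  proof -
    have "(k - gen Q) mod int s = 0"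
      using kj Q[OF that] by (simp add: mod_eq_dvd_iff[symmetric])
    then have "int s * ((k - gen Q) div int s) = k - gen Q" by auto
    moreover have "0 \<le> (k - gen Q) div int s" using km[OF that] s by (simp add: pos_imp_zdiv_nonneg_iff)
    ultimately show ?thesis by (simp add: l_def)
  qed
  have "\<forall>Q\<in>\<Q>. \<exists>P. P \<in> D \<and> Q \<in> descendants D (s * l Q) P" using ancestor Q by blast
  then obtain top where top: "\<forall>Q\<in>\<Q>. top Q \<in> D \<and> Q \<in> descendants D (s * l Q) (top Q)"
    by (auto dest!: bchoice)
  show ?thesis
  proof (rule that[of "top ` \<Q>" k "Suc (nat (k - m))"])
    show "finite (top ` \<Q>)" using fin by simp
    show "P \<in> D \<and> gen P = k" if P: "P \<in> top ` \<Q>" for P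
    proof -
      obtain Q where Q': "Q \<in> \<Q>" "P = top Q" using P by auto
      have P: "P \<in> D" "Q \<in> descendants D (s * l Q) P" using top Q' by auto
      show ?thesis using gen_descendants[OF P] l[OF Q'(1)] P by simp
    qed
    show "\<Q> \<subseteq> inner_tree_below (top ` \<Q>) k s (Suc (nat (k - m)))"
    proof
      fix Q assume Q': "Q \<in> \<Q>"
      have "Q \<subseteq> top Q" using top Q' descendants_subset by blast
      moreover have "int (l Q) \<le> k - m"
      proof -
        have "int (l Q) \<le> int (s * l Q)" using s by (simp only: of_nat_le_iff) simp
        then show ?thesis using l[OF Q'] km[OF Q'] by linarith
      qed
      ultimately show "Q \<in> inner_tree_below (top ` \<Q>) k s (Suc (nat (k - m)))"
        using Q Q' l[OF Q'] unfolding inner_tree_below_def by (auto intro!: exI[of _ "l Q"])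
    qed
  qed
qed

end

section \<open>Operators given by blocks\<close>

lemma L2_operator_sum_cong:
  fixes D :: "(real ^ 'n) set set"
    and T :: "(real ^ 'n \<Rightarrow> 'k::real_or_complex) \<Rightarrow> real ^ 'n \<Rightarrow> 'k"
  assumes "\<And>Q f x. Q \<in> D \<Longrightarrow> in_L2 f \<Longrightarrow> T1 Q f x = T2 Q f x" "L2_operator_sum D T1 T"
  shows "L2_operator_sum D T2 T"
  unfolding L2_operator_sum_def
proof (intro allI impI)
  fix f :: "real ^ 'n \<Rightarrow> 'k" assume f: "in_L2 f"
  have "eventually (\<lambda>F. L2_norm (\<lambda>x. T f x - (\<Sum>Q\<in>F. T1 Q f x)) = L2_norm (\<lambda>x. T f x - (\<Sum>Q\<in>F. T2 Q f x)))
      (finite_subsets_at_top D)"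
  proof (rule eventually_finite_subsets_at_top_weakI)
    fix F assume F: "finite F" "F \<subseteq> D"
    then have "(\<Sum>Q\<in>F. T1 Q f x) = (\<Sum>Q\<in>F. T2 Q f x)" for x
      using assms(1)[OF _ f] by (intro sum.cong) auto
    then show "L2_norm (\<lambda>x. T f x - (\<Sum>Q\<in>F. T1 Q f x)) = L2_norm (\<lambda>x. T f x - (\<Sum>Q\<in>F. T2 Q f x))" by simp
  qed
  moreover have "((\<lambda>F. L2_norm (\<lambda>x. T f x - (\<Sum>Q\<in>F. T1 Q f x))) \<longlongrightarrow> 0) (finite_subsets_at_top D)"
    using assms(2) f unfolding L2_operator_sum_def by blast
  ultimately show "((\<lambda>F. L2_norm (\<lambda>x. T f x - (\<Sum>Q\<in>F. T2 Q f x))) \<longlongrightarrow> 0) (finite_subsets_at_top D)"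
    by (rule tendsto_cong[THEN iffD1])
qed

context dyadic_grid
begin

definition block_operator ::
  "nat \<Rightarrow> ((real ^ 'n) set \<Rightarrow> (real ^ 'n) set \<Rightarrow> (real ^ 'n) set \<Rightarrow> 'k::real_or_complex) \<Rightarrow>
    (real ^ 'n) set \<Rightarrow> (real ^ 'n \<Rightarrow> 'k) \<Rightarrow> real ^ 'n \<Rightarrow> 'k" where
  "block_operator s c Q f x = (\<Sum>R\<in>descendants D s Q. indicat_real R x *\<^sub>R
     (\<Sum>S\<in>descendants D s Q. c Q R S * (LINT y:S|lebesgue. f y)))"

text \<open>
  The two properties of the operators that the estimates use: the outputs have mean zero, and the
  square function is bounded on \<open>L\<^sup>2\<close>, uniformly over all finite trees of the lattice.
\<close>

definition good_blocks ::
  "nat \<Rightarrow> ((real ^ 'n) set \<Rightarrow> (real ^ 'n) set \<Rightarrow> (real ^ 'n) set \<Rightarrow> 'k::real_or_complex) \<Rightarrow> real \<Rightarrow> bool" where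
  "good_blocks s c B \<longleftrightarrow> 0 \<le> B \<and>
     (\<forall>Q\<in>D. \<forall>S\<in>descendants D s Q. (\<Sum>R\<in>descendants D s Q. vol R *\<^sub>R c Q R S) = 0) \<and>
     (\<forall>\<T> k n h. finite \<T> \<and> (\<forall>P\<in>\<T>. P \<in> D \<and> gen P = k) \<and> in_L2 h \<longrightarrow>
       (\<Sum>Q\<in>inner_tree_below \<T> k s n. \<Sum>R\<in>descendants D s Q.
          vol R * (norm (\<Sum>S\<in>descendants D s Q. c Q R S * (LINT x:S|lebesgue. h x)))\<^sup>2)
        \<le> B\<^sup>2 * (LINT x|lebesgue. (norm (h x))\<^sup>2))"

lemma descendants_lmeasurable: "R \<in> descendants D s Q \<Longrightarrow> R \<in> lmeasurable"
  using descendants_subset_grid grid_lmeasurable by auto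

lemma descendants_sets: "R \<in> descendants D s Q \<Longrightarrow> R \<in> sets lebesgue"
  using descendants_lmeasurable by (simp add: fmeasurableD)

lemma in_descendant:
  assumes "Q \<in> D" "x \<in> Q"
  obtains R where "R \<in> descendants D s Q" "x \<in> R"
  using Union_descendants[OF assms(1), of s] assms(2) by auto

lemma sum_indicator_descendants:
  fixes v :: "(real ^ 'n) set \<Rightarrow> 'b::real_vector"
  assumes Q: "Q \<in> D" and R: "R \<in> descendants D s Q" "x \<in> R"
  shows "(\<Sum>R\<in>descendants D s Q. indicat_real R x *\<^sub>R v R) = v R"
proof -
  have "indicat_real R' x = (if R' = R then 1 else 0)" if "R' \<in> descendants D s Q" for R'
    using descendants_disjoint[OF Q that R(1)] R(2) by (auto simp: indicator_def)
  then have "(\<Sum>R\<in>descendants D s Q. indicat_real R x *\<^sub>R v R) = (\<Sum>R'\<in>descendants D s Q. if R' = R then v R else 0)"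
    by (intro sum.cong) auto
  then show ?thesis using R finite_descendants[OF Q] by simp
qed

lemma sum_indicator_descendants_outside:
  fixes v :: "(real ^ 'n) set \<Rightarrow> 'b::real_vector"
  assumes "x \<notin> Q"
  shows "(\<Sum>R\<in>descendants D s Q. indicat_real R x *\<^sub>R v R) = 0"
  using assms descendants_subset by (intro sum.neutral) (auto simp: indicator_def)

lemma set_integral_descendants:
  fixes f :: "real ^ 'n \<Rightarrow> 'b::{banach, second_countable_topology}"
  assumes Q: "Q \<in> D" and f: "set_integrable lebesgue Q f"
  shows "(LINT x:Q|lebesgue. f x) = (\<Sum>S\<in>descendants D s Q. LINT x:S|lebesgue. f x)"
proof -
  have "(LINT x:\<Union>(descendants D s Q)|lebesgue. f x) = (\<Sum>S\<in>descendants D s Q. LINT x:S|lebesgue. f x)"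
    by (rule set_integral_disjoint_Union[OF finite_descendants[OF Q] descendants_disjoint[OF Q] descendants_sets f])
      (simp_all add: Union_descendants[OF Q])
  then show ?thesis by (simp add: Union_descendants[OF Q])
qed

lemma
  assumes Q: "Q \<in> D"
  shows in_L2_block_operator: "in_L2 (block_operator s c Q f)"
    and L2_norm_block_operator: "(L2_norm (block_operator s c Q f))\<^sup>2 = (\<Sum>R\<in>descendants D s Q.
      vol R * (norm (\<Sum>S\<in>descendants D s Q. c Q R S * (LINT x:S|lebesgue. f x)))\<^sup>2)"
proof -
  note * = finite_descendants[OF Q, of s] descendants_disjoint[OF Q, of _ s] descendants_lmeasurable[of _ s Q]
  show "in_L2 (block_operator s c Q f)"
    unfolding block_operator_def[abs_def] by (rule in_L2_step[OF *])
  show "(L2_norm (block_operator s c Q f))\<^sup>2 = (\<Sum>R\<in>descendants D s Q.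
      vol R * (norm (\<Sum>S\<in>descendants D s Q. c Q R S * (LINT x:S|lebesgue. f x)))\<^sup>2)"
    unfolding L2_norm_sq block_operator_def[abs_def] by (rule L2_step[OF *])
qed

lemma kernel_operator_blocks:
  fixes K :: "real ^ 'n \<Rightarrow> real ^ 'n \<Rightarrow> 'k::real_or_complex"
  assumes Q: "Q \<in> D" and supp: "\<And>x y. (x, y) \<notin> Q \<times> Q \<Longrightarrow> K x y = 0"
    and c: "\<And>R S x y. R \<in> descendants D s Q \<Longrightarrow> S \<in> descendants D s Q \<Longrightarrow> x \<in> R \<Longrightarrow> y \<in> S \<Longrightarrow> K x y = c R S"
    and f: "set_integrable lebesgue Q f"
  shows "kernel_operator K f x = (\<Sum>R\<in>descendants D s Q. indicat_real R x *\<^sub>R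
     (\<Sum>S\<in>descendants D s Q. c R S * (LINT y:S|lebesgue. f y)))"
proof (cases "x \<in> Q")
  case False
  then show ?thesis using supp by (simp add: kernel_operator_def sum_indicator_descendants_outside)
next
  case True
  then obtain R where R: "R \<in> descendants D s Q" "x \<in> R" using in_descendant[OF Q] by metis
  have fS: "integrable lebesgue (\<lambda>y. indicat_real S y *\<^sub>R f y)" if "S \<in> descendants D s Q" for S
    using set_integrable_subset[OF f descendants_sets[OF that] descendants_subset[OF that]] by (simp add: set_integrable_def)
  have "K x y * f y = (\<Sum>S\<in>descendants D s Q. c R S * (indicat_real S y *\<^sub>R f y))" for y
  proof (cases "y \<in> Q")
    case False
    then have "(\<Sum>S\<in>descendants D s Q. c R S * (indicat_real S y *\<^sub>R f y)) = 0"
      using descendants_subset by (intro sum.neutral) (auto simp: indicator_def)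
    then show ?thesis using supp False by simp
  next
    case True
    then obtain S where S: "S \<in> descendants D s Q" "y \<in> S" using in_descendant[OF Q] by metis
    have "(\<Sum>S\<in>descendants D s Q. c R S * (indicat_real S y *\<^sub>R f y)) =
      (\<Sum>S\<in>descendants D s Q. indicat_real S y *\<^sub>R (c R S * f y))" by simp
    also have "\<dots> = c R S * f y" by (rule sum_indicator_descendants[OF Q S])
    finally show ?thesis using c[OF R(1) S(1) R(2) S(2)] by simp
  qed
  then have "kernel_operator K f x = (LINT y|lebesgue. (\<Sum>S\<in>descendants D s Q. c R S * (indicat_real S y *\<^sub>R f y)))"
    unfolding kernel_operator_def by (simp only:)
  also have "\<dots> = (\<Sum>S\<in>descendants D s Q. LINT y|lebesgue. c R S * (indicat_real S y *\<^sub>R f y))"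
    by (intro Bochner_Integration.integral_sum integrable_mult_right fS)
  also have "\<dots> = (\<Sum>S\<in>descendants D s Q. c R S * (LINT y:S|lebesgue. f y))"
    unfolding set_lebesgue_integral_def by (simp only: integral_mult_right_zero)
  finally show ?thesis
    using sum_indicator_descendants[OF Q R, of "\<lambda>R. \<Sum>S\<in>descendants D s Q. c R S * (LINT y:S|lebesgue. f y)"]
    by simp
qed

subsection \<open>Big Haar shifts\<close>

definition representative :: "(real ^ 'n) set \<Rightarrow> real ^ 'n" where
  "representative R = (SOME x. x \<in> R)"

lemma representative_mem: "R \<in> D \<Longrightarrow> representative R \<in> R"
  unfolding representative_def using grid_nonempty by (auto simp: some_in_eq)

lemma representative_descendant: "R \<in> descendants D s Q \<Longrightarrow> representative R \<in> R"
  using descendants_subset_grid by (auto intro: representative_mem)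

lemma sum_leaves_le:
  fixes h :: "real ^ 'n \<Rightarrow> 'b::euclidean_space"
  assumes h: "in_L2 h" and fin: "finite \<C>" and dis: "\<And>Z Z'. Z \<in> \<C> \<Longrightarrow> Z' \<in> \<C> \<Longrightarrow> Z \<noteq> Z' \<Longrightarrow> Z \<inter> Z' = {}"
    and C: "\<And>Z. Z \<in> \<C> \<Longrightarrow> Z \<in> D"
  shows "(\<Sum>Z\<in>\<C>. (norm (LINT x:Z|lebesgue. h x))\<^sup>2 / vol Z) \<le> (LINT x|lebesgue. (norm (h x))\<^sup>2)"
proof -
  have i: "integrable lebesgue (\<lambda>x. (norm (h x))\<^sup>2)" using h by (simp add: in_L2_def)
  then have iU: "set_integrable lebesgue UNIV (\<lambda>x. (norm (h x))\<^sup>2)" by (simp add: set_integrable_def)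
  have "(\<Sum>Z\<in>\<C>. (norm (LINT x:Z|lebesgue. h x))\<^sup>2 / vol Z) \<le> (\<Sum>Z\<in>\<C>. LINT x:Z|lebesgue. (norm (h x))\<^sup>2)"
  proof (rule sum_mono)
    fix Z assume Z: "Z \<in> \<C>"
    show "(norm (LINT x:Z|lebesgue. h x))\<^sup>2 / vol Z \<le> (LINT x:Z|lebesgue. (norm (h x))\<^sup>2)"
      using set_integral_norm_sq_le[OF h grid_lmeasurable[OF C[OF Z]]] grid_measure_pos[OF C[OF Z]]
      by (simp add: divide_le_eq mult.commute)
  qed
  also have "\<dots> = (LINT x:\<Union>\<C>|lebesgue. (norm (h x))\<^sup>2)"
    by (rule set_integral_disjoint_Union[symmetric, OF fin dis grid_sets[OF C] iU]) auto
  also have "\<dots> \<le> (LINT x:UNIV|lebesgue. (norm (h x))\<^sup>2)"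
    by (intro set_integral_mono_set[OF iU] sets.finite_Union fin subsetI grid_sets C) auto
  finally show ?thesis by (simp add: set_lebesgue_integral_def)
qed

text \<open>
  As \<open>T\<^sub>Q 1 = 0\<close>, the mean of \<open>h\<close> over \<open>Q\<close> may be subtracted, and the bound for the kernel shows that
  \<open>\<parallel>T\<^sub>Q h\<parallel>\<close> is at most the norm of the martingale difference of \<open>h\<close> on \<open>Q\<close>. Bessel's inequality sums up.
\<close>

lemma haar_blocks_bound:
  fixes c :: "(real ^ 'n) set \<Rightarrow> (real ^ 'n) set \<Rightarrow> (real ^ 'n) set \<Rightarrow> 'k::real_or_complex"
  assumes s: "0 < s"
    and one: "\<And>Q R. Q \<in> D \<Longrightarrow> R \<in> descendants D s Q \<Longrightarrow> (\<Sum>S\<in>descendants D s Q. vol S *\<^sub>R c Q R S) = 0"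
    and le: "\<And>Q R S. Q \<in> D \<Longrightarrow> R \<in> descendants D s Q \<Longrightarrow> S \<in> descendants D s Q \<Longrightarrow> norm (c Q R S) \<le> 1 / vol Q"
    and T: "finite \<T>" "\<And>P. P \<in> \<T> \<Longrightarrow> P \<in> D \<and> gen P = k" and h: "in_L2 h"
  shows "(\<Sum>Q\<in>inner_tree_below \<T> k s n. \<Sum>R\<in>descendants D s Q.
      vol R * (norm (\<Sum>S\<in>descendants D s Q. c Q R S * (LINT x:S|lebesgue. h x)))\<^sup>2)
    \<le> (LINT x|lebesgue. (norm (h x))\<^sup>2)"
proof -
  let ?F = "tree_below \<T> k s n" and ?I = "inner_tree_below \<T> k s n"
  interpret cube_tree ?F ?I "descendants D s" "2 ^ (s * CARD('n))" by (rule cube_tree_below[OF s T])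
  define f where "f Q = (LINT x:Q|lebesgue. h x)" for Q
  have FD: "Q \<in> D" if "Q \<in> ?F" for Q using that by (simp add: tree_below_def)
  have "(\<Sum>Q\<in>?I. \<Sum>R\<in>descendants D s Q. vol R * (norm (\<Sum>S\<in>descendants D s Q. c Q R S * f S))\<^sup>2) \<le>
    (\<Sum>Q\<in>?I. \<Sum>S\<in>descendants D s Q. vol S * (norm (f S /\<^sub>R vol S - f Q /\<^sub>R vol Q))\<^sup>2)"
  proof (rule sum_mono)
    fix Q assume QI: "Q \<in> ?I"
    then have Q: "Q \<in> D" using FD internal_tree by auto
    have vQ: "0 < vol Q" by (rule grid_measure_pos[OF Q])
    let ?C = "descendants D s Q"
    define q where "q = f Q /\<^sub>R vol Q"
    define X where "X = (\<Sum>S\<in>?C. vol S * (norm (f S /\<^sub>R vol S - q))\<^sup>2)"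
    have vS: "0 < vol S" if "S \<in> ?C" for S
      using that descendants_subset_grid grid_measure_pos by auto
    have sum_vol: "(\<Sum>S\<in>?C. vol S) = vol Q" using vol_eq_sum_ch[OF QI] by simp
    have "vol R * (norm (\<Sum>S\<in>?C. c Q R S * f S))\<^sup>2 \<le> vol R * (X / vol Q)" if R: "R \<in> ?C" for R
    proof (rule mult_left_mono)
      have "(\<Sum>S\<in>?C. c Q R S * f S) = (\<Sum>S\<in>?C. vol S *\<^sub>R (c Q R S * (f S /\<^sub>R vol S - q)))"
      proof -
        have "vol S *\<^sub>R (c Q R S * (f S /\<^sub>R vol S - q)) = c Q R S * f S - (vol S *\<^sub>R c Q R S) * q" if "S \<in> ?C" for S
          using vS[OF that] by (simp add: algebra_simps)
        then have "(\<Sum>S\<in>?C. vol S *\<^sub>R (c Q R S * (f S /\<^sub>R vol S - q))) = (\<Sum>S\<in>?C. c Q R S * f S) - (\<Sum>S\<in>?C. vol S *\<^sub>R c Q R S) * q"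
          by (simp add: sum_subtractf sum_distrib_right)
        then show ?thesis using one[OF Q R] by simp
      qed
      then have "norm (\<Sum>S\<in>?C. c Q R S * f S) \<le> (\<Sum>S\<in>?C. norm (vol S *\<^sub>R (c Q R S * (f S /\<^sub>R vol S - q))))"
        by (simp only: norm_sum)
      also have "\<dots> \<le> (\<Sum>S\<in>?C. (1 / vol Q) * (sqrt (vol S) * (sqrt (vol S) * norm (f S /\<^sub>R vol S - q))))"
      proof (rule sum_mono)
        fix S assume S: "S \<in> ?C"
        have "norm (vol S *\<^sub>R (c Q R S * (f S /\<^sub>R vol S - q))) = vol S * (norm (c Q R S) * norm (f S /\<^sub>R vol S - q))"
          by (simp add: norm_mult)
        also have "\<dots> \<le> vol S * ((1 / vol Q) * norm (f S /\<^sub>R vol S - q))"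
          by (intro mult_left_mono mult_right_mono le Q R S) auto
        also have "\<dots> = (1 / vol Q) * (sqrt (vol S) * (sqrt (vol S) * norm (f S /\<^sub>R vol S - q)))"
          using vS[OF S] by (simp add: mult.assoc[symmetric])
        finally show "norm (vol S *\<^sub>R (c Q R S * (f S /\<^sub>R vol S - q))) \<le>
          (1 / vol Q) * (sqrt (vol S) * (sqrt (vol S) * norm (f S /\<^sub>R vol S - q)))" .
      qed
      finally have "(norm (\<Sum>S\<in>?C. c Q R S * f S))\<^sup>2 \<le>
        ((1 / vol Q) * (\<Sum>S\<in>?C. sqrt (vol S) * (sqrt (vol S) * norm (f S /\<^sub>R vol S - q))))\<^sup>2"
        unfolding sum_distrib_left by (intro power_mono) auto
      also have "\<dots> \<le> (1 / vol Q)\<^sup>2 * ((\<Sum>S\<in>?C. (sqrt (vol S))\<^sup>2) * (\<Sum>S\<in>?C. (sqrt (vol S) * norm (f S /\<^sub>R vol S - q))\<^sup>2))"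
        unfolding power_mult_distrib[of "1 / vol Q"] by (intro mult_left_mono Cauchy_Schwarz_ineq_sum) auto
      also have "\<dots> = (1 / vol Q)\<^sup>2 * (vol Q * X)"
        using sum_vol by (simp add: X_def power_mult_distrib)
      also have "\<dots> = X / vol Q" using vQ by (simp add: power2_eq_square)
      finally show "(norm (\<Sum>S\<in>?C. c Q R S * f S))\<^sup>2 \<le> X / vol Q" .
    qed simp
    then have "(\<Sum>R\<in>?C. vol R * (norm (\<Sum>S\<in>?C. c Q R S * f S))\<^sup>2) \<le> (\<Sum>R\<in>?C. vol R * (X / vol Q))"
      by (rule sum_mono)
    also have "\<dots> = X" unfolding sum_distrib_right[symmetric] sum_vol using vQ by simp
    finally show "(\<Sum>R\<in>?C. vol R * (norm (\<Sum>S\<in>?C. c Q R S * f S))\<^sup>2) \<le>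
      (\<Sum>S\<in>?C. vol S * (norm (f S /\<^sub>R vol S - f Q /\<^sub>R vol Q))\<^sup>2)" by (simp add: X_def q_def)
  qed
  also have "\<dots> \<le> (\<Sum>Z\<in>?F - ?I. (norm (f Z))\<^sup>2 / vol Z)"
    unfolding f_def
    by (rule bessel) (use finite_tree ch_subset in_L2_set_integrable[OF h] lmeasurable_tree internal_tree in auto)
  also have "\<dots> \<le> (LINT x|lebesgue. (norm (h x))\<^sup>2)"
    unfolding f_def
  proof (rule sum_leaves_le[OF h])
    fix Z Z' assume Z: "Z \<in> ?F - ?I" "Z' \<in> ?F - ?I" "Z \<noteq> Z'"
    then have "\<not> Z \<subseteq> Z'" "\<not> Z' \<subseteq> Z" using leaf[of Z Z'] leaf[of Z' Z] by auto
    then show "Z \<inter> Z' = {}" using laminar_cases[OF laminar_tree, of Z Z'] Z by auto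
  qed (use finite_tree FD in auto)
  finally show ?thesis by (simp add: f_def)
qed

lemma set_integral_indicator_descendant:
  assumes "Q \<in> D" "S \<in> descendants D s Q"
  shows "(LINT y:S|lebesgue. (indicator Q y :: 'k::real_or_complex)) = vol S *\<^sub>R 1"
proof -
  have "(LINT y:S|lebesgue. (indicator Q y :: 'k)) = (LINT y|lebesgue. indicat_real S y *\<^sub>R 1)"
    unfolding set_lebesgue_integral_def using descendants_subset[OF assms(2)]
    by (intro Bochner_Integration.integral_cong) (auto simp: indicator_def)
  also have "\<dots> = vol S *\<^sub>R 1" by (subst integral_scaleR_left) (use descendants_lmeasurable[OF assms(2)]
        in \<open>auto simp: fmeasurable_def infinity_ennreal_def intro!: integrable_real_indicator\<close>)
  finally show ?thesis .
qed

lemma set_integrable_indicator_self: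
  assumes "Q \<in> D"
  shows "set_integrable lebesgue Q (indicator Q :: _ \<Rightarrow> 'k::real_or_complex)"
proof -
  have "integrable lebesgue (\<lambda>y. indicat_real Q y *\<^sub>R (1::'k))"
    by (intro integrable_scaleR_left integrable_real_indicator)
      (use grid_lmeasurable[OF assms] in \<open>auto simp: fmeasurable_def infinity_ennreal_def\<close>)
  then show ?thesis unfolding set_integrable_def
    by (rule Bochner_Integration.integrable_cong[THEN iffD1, rotated 2]) (auto simp: indicator_def)
qed

lemma big_haar_shift_blocks:
  fixes T :: "(real ^ 'n \<Rightarrow> 'k::real_or_complex) \<Rightarrow> real ^ 'n \<Rightarrow> 'k"
  assumes "big_haar_shift D r T"
  obtains c where "good_blocks (r + 1) c 1" "L2_bounded T" "L2_operator_sum D (block_operator (r + 1) c) T"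
proof -
  obtain K where T: "L2_bounded T" and K: "\<And>Q. Q \<in> D \<Longrightarrow> big_haar_kernel D r Q (K Q)"
    and sum: "L2_operator_sum D (\<lambda>Q. kernel_operator (K Q)) T"
    and one: "\<And>Q. Q \<in> D \<Longrightarrow> kernel_operator (K Q) (indicator Q) = (\<lambda>x. 0)"
    and adj: "\<And>Q. Q \<in> D \<Longrightarrow> kernel_operator (adjoint_kernel (K Q)) (indicator Q) = (\<lambda>x. 0)"
    using assms unfolding big_haar_shift_def generalized_big_haar_shift_with_kernels_def by blast
  define s where "s = r + 1"
  define c where "c Q R S = K Q (representative R) (representative S)" for Q R S
  have supp: "K Q x y = 0" if "Q \<in> D" "(x, y) \<notin> Q \<times> Q" for Q x y
    using K[OF that(1)] that(2) by (simp add: big_haar_kernel_def)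
  have Kc: "K Q x y = c Q R S"
    if *: "Q \<in> D" "R \<in> descendants D s Q" "S \<in> descendants D s Q" "x \<in> R" "y \<in> S" for Q R S x y
  proof -
    have RS: "R \<in> descendants D (r + 1) Q" "S \<in> descendants D (r + 1) Q" using *(2,3) by (simp_all only: s_def)
    have "\<exists>v. \<forall>x\<in>R. \<forall>y\<in>S. K Q x y = v"
      using K[OF *(1), unfolded big_haar_kernel_def, THEN conjunct2, THEN conjunct1, THEN bspec, OF RS(1), THEN bspec, OF RS(2)] .
    then obtain v where "\<forall>x\<in>R. \<forall>y\<in>S. K Q x y = v" ..
    then show ?thesis
      using * representative_descendant[OF *(2)] representative_descendant[OF *(3)] unfolding c_def by simp
  qed
  have ker: "kernel_operator (K Q) f x = block_operator s c Q f x"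
    if Q: "Q \<in> D" and f: "set_integrable lebesgue Q f" for Q f x
    unfolding block_operator_def
    by (rule kernel_operator_blocks[OF Q _ _ f]) (fact supp[OF Q], fact Kc[OF Q])
  have le: "norm (c Q R S) \<le> 1 / vol Q" if "Q \<in> D" for Q R S
    using K[OF that] by (simp add: big_haar_kernel_def c_def)
  have one': "(\<Sum>S\<in>descendants D s Q. vol S *\<^sub>R c Q R S) = 0" if Q: "Q \<in> D" and R: "R \<in> descendants D s Q" for Q R
  proof -
    have "kernel_operator (K Q) (indicator Q) (representative R) = 0" using one[OF Q] by simp
    then have "(\<Sum>S\<in>descendants D s Q. c Q R S * (LINT y:S|lebesgue. indicator Q y)) = 0"
      unfolding ker[OF Q set_integrable_indicator_self[OF Q]] block_operator_def
        sum_indicator_descendants[OF Q R representative_descendant[OF R]] .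
    then show ?thesis by (simp add: set_integral_indicator_descendant[OF Q])
  qed
  have adj': "(\<Sum>R\<in>descendants D s Q. vol R *\<^sub>R c Q R S) = 0" if Q: "Q \<in> D" and S: "S \<in> descendants D s Q" for Q S
  proof -
    have "kernel_operator (adjoint_kernel (K Q)) (indicator Q) (representative S) = 0" using adj[OF Q] by simp
    moreover have "adjoint_kernel (K Q) x y = 0" if xy: "(x, y) \<notin> Q \<times> Q" for x y
      using supp[OF Q, of y x] xy by (auto simp: adjoint_kernel_def)
    moreover have "adjoint_kernel (K Q) x y = fconj (c Q R' S')"
      if RS: "S' \<in> descendants D s Q" "R' \<in> descendants D s Q" "x \<in> S'" "y \<in> R'" for x y R' S'
      using Kc[OF Q RS(2,1,4,3)] by (simp add: adjoint_kernel_def)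
    ultimately have "(\<Sum>S'\<in>descendants D s Q. indicat_real S' (representative S) *\<^sub>R
        (\<Sum>R\<in>descendants D s Q. fconj (c Q R S') * (LINT y:R|lebesgue. indicator Q y))) = 0"
      using kernel_operator_blocks[OF Q, where K="adjoint_kernel (K Q)" and s=s and c="\<lambda>S R. fconj (c Q R S)",
          OF _ _ set_integrable_indicator_self[OF Q]] by simp
    then have "(\<Sum>R\<in>descendants D s Q. fconj (c Q R S) * (LINT y:R|lebesgue. indicator Q y)) = 0"
      unfolding sum_indicator_descendants[OF Q S representative_descendant[OF S]] .
    then have "fconj (\<Sum>R\<in>descendants D s Q. vol R *\<^sub>R c Q R S) = 0"
      by (simp add: set_integral_indicator_descendant[OF Q] fconj_sum fconj_scaleR)
    then show ?thesis by (metis fconj_fconj fconj_zero)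
  qed
  have "good_blocks s c 1"
    unfolding good_blocks_def using adj' haar_blocks_bound[of s c] one' le by (auto simp: s_def)
  moreover have "kernel_operator (K Q) f x = block_operator s c Q f x" if "Q \<in> D" "in_L2 f" for Q f x
    by (rule ker[OF that(1) in_L2_set_integrable[OF that(2) grid_lmeasurable[OF that(1)]]])
  then have "L2_operator_sum D (block_operator s c) T"
    using sum by (rule L2_operator_sum_cong)
  ultimately show ?thesis using that T by (simp add: s_def)
qed

end

subsection \<open>Paraproducts\<close>

context dyadic_grid
begin

lemma martingale_difference_eq:
  fixes b :: "real ^ 'n \<Rightarrow> 'k::real_or_complex"
  assumes R: "R \<in> D"
  shows "martingale_difference D R b x =
    (\<Sum>S\<in>descendants D 1 R. indicat_real S x *\<^sub>R (average S b - average R b))"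
proof (cases "x \<in> R")
  case False
  then have "(\<Sum>S\<in>descendants D 1 R. average S b * indicator S x) = 0"
    using descendants_subset by (intro sum.neutral) (auto simp: indicator_def)
  then show ?thesis using False by (simp add: martingale_difference_def sum_indicator_descendants_outside)
next
  case True
  then obtain S where S: "S \<in> descendants D 1 R" "x \<in> S" using in_descendant[OF R] by metis
  have "(\<Sum>S\<in>descendants D 1 R. average S b * indicator S x) =
    (\<Sum>S\<in>descendants D 1 R. indicat_real S x *\<^sub>R average S b)"
    by (intro sum.cong) (auto simp: indicator_def)
  also have "\<dots> = average S b" by (rule sum_indicator_descendants[OF R S])
  finally show ?thesis
    using True sum_indicator_descendants[OF R S, of "\<lambda>S. average S b - average R b"]
    by (simp add: martingale_difference_def)
qed

lemma in_L2_martingale_difference: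
  fixes b :: "real ^ 'n \<Rightarrow> 'k::real_or_complex"
  assumes R: "R \<in> D"
  shows "in_L2 (martingale_difference D R b)"
  unfolding martingale_difference_eq[OF R, abs_def]
  by (rule in_L2_step[OF finite_descendants[OF R] descendants_disjoint[OF R] descendants_lmeasurable])

lemma vol_scaleR_average: "Q \<in> D \<Longrightarrow> vol Q *\<^sub>R average Q b = (LINT x:Q|lebesgue. b x)"
  using grid_measure_pos[of Q] by (simp add: average_def)

lemma set_integral_martingale_difference:
  fixes b :: "real ^ 'n \<Rightarrow> 'k::real_or_complex"
  assumes R: "R \<in> D" and b: "locally_integrable b"
  shows "(LINT x:R|lebesgue. martingale_difference D R b x) = 0"
proof -
  have "(LINT x:R|lebesgue. martingale_difference D R b x) =
    (\<Sum>S\<in>descendants D 1 R. vol (S \<inter> R) *\<^sub>R (average S b - average R b))"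
    unfolding martingale_difference_eq[OF R]
    by (rule set_integral_step[OF finite_descendants[OF R] descendants_disjoint[OF R] descendants_lmeasurable grid_sets[OF R]])
  also have "\<dots> = (\<Sum>S\<in>descendants D 1 R. (LINT x:S|lebesgue. b x) - vol S *\<^sub>R average R b)"
  proof (rule sum.cong[OF refl])
    fix S assume S: "S \<in> descendants D 1 R"
    have "S \<inter> R = S" "S \<in> D" using descendants_subset[OF S] S descendants_subset_grid by auto
    then show "vol (S \<inter> R) *\<^sub>R (average S b - average R b) = (LINT x:S|lebesgue. b x) - vol S *\<^sub>R average R b"
      by (simp add: scaleR_diff_right vol_scaleR_average)
  qed
  also have "\<dots> = (LINT x:R|lebesgue. b x) - (\<Sum>S\<in>descendants D 1 R. vol S) *\<^sub>R average R b"
    using set_integral_descendants[OF R locally_integrable_grid[OF b R], of 1]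
    by (simp add: sum_subtractf scaleR_sum_left)
  also have "(\<Sum>S\<in>descendants D 1 R. vol S) = vol R"
    using measure_disjoint_Union[OF finite_descendants[OF R, of 1] descendants_disjoint[OF R] descendants_lmeasurable]
      Union_descendants[OF R, of 1] by simp
  finally show ?thesis by (simp add: vol_scaleR_average[OF R])
qed

definition paraproduct_symbol ::
  "nat \<Rightarrow> (real ^ 'n \<Rightarrow> 'k::real_or_complex) \<Rightarrow> (real ^ 'n) set \<Rightarrow> real ^ 'n \<Rightarrow> 'k" where
  "paraproduct_symbol r b Q x = (\<Sum>R\<in>descendants D r Q. martingale_difference D R b x)"

lemma martingale_difference_outside: "R \<in> D \<Longrightarrow> x \<notin> R \<Longrightarrow> martingale_difference D R b x = 0"
  by (simp add: martingale_difference_eq sum_indicator_descendants_outside)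

lemma paraproduct_symbol_outside: "x \<notin> Q \<Longrightarrow> paraproduct_symbol r b Q x = 0"
  unfolding paraproduct_symbol_def
proof (rule sum.neutral, rule ballI)
  fix R assume "x \<notin> Q" "R \<in> descendants D r Q"
  then show "martingale_difference D R b x = 0"
    using descendants_subset descendants_subset_grid by (intro martingale_difference_outside) blast+
qed

lemma paraproduct_symbol_on:
  assumes Q: "Q \<in> D" and R: "R \<in> descendants D r Q" "x \<in> R"
  shows "paraproduct_symbol r b Q x = martingale_difference D R b x"
proof -
  have "martingale_difference D R' b x = 0" if R': "R' \<in> descendants D r Q - {R}" for R'
  proof -
    have "R' \<inter> R = {}" using descendants_disjoint[OF Q _ R(1)] R' by auto
    then show ?thesis using R' R(2) descendants_subset_grid by (intro martingale_difference_outside) auto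
  qed
  then show ?thesis
    unfolding paraproduct_symbol_def using sum.remove[OF finite_descendants[OF Q] R(1), of "\<lambda>R. martingale_difference D R b x"]
    by simp
qed

text \<open>
  On a child of \<open>R\<close> the martingale difference of \<open>R\<close> is constant, and the sum defining the symbol has
  only one nonzero term there.
\<close>

lemma paraproduct_symbol_constant:
  assumes Q: "Q \<in> D" and S: "S \<in> D" "gen S \<le> gen Q - int (r + 1)" and xy: "x \<in> S" "y \<in> S"
  shows "paraproduct_symbol r b Q x = paraproduct_symbol r b Q y"
proof (cases "S \<inter> Q = {}")
  case True
  then have "x \<notin> Q" "y \<notin> Q" using xy by auto
  then show ?thesis by (simp add: paraproduct_symbol_outside)
next
  case False
  have "S \<subseteq> Q"
  proof (cases rule: laminar_cases[OF laminar_grid S(1) Q])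
    case 2
    then have "gen Q \<le> gen S" using gen_mono[OF S(1) Q] by auto
    then show ?thesis using S(2) by simp
  qed (use False in auto)
  then have xQ: "x \<in> Q" using xy(1) by auto
  obtain R where R: "R \<in> descendants D r Q" "x \<in> R" by (rule in_descendant[OF Q xQ])
  have RD: "R \<in> D" using R descendants_subset_grid by auto
  obtain S1 where S1: "S1 \<in> descendants D 1 R" "x \<in> S1" using in_descendant[OF RD R(2)] by metis
  have S1D: "S1 \<in> D" using S1 descendants_subset_grid by auto
  have g: "gen S1 = gen Q - int (r + 1)"
    using gen_descendants[OF RD S1(1)] gen_descendants[OF Q R(1)] by simp
  have "S \<subseteq> S1"
  proof (cases rule: laminar_cases[OF laminar_grid S(1) S1D])
    case 2
    then have "gen S1 \<le> gen S" using gen_mono[OF S(1) S1D] by auto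
    then have "S = S1" using gen_eq_imp_eq[OF S1D S(1)] g S(2) xy S1(2) by auto
    then show ?thesis by simp
  qed (use xy S1 in auto)
  then have y: "y \<in> S1" "y \<in> R" using xy descendants_subset[OF S1(1)] by auto
  have md: "martingale_difference D R b z = average S1 b - average R b" if "z \<in> S1" for z
    unfolding martingale_difference_eq[OF RD] by (rule sum_indicator_descendants[OF RD S1(1) that])
  show ?thesis
    by (simp only: paraproduct_symbol_on[OF Q R] paraproduct_symbol_on[OF Q R(1) y(2)] md[OF S1(2)] md[OF y(1)])
qed

lemma in_L2_paraproduct_symbol: "Q \<in> D \<Longrightarrow> in_L2 (paraproduct_symbol r b Q)"
  unfolding paraproduct_symbol_def[abs_def]
  by (intro in_L2_sum in_L2_martingale_difference) (use descendants_subset_grid in auto)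

lemma set_integral_paraproduct_symbol:
  assumes Q: "Q \<in> D" and R: "R \<in> descendants D r Q" and b: "locally_integrable b"
  shows "(LINT x:R|lebesgue. paraproduct_symbol r b Q x) = 0"
proof -
  have RD: "R \<in> D" using R descendants_subset_grid by auto
  have "(LINT x:R|lebesgue. paraproduct_symbol r b Q x) = (LINT x:R|lebesgue. martingale_difference D R b x)"
    by (rule set_lebesgue_integral_cong[OF grid_sets[OF RD]]) (simp add: paraproduct_symbol_on[OF Q R])
  then show ?thesis using set_integral_martingale_difference[OF RD b] by simp
qed

text \<open>
  Of two cubes of different generations let \<open>Q'\<close> be in the finer one. Then the symbol of \<open>Q\<close> is constant on
  each \<open>r\<close>-th descendant of \<open>Q'\<close>, and the symbol of \<open>Q'\<close> has mean zero there.
\<close>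

lemma paraproduct_terms_orthogonal:
  fixes b :: "real ^ 'n \<Rightarrow> 'k::real_or_complex"
  assumes b: "locally_integrable b" and Q: "Q \<in> D" "Q' \<in> D" "Q \<noteq> Q'"
  shows "(LINT x|lebesgue. (u * paraproduct_symbol r b Q x) \<bullet> (v * paraproduct_symbol r b Q' x)) = 0"
proof -
  have main: "(LINT x|lebesgue. (u * paraproduct_symbol r b Q x) \<bullet> (v * paraproduct_symbol r b Q' x)) = 0"
    if Q: "Q \<in> D" "Q' \<in> D" "Q \<noteq> Q'" and g: "gen Q' \<le> gen Q" for Q Q' u v
  proof (cases "gen Q' = gen Q")
    case True
    then have "Q' \<inter> Q = {}" using gen_eq_imp_eq[OF Q(1,2)] Q(3) by auto
    then have "x \<notin> Q \<or> x \<notin> Q'" for x by auto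
    then have "(u * paraproduct_symbol r b Q x) \<bullet> (v * paraproduct_symbol r b Q' x) = 0" for x
      using paraproduct_symbol_outside[of x Q r b] paraproduct_symbol_outside[of x Q' r b]
      by (metis inner_zero_left inner_zero_right mult_zero_right)
    then show ?thesis by simp
  next
    case False
    define p where "p x = u * paraproduct_symbol r b Q x" for x
    define p' where "p' x = v * paraproduct_symbol r b Q' x" for x
    have L: "in_L2 p" "in_L2 p'"
      unfolding p_def[abs_def] p'_def[abs_def]
      using in_L2_paraproduct_symbol[OF Q(1), of r b] in_L2_paraproduct_symbol[OF Q(2), of r b]
      by (auto simp: in_L2_def norm_mult power_mult_distrib intro!: borel_measurable_times)
    have i: "integrable lebesgue (\<lambda>x. p x \<bullet> p' x)" by (rule L2_inner(1)[OF L])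
    have "(LINT x|lebesgue. p x \<bullet> p' x) = (LINT x:Q'|lebesgue. p x \<bullet> p' x)"
      unfolding set_lebesgue_integral_def
      by (intro Bochner_Integration.integral_cong) (auto simp: indicator_def p'_def paraproduct_symbol_outside)
    also have "\<dots> = (\<Sum>R\<in>descendants D r Q'. LINT x:R|lebesgue. p x \<bullet> p' x)"
      by (rule set_integral_descendants[OF Q(2)])
        (use integrable_mult_indicator[OF grid_sets[OF Q(2)] i] in \<open>simp add: set_integrable_def\<close>)
    also have "\<dots> = 0"
    proof (rule sum.neutral, rule ballI)
      fix R assume R: "R \<in> descendants D r Q'"
      have RD: "R \<in> D" using R descendants_subset_grid by auto
      obtain z where z: "z \<in> R" using grid_nonempty[OF RD] by auto
      have "gen R \<le> gen Q - int (r + 1)" using gen_descendants[OF Q(2) R] g False by simp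
      have "p x = p z" if "x \<in> R" for x
        unfolding p_def by (rule arg_cong[OF paraproduct_symbol_constant[OF Q(1) RD \<open>gen R \<le> gen Q - int (r + 1)\<close> that z]])
      then have "(LINT x:R|lebesgue. p x \<bullet> p' x) = (LINT x:R|lebesgue. p z \<bullet> p' x)"
        by (intro set_lebesgue_integral_cong grid_sets RD) auto
      also have "\<dots> = p z \<bullet> (LINT x:R|lebesgue. p' x)"
        by (rule set_integral_bounded_linear[OF bounded_linear_inner_right in_L2_set_integrable[OF L(2) grid_lmeasurable[OF RD]]])
      also have "(LINT x:R|lebesgue. p' x) = v * (LINT x:R|lebesgue. paraproduct_symbol r b Q' x)"
        unfolding p'_def by (rule set_integral_mult_right)
      finally show "(LINT x:R|lebesgue. p x \<bullet> p' x) = 0"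
        using set_integral_paraproduct_symbol[OF Q(2) R b] by simp
    qed
    finally show ?thesis by (simp add: p_def p'_def)
  qed
  show ?thesis
  proof (cases "gen Q' \<le> gen Q")
    case True
    then show ?thesis using main Q by simp
  next
    case False
    then have "(LINT x|lebesgue. (v * paraproduct_symbol r b Q' x) \<bullet> (u * paraproduct_symbol r b Q x)) = 0"
      using main[of Q' Q] Q by simp
    then show ?thesis by (simp add: inner_commute)
  qed
qed

text \<open>
  The terms are orthogonal, so the sum of the squares of finitely many of them is at most that of
  any larger finite subfamily, and therefore at most \<open>\<parallel>T h\<parallel>\<^sup>2\<close>.
\<close>

lemma bounded_paraproduct_blocks:
  fixes T :: "(real ^ 'n \<Rightarrow> 'k::real_or_complex) \<Rightarrow> real ^ 'n \<Rightarrow> 'k"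
  assumes "bounded_paraproduct D r b T"
  obtains c B where "good_blocks (r + 1) c B" "L2_bounded T" "L2_operator_sum D (block_operator (r + 1) c) T"
proof -
  define s where "s = r + 1"
  define \<beta> where "\<beta> Q x = paraproduct_symbol r b Q x" for Q x
  have b: "locally_integrable b" and T: "L2_bounded T"
    and sum: "L2_operator_sum D (\<lambda>Q f x. average Q f * \<beta> Q x) T"
    using assms by (simp_all add: bounded_paraproduct_def paraproduct_symbol_def \<beta>_def)
  define c where "c Q R S = (1 / vol Q) *\<^sub>R \<beta> Q (representative R)" for Q R and S :: "(real ^ 'n) set"
  have \<beta>_const: "\<beta> Q x = \<beta> Q (representative R)" if Q: "Q \<in> D" and R: "R \<in> descendants D s Q" "x \<in> R" for Q R x
    unfolding \<beta>_def
  proof (rule paraproduct_symbol_constant[OF Q _ _ R(2) representative_descendant[OF R(1)]])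
    show "R \<in> D" using R(1) descendants_subset_grid by auto
    show "gen R \<le> gen Q - int (r + 1)" using gen_descendants[OF Q R(1)] by (simp add: s_def)
  qed
  have \<beta>_step: "\<beta> Q x = (\<Sum>R\<in>descendants D s Q. indicat_real R x *\<^sub>R \<beta> Q (representative R))" if Q: "Q \<in> D" for Q x
  proof (cases "x \<in> Q")
    case False
    then show ?thesis by (simp add: sum_indicator_descendants_outside \<beta>_def paraproduct_symbol_outside)
  next
    case True
    then obtain R where R: "R \<in> descendants D s Q" "x \<in> R" using in_descendant[OF Q] by metis
    show ?thesis using sum_indicator_descendants[OF Q R, of "\<lambda>R. \<beta> Q (representative R)"] \<beta>_const[OF Q R] by simp
  qed
  have blocks: "average Q f * \<beta> Q x = block_operator s c Q f x" if Q: "Q \<in> D" and f: "in_L2 f" for Q f x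
  proof -
    have "(\<Sum>S\<in>descendants D s Q. c Q R S * (LINT y:S|lebesgue. f y)) = average Q f * \<beta> Q (representative R)" for R
      using set_integral_descendants[OF Q in_L2_set_integrable[OF f grid_lmeasurable[OF Q]], of s]
      by (simp add: c_def average_def sum_distrib_left[symmetric] scaleR_sum_right[symmetric] mult.commute)
    then have "block_operator s c Q f x = (\<Sum>R\<in>descendants D s Q. indicat_real R x *\<^sub>R (average Q f * \<beta> Q (representative R)))"
      by (simp add: block_operator_def)
    also have "\<dots> = average Q f * (\<Sum>R\<in>descendants D s Q. indicat_real R x *\<^sub>R \<beta> Q (representative R))"
      by (simp add: sum_distrib_left)
    also have "\<dots> = average Q f * \<beta> Q x" by (simp only: \<beta>_step[OF Q, of x, symmetric])
    finally show ?thesis by simp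
  qed
  have mean0: "(\<Sum>R\<in>descendants D s Q. vol R *\<^sub>R c Q R S) = 0" if Q: "Q \<in> D" for Q S
  proof -
    have "(\<Sum>R\<in>descendants D s Q. vol (R \<inter> Q) *\<^sub>R \<beta> Q (representative R)) =
        (LINT x:Q|lebesgue. (\<Sum>R\<in>descendants D s Q. indicat_real R x *\<^sub>R \<beta> Q (representative R)))"
      by (rule set_integral_step[symmetric, OF finite_descendants[OF Q] descendants_disjoint[OF Q]
            descendants_lmeasurable grid_sets[OF Q]])
    also have "\<dots> = (LINT x:Q|lebesgue. \<beta> Q x)"
      by (rule set_lebesgue_integral_cong[OF grid_sets[OF Q]]) (rule allI, rule impI, rule \<beta>_step[OF Q, symmetric])
    also have "\<dots> = (\<Sum>R\<in>descendants D r Q. LINT x:R|lebesgue. \<beta> Q x)"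
      unfolding \<beta>_def
      by (rule set_integral_descendants[OF Q in_L2_set_integrable[OF in_L2_paraproduct_symbol[OF Q] grid_lmeasurable[OF Q]]])
    also have "\<dots> = 0" unfolding \<beta>_def using set_integral_paraproduct_symbol[OF Q _ b] by simp
    finally have "(\<Sum>R\<in>descendants D s Q. vol (R \<inter> Q) *\<^sub>R \<beta> Q (representative R)) = 0" .
    moreover have "vol (R \<inter> Q) = vol R" if "R \<in> descendants D s Q" for R
      using descendants_subset[OF that] by (simp add: Int_absorb2)
    ultimately have "(1 / vol Q) *\<^sub>R (\<Sum>R\<in>descendants D s Q. vol R *\<^sub>R \<beta> Q (representative R)) = 0" by simp
    then show ?thesis unfolding c_def scaleR_sum_right by (simp add: mult.commute)
  qed
  obtain B0 where B0: "\<And>f. in_L2 f \<Longrightarrow> in_L2 (T f) \<and> L2_norm (T f) \<le> B0 * L2_norm f"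
    using T unfolding L2_bounded_def by blast
  define B where "B = \<bar>B0\<bar>"
  have Tb: "L2_norm (T f) \<le> B * L2_norm f" if "in_L2 f" for f
  proof -
    have "L2_norm (T f) \<le> B0 * L2_norm f" using B0[OF that] by simp
    also have "\<dots> \<le> B * L2_norm f" unfolding B_def by (intro mult_right_mono L2_norm_nonneg) simp
    finally show ?thesis .
  qed
  define p where "p h Q x = average Q h * \<beta> Q x" for h Q x
  have pL: "in_L2 (p h Q)" if "Q \<in> D" "in_L2 h" for h Q
  proof -
    have "p h Q = block_operator s c Q h" using blocks[OF that] by (auto simp: p_def)
    then show ?thesis using in_L2_block_operator[OF that(1)] by simp
  qed
  have square: "(\<Sum>Q\<in>\<Q>. (L2_norm (p h Q))\<^sup>2) \<le> (B * L2_norm h)\<^sup>2" if fin: "finite \<Q>" "\<Q> \<subseteq> D" and h: "in_L2 h" for \<Q> h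
  proof -
    have psum: "(L2_norm (\<lambda>x. \<Sum>Q\<in>F. p h Q x))\<^sup>2 = (\<Sum>Q\<in>F. (L2_norm (p h Q))\<^sup>2)" if "finite F" "F \<subseteq> D" for F
    proof (rule L2_norm_sum_orthogonal[OF that(1)])
      show "in_L2 (p h Q)" if "Q \<in> F" for Q using pL h that \<open>F \<subseteq> D\<close> by auto
      show "(LINT x|lebesgue. p h Q x \<bullet> p h Q' x) = 0" if "Q \<in> F" "Q' \<in> F" "Q \<noteq> Q'" for Q Q'
        unfolding p_def \<beta>_def using paraproduct_terms_orthogonal[OF b _ _ that(3)] that \<open>F \<subseteq> D\<close> by auto
    qed
    have "sqrt (\<Sum>Q\<in>\<Q>. (L2_norm (p h Q))\<^sup>2) \<le> B * L2_norm h + \<epsilon>" if \<epsilon>: "0 < \<epsilon>" for \<epsilon>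
    proof -
      have "((\<lambda>F. L2_norm (\<lambda>x. T h x - (\<Sum>Q\<in>F. p h Q x))) \<longlongrightarrow> 0) (finite_subsets_at_top D)"
        using sum h unfolding L2_operator_sum_def p_def by blast
      then have "eventually (\<lambda>F. L2_norm (\<lambda>x. T h x - (\<Sum>Q\<in>F. p h Q x)) < \<epsilon>) (finite_subsets_at_top D)"
        using \<epsilon> by (rule order_tendstoD)
      then obtain F0 where F0: "finite F0" "F0 \<subseteq> D"
        "\<forall>F. finite F \<and> F0 \<subseteq> F \<and> F \<subseteq> D \<longrightarrow> L2_norm (\<lambda>x. T h x - (\<Sum>Q\<in>F. p h Q x)) < \<epsilon>"
        unfolding eventually_finite_subsets_at_top by (elim exE conjE)
      define F where "F = F0 \<union> \<Q>"
      have F: "finite F" "F \<subseteq> D" using F0 fin by (auto simp: F_def)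
      have Ls: "in_L2 (\<lambda>x. \<Sum>Q\<in>F. p h Q x)"
        by (rule in_L2_sum) (rule pL[OF subsetD[OF F(2)] h])
      have L\<delta>: "in_L2 (\<lambda>x. T h x - (\<Sum>Q\<in>F. p h Q x))" by (rule in_L2_diff[OF conjunct1[OF B0[OF h]] Ls])
      have L\<delta>': "in_L2 (\<lambda>x. (- 1) *\<^sub>R (T h x - (\<Sum>Q\<in>F. p h Q x)))" by (rule in_L2_scaleR[OF L\<delta>])
      have "(\<Sum>Q\<in>\<Q>. (L2_norm (p h Q))\<^sup>2) \<le> (\<Sum>Q\<in>F. (L2_norm (p h Q))\<^sup>2)"
        using F by (intro sum_mono2) (auto simp: F_def)
      also have "\<dots> = (L2_norm (\<lambda>x. \<Sum>Q\<in>F. p h Q x))\<^sup>2" by (rule psum[OF F, symmetric])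
      finally have "sqrt (\<Sum>Q\<in>\<Q>. (L2_norm (p h Q))\<^sup>2) \<le> L2_norm (\<lambda>x. \<Sum>Q\<in>F. p h Q x)"
        by (rule real_le_lsqrt[OF L2_norm_nonneg])
      also have "\<dots> = L2_norm (\<lambda>x. T h x + (- 1) *\<^sub>R (T h x - (\<Sum>Q\<in>F. p h Q x)))" by simp
      also have "\<dots> \<le> L2_norm (T h) + L2_norm (\<lambda>x. (- 1) *\<^sub>R (T h x - (\<Sum>Q\<in>F. p h Q x)))"
        by (rule L2_norm_triangle[OF conjunct1[OF B0[OF h]] L\<delta>'])
      also have "L2_norm (\<lambda>x. (- 1) *\<^sub>R (T h x - (\<Sum>Q\<in>F. p h Q x))) = L2_norm (\<lambda>x. T h x - (\<Sum>Q\<in>F. p h Q x))"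
        by (simp add: L2_norm_def norm_minus_commute)
      finally show ?thesis using Tb[OF h] F0(3)[rule_format, of F] F by (simp add: F_def)
    qed
    then have "sqrt (\<Sum>Q\<in>\<Q>. (L2_norm (p h Q))\<^sup>2) \<le> B * L2_norm h" by (rule field_le_epsilon)
    then show ?thesis by (rule sqrt_le_D)
  qed
  have "good_blocks s c B"
    unfolding good_blocks_def
  proof (intro conjI allI impI ballI)
    show "0 \<le> B" by (simp add: B_def)
    show "(\<Sum>R\<in>descendants D s Q. vol R *\<^sub>R c Q R S) = 0" if "Q \<in> D" for Q S by (rule mean0[OF that])
    fix \<T> k n and h :: "real ^ 'n \<Rightarrow> 'k"
    assume *: "finite \<T> \<and> (\<forall>P\<in>\<T>. P \<in> D \<and> gen P = k) \<and> in_L2 h"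
    then have h: "in_L2 h" by simp
    let ?I = "inner_tree_below \<T> k s n"
    interpret cube_tree "tree_below \<T> k s n" ?I "descendants D s" "2 ^ (s * CARD('n))"
      using * by (intro cube_tree_below) (auto simp: s_def)
    have ID: "?I \<subseteq> D" by (auto simp: inner_tree_below_def)
    have "(\<Sum>Q\<in>?I. \<Sum>R\<in>descendants D s Q. vol R * (norm (\<Sum>S\<in>descendants D s Q. c Q R S * (LINT x:S|lebesgue. h x)))\<^sup>2) =
      (\<Sum>Q\<in>?I. (L2_norm (p h Q))\<^sup>2)"
    proof (rule sum.cong[OF refl])
      fix Q assume "Q \<in> ?I"
      then have Q: "Q \<in> D" using ID by auto
      have "p h Q = block_operator s c Q h" using blocks[OF Q h] by (auto simp: p_def)
      then show "(\<Sum>R\<in>descendants D s Q. vol R * (norm (\<Sum>S\<in>descendants D s Q. c Q R S * (LINT x:S|lebesgue. h x)))\<^sup>2) =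
        (L2_norm (p h Q))\<^sup>2" using L2_norm_block_operator[OF Q, of s c h] by simp
    qed
    also have "\<dots> \<le> (B * L2_norm h)\<^sup>2" by (rule square[OF finite_internal ID h])
    also have "\<dots> = B\<^sup>2 * (LINT x|lebesgue. (norm (h x))\<^sup>2)" by (simp add: power_mult_distrib L2_norm_sq)
    finally show "(\<Sum>Q\<in>?I. \<Sum>R\<in>descendants D s Q. vol R * (norm (\<Sum>S\<in>descendants D s Q. c Q R S * (LINT x:S|lebesgue. h x)))\<^sup>2)
      \<le> B\<^sup>2 * (LINT x|lebesgue. (norm (h x))\<^sup>2)" .
  qed
  moreover have "L2_operator_sum D (block_operator s c) T"
    by (rule L2_operator_sum_cong[OF blocks sum])
  ultimately show ?thesis using that T by (simp add: s_def)
qed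

end

section \<open>From bilinear sums to the operator norm\<close>

lemma in_L2_component:
  fixes F :: "real ^ 'n \<Rightarrow> 'k::real_or_complex ^ 'd"
  assumes F: "in_L2 F"
  shows "in_L2 (\<lambda>x. F x $ i)"
proof -
  have m: "F \<in> borel_measurable lebesgue" and i: "integrable lebesgue (\<lambda>x. (norm (F x))\<^sup>2)"
    using F by (auto simp: in_L2_def)
  have m': "(\<lambda>x. F x $ i) \<in> borel_measurable lebesgue"
    by (rule borel_measurable_continuous_on[OF _ m]) (intro continuous_intros)
  moreover have "integrable lebesgue (\<lambda>x. (norm (F x $ i))\<^sup>2)"
  proof (rule Bochner_Integration.integrable_bound[OF i])
    show "(\<lambda>x. (norm (F x $ i))\<^sup>2) \<in> borel_measurable lebesgue" using m' by simp
    have "norm ((norm (F x $ i))\<^sup>2) \<le> norm ((norm (F x))\<^sup>2)" for x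
      using power_mono[OF Finite_Cartesian_Product.norm_nth_le[of "F x" i] norm_ge_zero, of 2] by simp
    then show "AE x in lebesgue. norm ((norm (F x $ i))\<^sup>2) \<le> norm ((norm (F x))\<^sup>2)" by simp
  qed
  ultimately show ?thesis by (simp add: in_L2_def)
qed

lemma in_L2_vec_lambda:
  fixes f :: "'d::finite \<Rightarrow> real ^ 'n \<Rightarrow> 'k::real_or_complex"
  assumes f: "\<And>i. in_L2 (f i)"
  shows "in_L2 (\<lambda>x. (\<chi> i. f i x) :: 'k ^ 'd)"
proof -
  have "bounded_linear (axis i :: 'k \<Rightarrow> 'k ^ 'd)" for i
    by (simp add: linear_conv_bounded_linear[symmetric] linear_iff vec_eq_iff axis_def)
  then have ax: "continuous_on UNIV (axis i :: 'k \<Rightarrow> 'k ^ 'd)" for i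
    by (simp add: linear_continuous_on)
  have "(\<lambda>x. axis i (f i x) :: 'k ^ 'd) \<in> borel_measurable lebesgue" for i
    by (rule borel_measurable_continuous_on[OF ax]) (use f in \<open>simp add: in_L2_def\<close>)
  then have "(\<lambda>x. \<Sum>i\<in>UNIV. axis i (f i x) :: 'k ^ 'd) \<in> borel_measurable lebesgue"
    by (intro borel_measurable_sum)
  moreover have "(\<Sum>i\<in>UNIV. axis i (f i x)) = (\<chi> i. f i x)" for x
    by (simp add: vec_eq_iff axis_def)
  ultimately have "(\<lambda>x. (\<chi> i. f i x) :: 'k ^ 'd) \<in> borel_measurable lebesgue" by simp
  moreover have "integrable lebesgue (\<lambda>x. (norm ((\<chi> i. f i x) :: 'k ^ 'd))\<^sup>2)"
    unfolding norm_vec_sq using f by (auto simp: in_L2_def)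
  ultimately show ?thesis by (simp add: in_L2_def)
qed

lemma borel_measurable_locally_integrable:
  fixes f :: "real ^ 'n \<Rightarrow> 'b::euclidean_space"
  assumes "locally_integrable f"
  shows "f \<in> borel_measurable lebesgue"
proof (rule borel_measurable_LIMSEQ_metric)
  show "(\<lambda>x. indicat_real (cball 0 (real n)) x *\<^sub>R f x) \<in> borel_measurable lebesgue" for n
    using assms unfolding locally_integrable_def set_integrable_def
    by (intro borel_measurable_integrable) auto
  fix x :: "real ^ 'n"
  obtain N :: nat where N: "norm x \<le> real N" using real_arch_simple by auto
  have "indicat_real (cball 0 (real n)) x *\<^sub>R f x = f x" if "n \<ge> N" for n
    using N that by (simp add: indicator_def)
  then show "(\<lambda>n. indicat_real (cball 0 (real n)) x *\<^sub>R f x) \<longlonglongrightarrow> f x"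
    by (intro tendsto_eventually) (auto simp: eventually_sequentially)
qed

lemma borel_measurable_mult_sqrt:
  fixes W :: "real ^ 'n \<Rightarrow> 'k::real_or_complex ^ 'd ^ 'd"
  assumes W: "matrix_weight W" and f: "f \<in> borel_measurable lebesgue"
  shows "(\<lambda>x. matrix_sqrt (W x) *v f x) \<in> borel_measurable lebesgue"
  using W unfolding matrix_weight_def
  by (intro borel_measurable_matrix_vector_mult[OF borel_measurable_matrix_sqrt[OF borel_measurable_locally_integrable] f]) auto

lemma bounded_compact_support_in_L2:
  fixes f :: "real ^ 'n \<Rightarrow> 'k::real_or_complex ^ 'd" and W :: "real ^ 'n \<Rightarrow> 'k ^ 'd ^ 'd"
  assumes f: "f \<in> borel_measurable lebesgue" "bounded (range f)" "bounded {x. f x \<noteq> 0}"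
    and W: "matrix_weight W"
  shows "in_L2 f" and "in_L2 (\<lambda>x. matrix_sqrt (W x) *v f x)"
proof -
  obtain b where b: "norm (f x) \<le> b" for x using f(2) unfolding bounded_iff by auto
  obtain r where r: "f x \<noteq> 0 \<Longrightarrow> norm x \<le> r" for x using f(3) unfolding bounded_iff by auto
  let ?B = "cball (0 :: real ^ 'n) r"
  have b0: "0 \<le> b" using order_trans[OF norm_ge_zero b] .
  have f2: "(norm (f x))\<^sup>2 \<le> b\<^sup>2 * indicat_real ?B x" for x
    using power_mono[OF b norm_ge_zero, of x 2] r[of x] by (cases "f x = 0") (auto simp: indicator_def)
  have iB: "integrable lebesgue (\<lambda>x. b\<^sup>2 * indicat_real ?B x)"
    using lmeasurable_cball[of "0 :: real ^ 'n" r]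
    by (intro integrable_mult_right integrable_real_indicator) (auto simp: fmeasurable_def infinity_ennreal_def)
  have "integrable lebesgue (\<lambda>x. (norm (f x))\<^sup>2)"
    by (rule Bochner_Integration.integrable_bound[OF iB]) (use f f2 in \<open>auto intro: order_trans[OF _ abs_ge_self]\<close>)
  then show "in_L2 f" using f by (simp add: in_L2_def)
  have psd: "positive_semidefinite (W x)" for x using W by (simp add: matrix_weight_def)
  have "bilinear (\<lambda>(A :: 'k ^ 'd ^ 'd) v. A *v v)"
    by (simp add: bilinear_def bounded_linear.linear[OF bounded_linear_matrix_apply])
  then have "bounded_bilinear (\<lambda>(A :: 'k ^ 'd ^ 'd) v. A *v v)"
    by (simp add: bilinear_conv_bounded_bilinear)
  then obtain c where c: "norm (A *v v) \<le> norm A * norm v * c" for A :: "'k ^ 'd ^ 'd" and v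
    using bounded_bilinear.bounded by blast
  have iW: "integrable lebesgue (\<lambda>x. indicat_real ?B x *\<^sub>R W x)"
    using W by (auto simp: matrix_weight_def locally_integrable_def set_integrable_def)
  have le: "(norm (matrix_sqrt (W x) *v f x))\<^sup>2 \<le> norm (indicat_real ?B x *\<^sub>R W x) * (b\<^sup>2 * \<bar>c\<bar>)" for x
  proof (cases "f x = 0")
    case False
    have "(norm (matrix_sqrt (W x) *v f x))\<^sup>2 = (W x *v f x) \<bullet> f x" by (rule norm_matrix_sqrt_mult[OF psd])
    also have "\<dots> \<le> norm (W x *v f x) * norm (f x)" by (rule norm_cauchy_schwarz)
    also have "\<dots> \<le> (norm (W x) * norm (f x) * \<bar>c\<bar>) * norm (f x)"
      by (intro mult_right_mono order_trans[OF c mult_left_mono]) auto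
    also have "\<dots> = norm (W x) * ((norm (f x))\<^sup>2 * \<bar>c\<bar>)" by (simp add: power2_eq_square mult_ac)
    also have "\<dots> \<le> norm (W x) * (b\<^sup>2 * \<bar>c\<bar>)" using b by (intro mult_left_mono mult_right_mono power_mono) auto
    finally show ?thesis using r[OF False] by (simp add: indicator_def)
  qed simp
  have m: "(\<lambda>x. matrix_sqrt (W x) *v f x) \<in> borel_measurable lebesgue" by (rule borel_measurable_mult_sqrt[OF W f(1)])
  have "integrable lebesgue (\<lambda>x. (norm (matrix_sqrt (W x) *v f x))\<^sup>2)"
    by (rule Bochner_Integration.integrable_bound[OF integrable_mult_left[OF integrable_norm[OF iW], of "b\<^sup>2 * \<bar>c\<bar>"]])
      (use m le in \<open>auto intro: order_trans[OF _ abs_ge_self]\<close>)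
  then show "in_L2 (\<lambda>x. matrix_sqrt (W x) *v f x)" using m by (simp add: in_L2_def)
qed

lemma in_L2_componentwise:
  fixes F :: "real ^ 'n \<Rightarrow> 'k::real_or_complex ^ 'd"
  assumes "L2_bounded T" "in_L2 F"
  shows "in_L2 (componentwise T F)"
proof -
  have "in_L2 (T f)" if "in_L2 f" for f using assms(1) that unfolding L2_bounded_def by blast
  then show ?thesis
    unfolding componentwise_def[abs_def] using in_L2_component[OF assms(2)] by (intro in_L2_vec_lambda) auto
qed

text \<open>
  Test with the product \<open>h\<close> itself, cut off where \<open>x\<close> or \<open>h x\<close> is large so that it is an admissible \<open>g\<close>;
  this bounds the integral of \<open>|h|\<^sup>2\<close> over the region kept, and monotone convergence gives the whole.
  In particular the product lies in \<open>L\<^sup>2\<close>.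
\<close>

lemma L2_bound_by_duality:
  fixes W :: "real ^ 'n \<Rightarrow> 'k::real_or_complex ^ 'd ^ 'd"
  assumes W: "matrix_weight W" and u: "u \<in> borel_measurable lebesgue" and X: "0 \<le> X"
    and dual: "\<And>g. g \<in> borel_measurable lebesgue \<Longrightarrow> bounded (range g) \<Longrightarrow> bounded {x. g x \<noteq> 0} \<Longrightarrow>
      \<bar>LINT x|lebesgue. u x \<bullet> (matrix_sqrt (W x) *v g x)\<bar> \<le> X * L2_norm g"
  shows "in_L2 (\<lambda>x. matrix_sqrt (W x) *v u x)" and "L2_norm (\<lambda>x. matrix_sqrt (W x) *v u x) \<le> X"
proof -
  define h where "h x = matrix_sqrt (W x) *v u x" for x
  have psd: "positive_semidefinite (W x)" for x using W by (simp add: matrix_weight_def)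
  have h: "h \<in> borel_measurable lebesgue" unfolding h_def[abs_def] by (rule borel_measurable_mult_sqrt[OF W u])
  define E where "E n = {x \<in> cball 0 (real n). norm (h x) \<le> real n}" for n
  have E: "E n \<in> sets lebesgue" for n
  proof -
    have "{x \<in> space lebesgue. norm (h x) \<le> real n} \<in> sets lebesgue" using h by measurable
    moreover have "cball (0 :: real ^ 'n) (real n) \<in> sets lebesgue" by simp
    moreover have "E n = cball 0 (real n) \<inter> {x \<in> space lebesgue. norm (h x) \<le> real n}" by (auto simp: E_def)
    ultimately show ?thesis by (simp only: sets.Int)
  qed
  have part: "(\<integral>\<^sup>+x. ennreal ((norm (h x))\<^sup>2) * indicator (E n) x \<partial>lebesgue) \<le> ennreal (X\<^sup>2)" for n
  proof -
    define g where "g x = indicat_real (E n) x *\<^sub>R h x" for x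
    have g: "g \<in> borel_measurable lebesgue" unfolding g_def[abs_def]
      using h E by (intro borel_measurable_scaleR borel_measurable_indicator)
    have bg: "norm (g x) \<le> real n" for x by (auto simp: g_def indicator_def E_def)
    have g1: "bounded (range g)" using bg by (auto simp: bounded_iff)
    have "{x. g x \<noteq> 0} \<subseteq> cball 0 (real n)" by (auto simp: g_def indicator_def E_def)
    then have g2: "bounded {x. g x \<noteq> 0}" using bounded_subset bounded_cball by metis
    have gL: "in_L2 g" by (rule bounded_compact_support_in_L2(1)[OF g g1 g2 W])
    have "u x \<bullet> (matrix_sqrt (W x) *v g x) = (norm (g x))\<^sup>2" for x
    proof -
      have "u x \<bullet> (matrix_sqrt (W x) *v g x) = h x \<bullet> g x"
        unfolding h_def using positive_semidefinite_self_adjoint[OF positive_semidefinite_matrix_sqrt[OF psd]] by metis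
      also have "\<dots> = (norm (g x))\<^sup>2" by (simp add: g_def indicator_def power2_norm_eq_inner)
      finally show ?thesis .
    qed
    then have "(L2_norm g)\<^sup>2 \<le> X * L2_norm g"
      using dual[OF g g1 g2] by (simp add: L2_norm_sq)
    then have "L2_norm g \<le> X"
      using L2_norm_nonneg[of g] X by (cases "L2_norm g = 0") (auto simp: power2_eq_square)
    then have le: "(LINT x|lebesgue. (norm (g x))\<^sup>2) \<le> X\<^sup>2"
      unfolding L2_norm_sq[symmetric] by (intro power_mono L2_norm_nonneg)
    have "(\<integral>\<^sup>+x. ennreal ((norm (h x))\<^sup>2) * indicator (E n) x \<partial>lebesgue) = (\<integral>\<^sup>+x. ennreal ((norm (g x))\<^sup>2) \<partial>lebesgue)"
      by (intro nn_integral_cong) (auto simp: g_def indicator_def)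
    also have "\<dots> = ennreal (LINT x|lebesgue. (norm (g x))\<^sup>2)"
      using gL by (intro nn_integral_eq_integral) (auto simp: in_L2_def)
    finally show ?thesis using le by (simp add: ennreal_leI)
  qed
  have "(\<integral>\<^sup>+x. ennreal ((norm (h x))\<^sup>2) \<partial>lebesgue) = (\<integral>\<^sup>+x. (SUP n. ennreal ((norm (h x))\<^sup>2) * indicator (E n) x) \<partial>lebesgue)"
  proof (rule nn_integral_cong)
    fix x
    obtain n :: nat where n: "max (norm x) (norm (h x)) \<le> real n" using real_arch_simple by blast
    show "ennreal ((norm (h x))\<^sup>2) = (SUP n. ennreal ((norm (h x))\<^sup>2) * indicator (E n) x)"
    proof (rule antisym)
      have "x \<in> E n" using n by (simp add: E_def)
      then show "ennreal ((norm (h x))\<^sup>2) \<le> (SUP n. ennreal ((norm (h x))\<^sup>2) * indicator (E n) x)"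
        by (intro SUP_upper2[of n]) auto
    qed (auto intro!: SUP_least simp: indicator_def)
  qed
  also have "\<dots> = (SUP n. \<integral>\<^sup>+x. ennreal ((norm (h x))\<^sup>2) * indicator (E n) x \<partial>lebesgue)"
  proof (rule nn_integral_monotone_convergence_SUP)
    show "incseq (\<lambda>n x. ennreal ((norm (h x))\<^sup>2) * indicator (E n) x)"
      by (auto simp: incseq_def le_fun_def E_def indicator_def)
    show "(\<lambda>x. ennreal ((norm (h x))\<^sup>2) * indicator (E n) x) \<in> borel_measurable lebesgue" for n
      using h E by (intro borel_measurable_times_ennreal borel_measurable_indicator) auto
  qed
  also have "\<dots> \<le> ennreal (X\<^sup>2)" by (intro SUP_least part)
  finally have nn: "(\<integral>\<^sup>+x. ennreal ((norm (h x))\<^sup>2) \<partial>lebesgue) \<le> ennreal (X\<^sup>2)" .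
  have i: "integrable lebesgue (\<lambda>x. (norm (h x))\<^sup>2)"
  proof (rule integrableI_bounded)
    show "(\<lambda>x. (norm (h x))\<^sup>2) \<in> borel_measurable lebesgue" using h by simp
    show "(\<integral>\<^sup>+x. ennreal (norm ((norm (h x))\<^sup>2)) \<partial>lebesgue) < \<infinity>"
      using le_less_trans[OF nn] by (simp add: ennreal_less_top)
  qed
  then show "in_L2 (\<lambda>x. matrix_sqrt (W x) *v u x)" using h by (simp add: in_L2_def h_def[abs_def])
  have "ennreal (LINT x|lebesgue. (norm (h x))\<^sup>2) \<le> ennreal (X\<^sup>2)"
    using nn i by (subst (asm) nn_integral_eq_integral) auto
  then have "(LINT x|lebesgue. (norm (h x))\<^sup>2) \<le> X\<^sup>2" by (simp add: ennreal_le_iff)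
  then show "L2_norm (\<lambda>x. matrix_sqrt (W x) *v u x) \<le> X"
    unfolding L2_norm_def h_def[symmetric] using X by (simp add: real_le_lsqrt Bochner_Integration.integral_nonneg)
qed

context dyadic_grid
begin

lemma integral_componentwise_block_operator:
  fixes F G :: "real ^ 'n \<Rightarrow> 'k::real_or_complex ^ 'd"
  assumes Q: "Q \<in> D" and F: "in_L2 F" and G: "in_L2 G"
  shows "(\<Sum>i\<in>UNIV. LINT x|lebesgue. block_operator s c Q (\<lambda>y. F y $ i) x \<bullet> (G x $ i)) =
    block_form (mat 1) (descendants D s Q) (c Q) F G"
proof -
  have R: "R \<in> lmeasurable" if "R \<in> descendants D s Q" for R using descendants_lmeasurable[OF that] .
  define y where "y R = (\<Sum>S\<in>descendants D s Q. c Q R S *s (LINT x:S|lebesgue. F x))" for R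
  have y: "(\<Sum>S\<in>descendants D s Q. c Q R S * (LINT x:S|lebesgue. F x $ i)) = y R $ i" for R i
  proof -
    have "(LINT x:S|lebesgue. F x $ i) = (LINT x:S|lebesgue. F x) $ i" if "S \<in> descendants D s Q" for S
      by (rule set_integral_bounded_linear[OF bounded_linear_vec_nth in_L2_set_integrable[OF F R[OF that]]])
    then show ?thesis by (simp add: y_def)
  qed
  have iR: "integrable lebesgue (\<lambda>x. indicat_real R x *\<^sub>R (y R \<bullet> G x))" if "R \<in> descendants D s Q" for R
    using set_integrable_bounded_linear[OF bounded_linear_inner_right in_L2_set_integrable[OF G R[OF that]]]
    by (simp add: set_integrable_def)
  have i2: "integrable lebesgue (\<lambda>x. block_operator s c Q (\<lambda>y. F y $ i) x \<bullet> (G x $ i))" for i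
    by (rule L2_inner(1)[OF in_L2_block_operator[OF Q] in_L2_component[OF G]])
  have "(\<Sum>i\<in>UNIV. LINT x|lebesgue. block_operator s c Q (\<lambda>y. F y $ i) x \<bullet> (G x $ i)) =
    (LINT x|lebesgue. (\<Sum>i\<in>UNIV. block_operator s c Q (\<lambda>y. F y $ i) x \<bullet> (G x $ i)))"
    by (rule Bochner_Integration.integral_sum[symmetric]) (rule i2)
  also have "\<dots> = (LINT x|lebesgue. (\<Sum>R\<in>descendants D s Q. indicat_real R x *\<^sub>R (y R \<bullet> G x)))"
  proof (rule Bochner_Integration.integral_cong[OF refl])
    fix x
    have "(\<Sum>i\<in>UNIV. block_operator s c Q (\<lambda>y. F y $ i) x \<bullet> (G x $ i)) =
      (\<Sum>i\<in>UNIV. \<Sum>R\<in>descendants D s Q. indicat_real R x * (y R $ i \<bullet> (G x $ i)))"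
      by (simp add: block_operator_def y inner_sum_left)
    also have "\<dots> = (\<Sum>R\<in>descendants D s Q. \<Sum>i\<in>UNIV. indicat_real R x * (y R $ i \<bullet> (G x $ i)))"
      by (rule sum.swap)
    finally show "(\<Sum>i\<in>UNIV. block_operator s c Q (\<lambda>y. F y $ i) x \<bullet> (G x $ i)) =
      (\<Sum>R\<in>descendants D s Q. indicat_real R x *\<^sub>R (y R \<bullet> G x))"
      by (simp add: inner_vec_def sum_distrib_left)
  qed
  also have "\<dots> = (\<Sum>R\<in>descendants D s Q. LINT x:R|lebesgue. y R \<bullet> G x)"
    unfolding set_lebesgue_integral_def by (rule Bochner_Integration.integral_sum) (rule iR)
  also have "\<dots> = (\<Sum>R\<in>descendants D s Q. y R \<bullet> (LINT x:R|lebesgue. G x))"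
    by (intro sum.cong refl set_integral_bounded_linear bounded_linear_inner_right in_L2_set_integrable G R)
  finally show ?thesis by (simp add: block_form_def y_def)
qed

text \<open>
  The pairing is a limit of the finite sums, because each component of \<open>T F\<close> is an \<open>L\<^sup>2\<close>-limit.
\<close>

lemma bilinear_form_bound:
  fixes F G :: "real ^ 'n \<Rightarrow> 'k::real_or_complex ^ 'd"
  assumes T: "L2_bounded T" and sum: "L2_operator_sum D (block_operator s c) T"
    and F: "in_L2 F" and G: "in_L2 G"
    and le: "\<And>\<Q>. finite \<Q> \<Longrightarrow> \<Q> \<subseteq> D \<Longrightarrow>
      (\<Sum>Q\<in>\<Q>. \<bar>block_form (mat 1) (descendants D s Q) (c Q) F G\<bar>) \<le> X"
  shows "\<bar>LINT x|lebesgue. componentwise T F x \<bullet> G x\<bar> \<le> X"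
proof (rule field_le_epsilon)
  fix \<epsilon> :: real assume \<epsilon>: "0 < \<epsilon>"
  define F' where "F' i x = F x $ i" for i x
  define G' where "G' i x = G x $ i" for i x
  have F': "in_L2 (F' i)" and G': "in_L2 (G' i)" for i
    unfolding F'_def[abs_def] G'_def[abs_def] using in_L2_component F G by auto
  have TF: "in_L2 (T (F' i))" for i using T F' unfolding L2_bounded_def by blast
  define E where "E \<Q> i x = T (F' i) x - (\<Sum>Q\<in>\<Q>. block_operator s c Q (F' i) x)" for \<Q> i x
  have "((\<lambda>\<Q>. \<Sum>i\<in>UNIV. L2_norm (E \<Q> i) * L2_norm (G' i)) \<longlongrightarrow> (\<Sum>i\<in>(UNIV::'d set). 0 * L2_norm (G' i)))
      (finite_subsets_at_top D)"
    using sum F' unfolding L2_operator_sum_def E_def by (intro tendsto_sum tendsto_mult tendsto_const) auto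
  then have "eventually (\<lambda>\<Q>. (\<Sum>i\<in>UNIV. L2_norm (E \<Q> i) * L2_norm (G' i)) < \<epsilon>) (finite_subsets_at_top D)"
    using \<epsilon> by (intro order_tendstoD(2)) auto
  then obtain \<Q> where Q: "finite \<Q>" "\<Q> \<subseteq> D"
    and *: "\<forall>Y. finite Y \<and> \<Q> \<subseteq> Y \<and> Y \<subseteq> D \<longrightarrow> (\<Sum>i\<in>UNIV. L2_norm (E Y i) * L2_norm (G' i)) < \<epsilon>"
    unfolding eventually_finite_subsets_at_top by (elim exE conjE)
  have Q\<epsilon>: "(\<Sum>i\<in>UNIV. L2_norm (E \<Q> i) * L2_norm (G' i)) < \<epsilon>" using *[rule_format, of \<Q>] Q by simp
  have Eb: "in_L2 (block_operator s c Q (F' i))" if "Q \<in> \<Q>" for Q i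
    by (rule in_L2_block_operator[OF subsetD[OF Q(2) that]])
  have EL: "in_L2 (E \<Q> i)" for i
    unfolding E_def[abs_def] by (intro in_L2_diff TF in_L2_sum Eb)
  have iB: "integrable lebesgue (\<lambda>x. block_operator s c Q (F' i) x \<bullet> G' i x)" if "Q \<in> \<Q>" for Q i
    by (rule L2_inner(1)[OF Eb[OF that] G'])
  have "(LINT x|lebesgue. componentwise T F x \<bullet> G x) = (LINT x|lebesgue. (\<Sum>i\<in>UNIV. T (F' i) x \<bullet> G' i x))"
    by (simp add: inner_vec_def componentwise_def F'_def[abs_def] G'_def)
  also have "\<dots> = (\<Sum>i\<in>UNIV. LINT x|lebesgue. T (F' i) x \<bullet> G' i x)"
    by (intro Bochner_Integration.integral_sum L2_inner(1) TF G')
  also have "\<dots> = (\<Sum>i\<in>UNIV. (LINT x|lebesgue. E \<Q> i x \<bullet> G' i x) + (\<Sum>Q\<in>\<Q>. LINT x|lebesgue. block_operator s c Q (F' i) x \<bullet> G' i x))"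
  proof (rule sum.cong[OF refl])
    fix i
    have "T (F' i) x \<bullet> G' i x = E \<Q> i x \<bullet> G' i x + (\<Sum>Q\<in>\<Q>. block_operator s c Q (F' i) x \<bullet> G' i x)" for x
      by (simp add: E_def inner_diff_left inner_sum_left)
    then show "(LINT x|lebesgue. T (F' i) x \<bullet> G' i x) =
      (LINT x|lebesgue. E \<Q> i x \<bullet> G' i x) + (\<Sum>Q\<in>\<Q>. LINT x|lebesgue. block_operator s c Q (F' i) x \<bullet> G' i x)"
      using L2_inner(1)[OF EL G'] iB by (simp add: Bochner_Integration.integral_sum)
  qed
  also have "\<dots> = (\<Sum>i\<in>UNIV. LINT x|lebesgue. E \<Q> i x \<bullet> G' i x) +
      (\<Sum>Q\<in>\<Q>. \<Sum>i\<in>UNIV. LINT x|lebesgue. block_operator s c Q (F' i) x \<bullet> G' i x)"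
    unfolding sum.distrib by (subst (2) sum.swap) simp
  also have "(\<Sum>Q\<in>\<Q>. \<Sum>i\<in>UNIV. LINT x|lebesgue. block_operator s c Q (F' i) x \<bullet> G' i x) =
      (\<Sum>Q\<in>\<Q>. block_form (mat 1) (descendants D s Q) (c Q) F G)"
    unfolding F'_def[abs_def] G'_def
    by (intro sum.cong refl integral_componentwise_block_operator F G) (use Q in auto)
  finally have eq: "(LINT x|lebesgue. componentwise T F x \<bullet> G x) = (\<Sum>i\<in>UNIV. LINT x|lebesgue. E \<Q> i x \<bullet> G' i x) +
      (\<Sum>Q\<in>\<Q>. block_form (mat 1) (descendants D s Q) (c Q) F G)" .
  have "\<bar>\<Sum>i\<in>UNIV. LINT x|lebesgue. E \<Q> i x \<bullet> G' i x\<bar> \<le> (\<Sum>i\<in>UNIV. L2_norm (E \<Q> i) * L2_norm (G' i))"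
    by (rule order_trans[OF sum_abs sum_mono[OF L2_inner(2)[OF EL G']]])
  moreover have "\<bar>\<Sum>Q\<in>\<Q>. block_form (mat 1) (descendants D s Q) (c Q) F G\<bar> \<le> X"
    by (rule order_trans[OF sum_abs le[OF Q(1,2)]])
  ultimately show "\<bar>LINT x|lebesgue. componentwise T F x \<bullet> G x\<bar> \<le> X + \<epsilon>" unfolding eq using Q\<epsilon> by linarith
qed

text \<open>
  Sorting by generation modulo \<open>s\<close> splits a finite family into \<open>s\<close> families that fit into trees.
\<close>

lemma weighted_block_sum_estimate:
  fixes c :: "(real ^ 'n) set \<Rightarrow> (real ^ 'n) set \<Rightarrow> (real ^ 'n) set \<Rightarrow> 'k::real_or_complex"
    and V W :: "real ^ 'n \<Rightarrow> 'k ^ 'd ^ 'd"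
  assumes s: "0 < s" and c: "good_blocks s c B" and V: "matrix_weight V" and W: "matrix_weight W"
    and f: "in_L2 f" and F: "in_L2 (\<lambda>x. matrix_sqrt (V x) *v f x)"
    and g: "in_L2 g" and G: "in_L2 (\<lambda>x. matrix_sqrt (W x) *v g x)"
    and AV: "\<And>e. A_infinity D (\<lambda>x. (V x *v e) \<bullet> e) < ennreal AV" "0 < AV"
    and AW: "\<And>e. A_infinity D (\<lambda>x. (W x *v e) \<bullet> e) < ennreal AW" "0 < AW"
    and K: "\<And>Q. Q \<in> D \<Longrightarrow> (matrix_opnorm (matrix_sqrt (average Q W) ** matrix_sqrt (average Q V)))\<^sup>2 \<le> K"
    and \<eta>: "0 < \<eta>" and \<Q>: "finite \<Q>" "\<Q> \<subseteq> D"
  shows "(\<Sum>Q\<in>\<Q>. \<bar>block_form (mat 1) (descendants D s Q) (c Q) (\<lambda>x. matrix_sqrt (V x) *v f x) (\<lambda>x. matrix_sqrt (W x) *v g x)\<bar>)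
    \<le> real s * (32 * real CARD('d) * B * (2 ^ (s * CARD('n)))\<^sup>2 * sqrt ((K + \<eta>) * (4 * AV + 1) * (4 * AW + 1)) * L2_norm f * L2_norm g)"
proof -
  define t where "t Q = \<bar>block_form (mat 1) (descendants D s Q) (c Q) (\<lambda>x. matrix_sqrt (V x) *v f x) (\<lambda>x. matrix_sqrt (W x) *v g x)\<bar>" for Q
  define X where "X = 32 * real CARD('d) * B * (2 ^ (s * CARD('n)))\<^sup>2 * sqrt ((K + \<eta>) * (4 * AV + 1) * (4 * AW + 1)) * L2_norm f * L2_norm g"
  have slice: "(\<Sum>Q | Q \<in> \<Q> \<and> gen Q mod int s = j. t Q) \<le> X" for j
  proof -
    let ?Q = "{Q \<in> \<Q>. gen Q mod int s = j}"
    have fin: "finite ?Q" using \<Q> by simp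
    have Qj: "Q \<in> D \<and> gen Q mod int s = j" if "Q \<in> ?Q" for Q using \<Q> that by auto
    show ?thesis
    proof (rule slice_in_tree[OF s fin Qj])
      fix \<T> k n assume T: "finite \<T>" "\<And>P. P \<in> \<T> \<Longrightarrow> P \<in> D \<and> gen P = k"
        and sub: "?Q \<subseteq> inner_tree_below \<T> k s n"
      have tree: "cube_tree (tree_below \<T> k s n) (inner_tree_below \<T> k s n) (descendants D s) (2 ^ (s * CARD('n)))"
        by (rule cube_tree_below[OF s T])
      have "(\<Sum>Q\<in>?Q. t Q) \<le> (\<Sum>Q\<in>inner_tree_below \<T> k s n. t Q)"
        using sub cube_tree.finite_internal[OF tree] by (intro sum_mono2) (auto simp: t_def)
      also have "\<dots> \<le> X"
        unfolding t_def X_def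
      proof (rule weighted_tree_estimate[OF tree _ _ _ _ V W f F g G AV AW K \<eta>])
        show "Q \<in> D" if "Q \<in> tree_below \<T> k s n" for Q using that by (simp add: tree_below_def)
        show "(\<Sum>R\<in>descendants D s Q. vol R *\<^sub>R c Q R S) = 0"
          if "Q \<in> inner_tree_below \<T> k s n" "S \<in> descendants D s Q" for Q S
          using c that by (simp add: good_blocks_def inner_tree_below_def)
        show "0 \<le> B" using c by (simp add: good_blocks_def)
        show "(\<Sum>Q\<in>inner_tree_below \<T> k s n. \<Sum>R\<in>descendants D s Q.
            vol R * (norm (\<Sum>S\<in>descendants D s Q. c Q R S * (LINT x:S|lebesgue. h x)))\<^sup>2)
          \<le> B\<^sup>2 * (LINT x|lebesgue. (norm (h x))\<^sup>2)" if "in_L2 h" for h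
          using c that T unfolding good_blocks_def by simp
      qed
      finally show "(\<Sum>Q\<in>?Q. t Q) \<le> X" .
    qed
  qed
  have "(\<Sum>Q\<in>\<Q>. t Q) = (\<Sum>j\<in>{0..<int s}. \<Sum>Q | Q \<in> \<Q> \<and> gen Q mod int s = j. t Q)"
    by (rule sum.group[symmetric]) (use \<Q> s in auto)
  also have "\<dots> \<le> (\<Sum>j\<in>{0..<int s}. X)" by (intro sum_mono slice)
  also have "\<dots> = real s * X" by simp
  finally show ?thesis by (simp add: t_def X_def)
qed

text \<open>
  The maximal function over \<open>Q\<close> is at least the average over \<open>Q\<close>, so a characteristic below \<open>1\<close> is only
  possible if all averages vanish.
\<close>

lemma A_infinity_less_1:
  assumes w: "\<And>x. 0 \<le> w x" and A: "A_infinity D w < 1" and Q: "Q \<in> D"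
  shows "average Q w = 0"
proof -
  define a where "a = average Q w"
  have a: "0 \<le> a" unfolding a_def average_def using set_integral_nonneg_pointwise[of Q w lebesgue, OF w] by simp
  have vQ: "0 < vol Q" by (rule grid_measure_pos[OF Q])
  obtain C where C: "C < 1" "\<forall>Q\<in>D. (\<integral>\<^sup>+x\<in>Q. local_maximal D Q w x \<partial>lebesgue) / ennreal (vol Q) \<le> C * ennreal (average Q w)"
    using A unfolding A_infinity_def Inf_less_iff by auto
  have "ennreal a * ennreal (vol Q) = (\<integral>\<^sup>+x\<in>Q. ennreal a \<partial>lebesgue)"
    using grid_lmeasurable[OF Q] grid_sets[OF Q] by (simp add: nn_integral_cmult_indicator emeasure_eq_measure2)
  also have "\<dots> \<le> (\<integral>\<^sup>+x\<in>Q. local_maximal D Q w x \<partial>lebesgue)"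
  proof (rule nn_integral_mono)
    fix x
    show "ennreal a * indicator Q x \<le> local_maximal D Q w x * indicator Q x"
    proof (cases "x \<in> Q")
      case True
      then have "ennreal \<bar>average Q w\<bar> \<le> (SUP R\<in>{R \<in> D. R \<subseteq> Q \<and> x \<in> R}. ennreal \<bar>average R w\<bar>)"
        using Q by (intro SUP_upper) auto
      then show ?thesis using True a by (simp add: local_maximal_def a_def)
    qed simp
  qed
  finally have "ennreal a * ennreal (vol Q) / ennreal (vol Q) \<le> (\<integral>\<^sup>+x\<in>Q. local_maximal D Q w x \<partial>lebesgue) / ennreal (vol Q)"
    by (rule divide_right_mono_ennreal)
  also have "\<dots> \<le> C * ennreal a" using C(2) Q by (simp add: a_def)
  finally have *: "ennreal a \<le> C * ennreal a" using vQ by (simp add: mult_divide_eq_ennreal)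
  obtain r where r: "C = ennreal r" "0 \<le> r" "r < 1"
    using C(1) by (cases C) (auto simp: ennreal_less_one_iff)
  have "a \<le> r * a" using * a r by (simp add: ennreal_mult[symmetric])
  then have "(1 - r) * a \<le> 0" by (simp add: algebra_simps)
  then show ?thesis using a r unfolding a_def by (simp add: mult_le_0_iff)
qed

lemma scalar_A_infinity_less_1:
  assumes V: "matrix_weight V" and A: "scalar_A_infinity D V < 1" and Q: "Q \<in> D"
  shows "matrix_sqrt (average Q V) *v v = 0"
proof -
  have psd: "positive_semidefinite (V x)" for x using V by (simp add: matrix_weight_def)
  have "A_infinity D (\<lambda>x. (V x *v v) \<bullet> v) \<le> scalar_A_infinity D V"
    unfolding scalar_A_infinity_def by (rule SUP_upper) simp
  then have "average Q (\<lambda>x. (V x *v v) \<bullet> v) = 0"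
    using A by (intro A_infinity_less_1 Q positive_semidefinite_nonneg[OF psd]) auto
  then have "(average Q V *v v) \<bullet> v = 0"
    using set_integral_matrix_form[OF V Q, of v v] grid_measure_pos[OF Q] by (simp add: average_def)
  then show ?thesis
    using norm_matrix_sqrt_mult[OF positive_semidefinite_average[OF V Q], of v] by simp
qed

lemma joint_A2_eq_0:
  fixes V W :: "real ^ 'n \<Rightarrow> 'k::real_or_complex ^ 'd ^ 'd"
  assumes V: "matrix_weight V" and W: "matrix_weight W"
    and A: "scalar_A_infinity D V < 1 \<or> scalar_A_infinity D W < 1"
  shows "joint_A2 D V W = 0"
proof -
  have "matrix_opnorm (matrix_sqrt (average Q W) ** matrix_sqrt (average Q V)) = 0" if Q: "Q \<in> D" for Q
  proof -
    have "(matrix_sqrt (average Q W) ** matrix_sqrt (average Q V)) *v v = 0" for v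
      using A scalar_A_infinity_less_1[OF V _ Q] scalar_A_infinity_less_1[OF W _ Q]
      by (auto simp: matrix_vector_mul_assoc[symmetric])
    then show ?thesis by (simp add: matrix_opnorm_def onorm_zero)
  qed
  then have "joint_A2 D V W = (SUP Q\<in>D. 0)" unfolding joint_A2_def by (intro SUP_cong) auto
  then show ?thesis using cube_mem by (simp add: SUP_constant bot_ennreal)
qed

text \<open>
  The strict bounds \<open>AV\<close> and \<open>AW\<close> leave room for the infimum in the definition of the characteristic. The
  loss \<open>\<eta>\<close> from regularizing the averages tends to zero.
\<close>

lemma weighted_norm_estimate:
  fixes T :: "(real ^ 'n \<Rightarrow> 'k::real_or_complex) \<Rightarrow> real ^ 'n \<Rightarrow> 'k"
    and V W :: "real ^ 'n \<Rightarrow> 'k ^ 'd ^ 'd"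
  assumes s: "0 < s" and c: "good_blocks s c B" and T: "L2_bounded T"
    and sum: "L2_operator_sum D (block_operator s c) T"
    and V: "matrix_weight V" and W: "matrix_weight W"
    and AV: "scalar_A_infinity D V < ennreal AV" "0 < AV"
    and AW: "scalar_A_infinity D W < ennreal AW" "0 < AW"
    and K: "joint_A2 D V W \<le> ennreal K" "0 \<le> K"
  shows "L2_operator_norm (mult_sqrt W \<circ> componentwise T \<circ> mult_sqrt V) \<le>
    ennreal (32 * real s * real CARD('d) * B * (2 ^ (s * CARD('n)))\<^sup>2 * sqrt (K * (4 * AV + 1) * (4 * AW + 1)))"
proof -
  define C where "C = 32 * real s * real CARD('d) * B * (2 ^ (s * CARD('n)))\<^sup>2"
  define Y where "Y = (4 * AV + 1) * (4 * AW + 1)"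
  have C: "0 \<le> C" using c by (simp add: C_def good_blocks_def)
  have Y: "0 \<le> Y" using AV AW by (simp add: Y_def)
  have AV': "A_infinity D (\<lambda>x. (V x *v e) \<bullet> e) < ennreal AV" for e
    using AV(1) unfolding scalar_A_infinity_def by (rule le_less_trans[OF SUP_upper, rotated]) simp
  have AW': "A_infinity D (\<lambda>x. (W x *v e) \<bullet> e) < ennreal AW" for e
    using AW(1) unfolding scalar_A_infinity_def by (rule le_less_trans[OF SUP_upper, rotated]) simp
  have K': "(matrix_opnorm (matrix_sqrt (average Q W) ** matrix_sqrt (average Q V)))\<^sup>2 \<le> K" if "Q \<in> D" for Q
  proof -
    have "ennreal ((matrix_opnorm (matrix_sqrt (average Q W) ** matrix_sqrt (average Q V)))\<^sup>2) \<le> joint_A2 D V W"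
      unfolding joint_A2_def using that by (rule SUP_upper)
    then have "ennreal ((matrix_opnorm (matrix_sqrt (average Q W) ** matrix_sqrt (average Q V)))\<^sup>2) \<le> ennreal K"
      using K(1) by (rule order_trans)
    then show ?thesis using K(2) by (simp add: ennreal_le_iff)
  qed
  have main: "in_L2 ((mult_sqrt W \<circ> componentwise T \<circ> mult_sqrt V) f) \<and>
    L2_norm ((mult_sqrt W \<circ> componentwise T \<circ> mult_sqrt V) f) \<le> C * sqrt (K * Y) * L2_norm f"
    if f: "f \<in> borel_measurable lebesgue" "bounded (range f)" "bounded {x. f x \<noteq> 0}" for f
  proof -
    define F where "F x = matrix_sqrt (V x) *v f x" for x
    define u where "u = componentwise T F"
    have fL: "in_L2 f" by (rule bounded_compact_support_in_L2(1)[OF f V])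
    have F: "in_L2 (\<lambda>x. matrix_sqrt (V x) *v f x)" by (rule bounded_compact_support_in_L2(2)[OF f V])
    then have FL: "in_L2 F" by (simp add: F_def[abs_def])
    have u: "in_L2 u" unfolding u_def by (rule in_L2_componentwise[OF T FL])
    have dual: "\<bar>LINT x|lebesgue. u x \<bullet> (matrix_sqrt (W x) *v g x)\<bar> \<le> C * sqrt (K * Y) * L2_norm f * L2_norm g"
      if g: "g \<in> borel_measurable lebesgue" "bounded (range g)" "bounded {x. g x \<noteq> 0}" for g
    proof -
      have gL: "in_L2 g" by (rule bounded_compact_support_in_L2(1)[OF g W])
      have G: "in_L2 (\<lambda>x. matrix_sqrt (W x) *v g x)" by (rule bounded_compact_support_in_L2(2)[OF g W])
      have step: "\<bar>LINT x|lebesgue. u x \<bullet> (matrix_sqrt (W x) *v g x)\<bar> \<le> C * sqrt ((K + \<eta>) * Y) * L2_norm f * L2_norm g"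
        if \<eta>: "0 < \<eta>" for \<eta>
        unfolding u_def
      proof (rule bilinear_form_bound[OF T sum FL G])
        fix \<Q> assume \<Q>: "finite \<Q>" "\<Q> \<subseteq> D"
        show "(\<Sum>Q\<in>\<Q>. \<bar>block_form (mat 1) (descendants D s Q) (c Q) F (\<lambda>x. matrix_sqrt (W x) *v g x)\<bar>)
          \<le> C * sqrt ((K + \<eta>) * Y) * L2_norm f * L2_norm g"
          using weighted_block_sum_estimate[OF s c V W fL F gL G AV' AV(2) AW' AW(2) K' \<eta> \<Q>]
          by (simp add: C_def Y_def F_def[abs_def] mult_ac)
      qed
      have "(\<lambda>n. C * sqrt ((K + inverse (real (Suc n))) * Y) * L2_norm f * L2_norm g)
        \<longlonglongrightarrow> C * sqrt ((K + 0) * Y) * L2_norm f * L2_norm g"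
        by (intro tendsto_intros LIMSEQ_inverse_real_of_nat)
      then have "\<bar>LINT x|lebesgue. u x \<bullet> (matrix_sqrt (W x) *v g x)\<bar> \<le> C * sqrt ((K + 0) * Y) * L2_norm f * L2_norm g"
        by (rule LIMSEQ_le_const) (auto intro!: exI[of _ 0] step)
      then show ?thesis by simp
    qed
    have um: "u \<in> borel_measurable lebesgue" using u by (simp add: in_L2_def)
    have X0: "0 \<le> C * sqrt (K * Y) * L2_norm f" using C K Y L2_norm_nonneg[of f] by simp
    note L2_bound_by_duality[OF W um X0 dual]
    moreover have "(mult_sqrt W \<circ> componentwise T \<circ> mult_sqrt V) f = (\<lambda>x. matrix_sqrt (W x) *v u x)"
      by (simp add: u_def F_def[abs_def] mult_sqrt_def[abs_def] o_def)
    ultimately show ?thesis by simp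
  qed
  have "L2_operator_norm (mult_sqrt W \<circ> componentwise T \<circ> mult_sqrt V) \<le> ennreal (C * sqrt (K * Y))"
    unfolding L2_operator_norm_def
  proof (rule Inf_lower, rule imageI, rule CollectI, intro conjI allI impI)
    show "0 \<le> C * sqrt (K * Y)" using C K Y by simp
  qed (use main in auto)
  then show ?thesis by (simp add: C_def Y_def mult.assoc)
qed

end

theorem theorem1p2:
  fixes D :: "(real ^ 'n) set set"
    and T :: "(real ^ 'n \<Rightarrow> 'k::real_or_complex) \<Rightarrow> real ^ 'n \<Rightarrow> 'k"
  assumes "dyadic_lattice D"
    and "(\<exists>r. big_haar_shift D r T) \<or> (\<exists>r b. bounded_paraproduct D r b T)"
  shows "\<exists>C\<ge>0. \<forall>V W :: real ^ 'n \<Rightarrow> 'k ^ 'd ^ 'd.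
           matrix_weight V \<and> matrix_weight W \<and> joint_A2 D V W < \<infinity> \<and>
           scalar_A_infinity D V < \<infinity> \<and> scalar_A_infinity D W < \<infinity> \<longrightarrow>
           (L2_operator_norm (mult_sqrt W \<circ> componentwise T \<circ> mult_sqrt V))\<^sup>2
             \<le> ennreal C * scalar_A_infinity D V * scalar_A_infinity D W * joint_A2 D V W"
proof -
  obtain a where "D = {(\<lambda>x. x + a) ` standard_dyadic_cube k m | k m. True}"
    using assms(1) unfolding dyadic_lattice_def by blast
  then interpret dyadic_grid D a
    by unfold_locales (simp add: translate_standard_dyadic_cube)
  have "\<exists>r c B. good_blocks (r + 1) c B \<and> L2_bounded T \<and> L2_operator_sum D (block_operator (r + 1) c) T"
    using assms(2)
  proof (elim disjE exE)
    fix r assume "big_haar_shift D r T"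
    then show ?thesis by (rule big_haar_shift_blocks) (intro exI conjI)
  next
    fix r b assume "bounded_paraproduct D r b T"
    then show ?thesis by (rule bounded_paraproduct_blocks) (intro exI conjI)
  qed
  then obtain r c B where c: "good_blocks (r + 1) c B" and T: "L2_bounded T"
    and sum: "L2_operator_sum D (block_operator (r + 1) c) T" by (elim exE conjE)
  define s where "s = r + 1"
  have s: "0 < s" and c: "good_blocks s c B" and sum: "L2_operator_sum D (block_operator s c) T"
    using c sum by (auto simp: s_def)
  define C where "C = 32 * real s * real CARD('d) * B * (2 ^ (s * CARD('n)))\<^sup>2"
  have C: "0 \<le> C" using c by (simp add: C_def good_blocks_def)
  show ?thesis
  proof (intro exI[of _ "81 * C\<^sup>2"] conjI allI impI, simp)
    fix V W :: "real ^ 'n \<Rightarrow> 'k ^ 'd ^ 'd"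
    assume *: "matrix_weight V \<and> matrix_weight W \<and> joint_A2 D V W < \<infinity> \<and>
      scalar_A_infinity D V < \<infinity> \<and> scalar_A_infinity D W < \<infinity>"
    then have V: "matrix_weight V" and W: "matrix_weight W" by auto
    obtain K where K: "joint_A2 D V W = ennreal K" "0 \<le> K"
      using * by (cases "joint_A2 D V W") auto
    obtain AV where AV: "scalar_A_infinity D V = ennreal AV" "0 \<le> AV"
      using * by (cases "scalar_A_infinity D V") auto
    obtain AW where AW: "scalar_A_infinity D W = ennreal AW" "0 \<le> AW"
      using * by (cases "scalar_A_infinity D W") auto
    let ?A = "L2_operator_norm (mult_sqrt W \<circ> componentwise T \<circ> mult_sqrt V)"
    have "?A \<le> ennreal (C * sqrt (K * (4 * (AV + 1) + 1) * (4 * (AW + 1) + 1)))"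
      unfolding C_def
      by (rule weighted_norm_estimate[OF s c T sum V W]) (use AV AW K in \<open>auto simp: ennreal_less_iff\<close>)
    also have "\<dots> \<le> ennreal (C * sqrt (K * (9 * AV) * (9 * AW)))"
    \<comment> \<open>The estimate above involves \<open>4 (AV + 1) + 1\<close>, which is at most \<open>9 AV\<close> only for \<open>AV \<ge> 1\<close>; otherwise a weight vanishes and so does \<open>K\<close>.\<close>
    proof (cases "AV < 1 \<or> AW < 1")
      case True
      then have "joint_A2 D V W = 0"
        using AV AW by (intro joint_A2_eq_0[OF V W]) (auto simp: ennreal_less_one_iff)
      then have "K = 0" using K by (simp add: ennreal_eq_0_iff)
      then show ?thesis by simp
    next
      case False
      then show ?thesis using C K
        by (intro ennreal_leI mult_left_mono real_sqrt_le_mono mult_mono mult_nonneg_nonneg) auto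
    qed
    finally have "?A\<^sup>2 \<le> (ennreal (C * sqrt (K * (9 * AV) * (9 * AW))))\<^sup>2"
      by (rule power_mono) simp
    also have "\<dots> = ennreal ((C * sqrt (K * (9 * AV) * (9 * AW)))\<^sup>2)"
      using C K AV AW by (intro ennreal_power) auto
    also have "(C * sqrt (K * (9 * AV) * (9 * AW)))\<^sup>2 = 81 * C\<^sup>2 * AV * AW * K"
      using K AV AW by (simp add: power_mult_distrib)
    also have "ennreal \<dots> = ennreal (81 * C\<^sup>2) * scalar_A_infinity D V * scalar_A_infinity D W * joint_A2 D V W"
      using K AV AW by (simp add: ennreal_mult)
    finally show "?A\<^sup>2 \<le> ennreal (81 * C\<^sup>2) * scalar_A_infinity D V * scalar_A_infinity D W * joint_A2 D V W" .
  qed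
qed

end
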